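(* Let $|A|<1$ and $0<\alpha<1$. For $\mathscr{D}=\mathbb{R}^2$, the triple $\breve z_{A,\alpha}=(\breve\theta_{A,\alpha},\breve{\mathbf{u}}_{A,\alpha},\breve{\mathbf{m}}_{A,\alpha})$ given by $$\breve\theta_{A,\alpha}(t)=\Theta_A(\alpha t)\ (t\in\mathbb{R}_+),\qquad \breve{\mathbf{u}}_{A,\alpha}=0,\qquad \breve{\mathbf{m}}_{A,\alpha}=-\alpha\frac{1-\breve\theta_{A,\alpha}^2}{1-A\breve\theta_{A,\alpha}}\,\mathbf{i}$$ is an admissible subsolution to $(\mathrm{IPM}_A)$, starting from the planar phase $\theta_0=\pm1$ for $\pm x_2>0$, with respect to $$\Omega_{\rm mix}=\{(t,x)\in\mathbb{R}_+\times\mathscr{D}: -\alpha c_A^-t<x_2<\alpha c_A^+t\}.$$ For $\mathscr{D}=(-1,1)^2$ the same holds (with $\Theta_A$ the confined profile defined in the context), except that the formula $\Omega_{\rm mix}(t)=\{x\in\mathscr{D}: -\alpha c_A^-t<x_2<\alpha c_A^+t\}$ is only valid until $\Omega_{\rm mix}(t)$ meets either the lower or the upper boundary of $(-1,1)^2$; after this, the mixing zone is $\Omega_{\rm mix}(t)=\{x\in\mathscr{D}:\ell^-(\alpha t)<x_2<\ell^+(\alpha t)\}$ for $0<\alpha t<t_A$, where from the time $\alpha t=1/c_A^\pm$ on the boundary $\ell^\pm(\alpha t)$ moves monotonically from $\pm1$ towards $0$, until the mixing zone collapses at the finite time $\alpha t=t_A$ and the stable planar phase ($\breve\theta_{A,\alpha}=\mp1$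 for $\pm x_2>0$) is reached.
   Context: $\mathbb{R}_+=[0,\infty)$, $\mathbf{i}=(0,1)$, $\nabla^\perp=(-\partial_{x_2},\partial_{x_1})$, $L^\infty_{w^*}$ is $L^\infty$ with the weak* topology, $\Omega_{\rm mix}(t)=\{x:(t,x)\in\Omega_{\rm mix}\}$, $c_A^\pm=\frac{2}{1\mp A}$. $(\mathrm{IPM}_A)$: $\partial_t\theta+\nabla\cdot(\theta\mathbf{u})=0$, $\nabla\cdot\mathbf{u}=0$, $\mathbf{u}+A\theta\mathbf{u}+\theta\mathbf{i}=-\nabla p$. $\mathcal{U}_A$ is the open set of $z=(\theta,\mathbf{u},\mathbf{m})\in[-1,1]\times\mathbb{R}^2\times\mathbb{R}^2$ with $|2(1-\theta A)(\mathbf{m}-\theta\mathbf{u})+(1-\theta^2)(A\mathbf{u}+\mathbf{i})|<(1-\theta^2)|A\mathbf{u}+\mathbf{i}|$; $\bar{\mathcal{U}}_A$ is its closure. $L^\infty_{\mathbf S}(\mathscr{D};\bar{\mathcal{U}}_A)$ is the set of $\bar{\mathcal{U}}_A$-valued $z\in L^\infty_{w^*}(\mathscr{D})$ with $\int_{\mathscr{D}}\mathbf{u}\cdot\nabla\phi\,dx=0$ for all $\phi\in C^1_c(\bar{\mathscr{D}})$ and $\int_{\mathscr{D}}(\mathbf{u}+A\mathbf{m}+\theta\mathbf{i})\cdot\nabla^\perp\psi\,dx=0$ for all $\psi\in C^1_c(\mathscr{D})$. A subsolution (on $\mathbb{R}_+$) starting from $\theta_0\in L^\infty(\mathscr{D};[-1,1])$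 is $\breve z=(\breve\theta,\breve{\mathbf{u}},\breve{\mathbf{m}})\in C(\mathbb{R}_+;L^\infty_{\mathbf S}(\mathscr{D};\bar{\mathcal{U}}_A))$ such that for each $t\ge0$, $\int_0^t\int_{\mathscr{D}}(\breve\theta\partial_t\phi+\breve{\mathbf{m}}\cdot\nabla\phi)\,dx\,d\tau=\int_{\mathscr{D}}\breve\theta(t)\phi(t)\,dx-\int_{\mathscr{D}}\theta_0\phi(0)\,dx$ for all $\phi\in C^1_c(\mathbb{R}_+\times\bar{\mathscr{D}})$. It is admissible w.r.t. an open set $\emptyset\ne\Omega_{\rm mix}\subset\mathbb{R}_+\times\mathscr{D}$ if $\breve z\in C(\Omega_{\rm mix};\mathcal{U}_A)$ (continuous with values in $\mathcal{U}_A$), and for all $t$, $\breve{\mathbf{m}}=\breve\theta\breve{\mathbf{u}}$ and $|\breve\theta|=1$ a.e. in $\mathscr{D}\setminus\Omega_{\rm mix}(t)$. The function $\Theta_A$ for $\mathscr{D}=\mathbb{R}^2$: $\Theta_A(0,x)=\pm1$ for $\pm x_2>0$, and for $t>0$: $\Theta_A(t,x)=+1$ if $x_2>c_A^+t$; $\Theta_A(t,x)=-1$ if $x_2<-c_A^-t$; and for $-c_A^-t<x_2<c_A^+t$ $$\Theta_A(t,x)=\vartheta_A(t,x_2):=\frac{x_2+At}{t+Ax_2+\sqrt{(1-A^2)t(t+Ax_2)}}.$$ For $\mathscr{D}=(-1,1)^2$: let $f^\pm$ be the unique solutions of $\dot f^\pm(t)=\frac{1\mp\vartheta_A(t,\pm(1-f^\pm(t)))}{1-A\,\vartheta_A(t,\pm(1-f^\pm(t)))}$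 for $t\ge1/c_A^\pm$, with $f^\pm(1/c_A^\pm)=0$; $t_A<\infty$ denotes the common time at which $f^+$ and $f^-$ reach the value $1$. Put $\ell^\pm(t)=\pm c_A^\pm t$ for $0\le t\le1/c_A^\pm$ and $\ell^\pm(t)=\pm(1-f^\pm(t))$ for $1/c_A^\pm\le t\le t_A$. Then $\Theta_A(0,x)=\pm1$ for $\pm x_2>0$; for $0<t<t_A$, $\Theta_A(t,x)=\vartheta_A(t,x_2)$ if $\ell^-(t)<x_2<\ell^+(t)$; for $x_2>\ell^+(t)$, $\Theta_A=+1$ if $c_A^+t\le1$ and $-1$ if $c_A^+t>1$; for $x_2<\ell^-(t)$, $\Theta_A=-1$ if $c_A^-t\le1$ and $+1$ if $c_A^-t>1$; for $t\ge t_A$, $\Theta_A=\mp1$ for $\pm x_2>0$. *)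

theory Defs
  imports "HOL-Analysis.Analysis"
begin

text \<open>
  The plane is \<^typ>\<open>real \<times> real\<close> with its Euclidean norm; \<open>fst x\<close> and \<open>snd x\<close> are the coordinates
  \<open>x\<^sub>1\<close> and \<open>x\<^sub>2\<close>. A state is \<open>(\<theta>, u, m)\<close>. Elements of \<open>L\<^sup>\<infinity>\<close> are represented by functions, all
  conditions on them being imposed almost everywhere.
\<close>

type_synonym plane = "real \<times> real"
type_synonym state = "real \<times> plane \<times> plane"

definition e_vert :: plane where
  "e_vert = (0, 1)"

abbreviation theta_of :: "state \<Rightarrow> real" where "theta_of z \<equiv> fst z"
abbreviation u_of :: "state \<Rightarrow> plane" where "u_of z \<equiv> fst (snd z)"
abbreviation m_of :: "state \<Rightarrow> plane" where "m_of z \<equiv> snd (snd z)"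

definition perp :: "plane \<Rightarrow> plane" where
  "perp g = (- snd g, fst g)"

definition open_square :: "plane set" where
  "open_square = {-1<..<1} \<times> {-1<..<1}"

text \<open>
  \<open>C1c S \<phi> D\<phi>\<close>: \<open>\<phi>\<close> belongs to \<open>C\<^sup>1\<^sub>c(S)\<close> and has gradient \<open>D\<phi>\<close> there. For \<open>S\<close> not open (such as
  \<open>closure \<D>\<close> or \<open>[0,\<infinity>) \<times> closure \<D>\<close>) derivatives are taken within \<open>S\<close> and are continuous up to the
  boundary, and the support may touch the boundary.
\<close>

definition C1c :: "'a::euclidean_space set \<Rightarrow> ('a \<Rightarrow> real) \<Rightarrow> ('a \<Rightarrow> 'a) \<Rightarrow> bool" where
  "C1c S \<phi> D\<phi> \<longleftrightarrow>
     (\<forall>x\<in>S. (\<phi> has_derivative (\<lambda>h. D\<phi> x \<bullet> h)) (at x within S)) \<and>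
     continuous_on S D\<phi> \<and>
     compact (closure {x \<in> S. \<phi> x \<noteq> 0}) \<and> closure {x \<in> S. \<phi> x \<noteq> 0} \<subseteq> S"

definition U_set :: "real \<Rightarrow> state set" where
  "U_set A = {(\<theta>, u, m). -1 \<le> \<theta> \<and> \<theta> \<le> 1 \<and>
     norm ((2 * (1 - \<theta> * A)) *\<^sub>R (m - \<theta> *\<^sub>R u) + (1 - \<theta>\<^sup>2) *\<^sub>R (A *\<^sub>R u + e_vert))
       < (1 - \<theta>\<^sup>2) * norm (A *\<^sub>R u + e_vert)}"

definition Linf :: "plane set \<Rightarrow> (plane \<Rightarrow> state) set" where
  "Linf D = {z. z \<in> borel_measurable (lebesgue_on D) \<and>
                (\<exists>C. AE x in lebesgue_on D. norm (z x) \<le> C)}"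

text \<open>The weak* topology on \<open>L\<^sup>\<infinity>(\<D>)\<close> as the dual of \<open>L\<^sup>1(\<D>)\<close>.\<close>

definition weak_star :: "plane set \<Rightarrow> (plane \<Rightarrow> state) topology" where
  "weak_star D = topology_generated_by
     {{z \<in> Linf D. (\<integral>x. z x \<bullet> g x \<partial>lebesgue_on D) \<in> V} | g V.
        integrable (lebesgue_on D) g \<and> open V}"

definition Linf_S :: "real \<Rightarrow> plane set \<Rightarrow> (plane \<Rightarrow> state) set" where
  "Linf_S A D = {z \<in> Linf D.
     (AE x in lebesgue_on D. z x \<in> closure (U_set A)) \<and>
     (\<forall>\<phi> D\<phi>. C1c (closure D) \<phi> D\<phi> \<longrightarrow>
        (\<integral>x. u_of (z x) \<bullet> D\<phi> x \<partial>lebesgue_on D) = 0) \<and>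
     (\<forall>\<psi> D\<psi>. C1c D \<psi> D\<psi> \<longrightarrow>
        (\<integral>x. (u_of (z x) + A *\<^sub>R m_of (z x) + theta_of (z x) *\<^sub>R e_vert) \<bullet> perp (D\<psi> x)
           \<partial>lebesgue_on D) = 0)}"

text \<open>
  Test functions \<open>\<phi>\<close> of \<open>(t, x)\<close> have gradient \<open>D\<phi> = (\<partial>\<^sub>t\<phi>, \<nabla>\<phi>)\<close>.
\<close>

definition subsolution ::
  "real \<Rightarrow> plane set \<Rightarrow> (plane \<Rightarrow> real) \<Rightarrow> (real \<Rightarrow> plane \<Rightarrow> state) \<Rightarrow> bool" where
  "subsolution A D \<theta>0 z \<longleftrightarrow>
     \<theta>0 \<in> borel_measurable (lebesgue_on D) \<and>
     (AE x in lebesgue_on D. -1 \<le> \<theta>0 x \<and> \<theta>0 x \<le> 1) \<and>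
     continuous_map (top_of_set {0..}) (subtopology (weak_star D) (Linf_S A D)) z \<and>
     (\<forall>t\<ge>0. \<forall>\<phi> D\<phi>. C1c ({0..} \<times> closure D) \<phi> D\<phi> \<longrightarrow>
        (\<integral>\<tau>. (\<integral>x. theta_of (z \<tau> x) * fst (D\<phi> (\<tau>, x)) + m_of (z \<tau> x) \<bullet> snd (D\<phi> (\<tau>, x))
               \<partial>lebesgue_on D) \<partial>lebesgue_on {0..t})
        = (\<integral>x. theta_of (z t x) * \<phi> (t, x) \<partial>lebesgue_on D)
          - (\<integral>x. \<theta>0 x * \<phi> (0, x) \<partial>lebesgue_on D))"

text \<open>The time slice \<open>\<Omega>(t)\<close> is the relational image \<open>\<Omega> `` {t}\<close>.\<close>

definition admissible ::
  "real \<Rightarrow> plane set \<Rightarrow> (real \<Rightarrow> plane \<Rightarrow> state) \<Rightarrow> (real \<times> plane) set \<Rightarrow> bool" where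
  "admissible A D z \<Omega> \<longleftrightarrow>
     openin (top_of_set ({0..} \<times> D)) \<Omega> \<and> \<Omega> \<noteq> {} \<and>
     continuous_on \<Omega> (\<lambda>(t, x). z t x) \<and> (\<forall>(t, x)\<in>\<Omega>. z t x \<in> U_set A) \<and>
     (\<forall>t\<ge>0. AE x in lebesgue_on (D - \<Omega> `` {t}).
        m_of (z t x) = theta_of (z t x) *\<^sub>R u_of (z t x) \<and> \<bar>theta_of (z t x)\<bar> = 1)"

definition planar :: "plane \<Rightarrow> real" where
  "planar x = sgn (snd x)"

text \<open>
  Superscripts \<open>\<plusminus>\<close> are encoded by a real argument \<open>s\<close> taking the values \<open>1\<close> and \<open>-1\<close>.
\<close>

definition c_speed :: "real \<Rightarrow> real \<Rightarrow> real" where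
  "c_speed A s = 2 / (1 - s * A)"

definition vartheta :: "real \<Rightarrow> real \<Rightarrow> real \<Rightarrow> real" where
  "vartheta A t y = (y + A * t) / (t + A * y + sqrt ((1 - A\<^sup>2) * t * (t + A * y)))"

text \<open>
  The values of the profiles on the null sets left unspecified in the mathematical text are
  immaterial: on the interfaces they are given by \<^const>\<open>vartheta\<close>, and at \<open>t = 0\<close> (and after the
  collapse, for the square) they vanish on the line \<open>x\<^sub>2 = 0\<close>.
\<close>

definition Theta_plane :: "real \<Rightarrow> real \<Rightarrow> plane \<Rightarrow> real" where
  "Theta_plane A t x =
     (if t \<le> 0 then planar x
      else if snd x > c_speed A 1 * t then 1
      else if snd x < - c_speed A (-1) * t then -1
      else vartheta A t (snd x))"

text \<open>
  Outside the interval on which the differential equation is posed, \<open>f\<close> is normalised by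
  \<^const>\<open>extensional\<close>, so that uniqueness makes sense for total functions.
\<close>

definition is_front :: "real \<Rightarrow> real \<Rightarrow> (real \<Rightarrow> real) \<Rightarrow> bool" where
  "is_front A s f \<longleftrightarrow>
     f \<in> extensional {1 / c_speed A s..} \<and> f (1 / c_speed A s) = 0 \<and>
     (\<forall>t \<ge> 1 / c_speed A s.
        (f has_real_derivative
           (1 - s * vartheta A t (s * (1 - f t))) / (1 - A * vartheta A t (s * (1 - f t))))
        (at t within {1 / c_speed A s..}))"

definition front :: "real \<Rightarrow> real \<Rightarrow> real \<Rightarrow> real" where
  "front A s = (THE f. is_front A s f)"

definition is_collapse_time :: "real \<Rightarrow> real \<Rightarrow> bool" where
  "is_collapse_time A t \<longleftrightarrow> (\<forall>s\<in>{1, -1}. t \<ge> 1 / c_speed A s \<and> front A s t = 1)"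

definition collapse_time :: "real \<Rightarrow> real" where
  "collapse_time A = (THE t. is_collapse_time A t)"

definition ell :: "real \<Rightarrow> real \<Rightarrow> real \<Rightarrow> real" where
  "ell A s t = (if t \<le> 1 / c_speed A s then s * c_speed A s * t else s * (1 - front A s t))"

definition Theta_square :: "real \<Rightarrow> real \<Rightarrow> plane \<Rightarrow> real" where
  "Theta_square A t x =
     (if t \<le> 0 then planar x
      else if t < collapse_time A then
        (if snd x > ell A 1 t then (if c_speed A 1 * t \<le> 1 then 1 else -1)
         else if snd x < ell A (-1) t then (if c_speed A (-1) * t \<le> 1 then -1 else 1)
         else vartheta A t (snd x))
      else - planar x)"

definition z_breve ::
  "(real \<Rightarrow> real \<Rightarrow> plane \<Rightarrow> real) \<Rightarrow> real \<Rightarrow> real \<Rightarrow> real \<Rightarrow> plane \<Rightarrow> state" where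
  "z_breve \<Theta> A \<alpha> t x =
     (let \<theta> = \<Theta> A (\<alpha> * t) x
      in (\<theta>, 0, (- \<alpha> * ((1 - \<theta>\<^sup>2) / (1 - A * \<theta>))) *\<^sub>R e_vert))"

definition mix_plane :: "real \<Rightarrow> real \<Rightarrow> (real \<times> plane) set" where
  "mix_plane A \<alpha> = {(t, x). 0 \<le> t \<and>
     - \<alpha> * c_speed A (-1) * t < snd x \<and> snd x < \<alpha> * c_speed A 1 * t}"

definition mix_square :: "real \<Rightarrow> real \<Rightarrow> (real \<times> plane) set" where
  "mix_square A \<alpha> = {(t, x). 0 < \<alpha> * t \<and> \<alpha> * t < collapse_time A \<and> x \<in> open_square \<and>
     ell A (-1) (\<alpha> * t) < snd x \<and> snd x < ell A 1 (\<alpha> * t)}"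

end

theory Submission
  imports Defs
begin

text \<open>
  With the convex flux \<open>G(a) = - (1 - a\<^sup>2) / (1 - A a)\<close>, the profile \<open>\<vartheta>\<close> is determined by
  \<open>y = t G'(\<vartheta>)\<close>, so the plane profile at \<open>(t, y)\<close> is the slope \<open>a\<close> that attains
  \<open>\<Psi>(t, y) = max {a y - t G(a) | \<bar>a\<bar> \<le> 1}\<close>. Maximality is a subgradient inequality for \<open>\<Psi>\<close>, whence
  \<open>\<partial>\<^sub>y \<Psi> = \<theta>\<close> and \<open>\<partial>\<^sub>t \<Psi> = - G(\<theta>)\<close>: the conservation law says that \<open>\<theta>\<close> and the flux derive from one
  Lipschitz potential. For the square the potential is \<open>min \<Psi> (2 - \<bar>y\<bar>)\<close>; the reflected fronts are
  the curves where both branches agree, which determines them in closed form and gives the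
  collapse time \<open>1 + sqrt (1 - A\<^sup>2)\<close>.
\<close>

section \<open>The rarefaction fan and its potential\<close>

text \<open>Where the stable phase prevails the slope is \<open>- sgn y\<close> and the flux
  vanishes, so the potential does not change in time and is a constant minus
  \<open>\<bar>y\<bar>\<close>. The constant is \<open>2\<close> because no mass crosses a wall: the
  potential keeps its initial value \<open>1\<close> at \<open>y = 1\<close> and
  \<open>y = -1\<close>. Equality of the two branches, differentiated along a reflected front, is
  the Rankine-Hugoniot condition, and this is the differential equation of the front; hence the
  level set of the potential and the solution of the equation are the same curve. The factor
  \<alpha> acts twice, by slowing the clock of the profile and by multiplying the flux, so that the
  conservation law persists; in the hull it leaves only the condition
  \<open>\<bar>1 - 2 * \<alpha>\<bar> < 1\<close>. The lower half of the square is reduced to the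
  upper half by the symmetry that changes the signs of \<open>A\<close>, \<open>y\<close> and
  \<open>\<theta>\<close>.\<close>

definition flux :: "real \<Rightarrow> real \<Rightarrow> real" where
  "flux A a = - ((1 - a\<^sup>2) / (1 - A * a))"

text \<open>The derivative of \<open>flux A\<close>; the ray \<open>y = t * fan_speed A a\<close>
  carries the constant value \<open>a\<close>.\<close>

definition fan_speed :: "real \<Rightarrow> real \<Rightarrow> real" where
  "fan_speed A a = (2 * a - A * a\<^sup>2 - A) / (1 - A * a)\<^sup>2"

lemma one_minus_mult_pos:
  fixes A a :: real
  assumes "\<bar>A\<bar> < 1" "\<bar>a\<bar> \<le> 1"
  shows "0 < 1 - A * a"
proof -
  have "\<bar>A * a\<bar> \<le> \<bar>A\<bar>" using assms by (simp add: abs_mult mult_left_le)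
  then show ?thesis using assms by linarith
qed

lemma flux_nonpos: "\<bar>A\<bar> < 1 \<Longrightarrow> \<bar>a\<bar> \<le> 1 \<Longrightarrow> flux A a \<le> 0"
  using one_minus_mult_pos[of A a] by (simp add: flux_def abs_square_le_1)

lemma flux_bound:
  assumes "\<bar>A\<bar> < 1" "\<bar>a\<bar> \<le> 1"
  shows "\<bar>flux A a\<bar> \<le> 1 / (1 - \<bar>A\<bar>)"
proof -
  have "A * a \<le> \<bar>A\<bar>"
    using one_minus_mult_pos assms abs_ge_self[of "A * a"] mult_left_le[of "\<bar>a\<bar>" "\<bar>A\<bar>"]
    by (simp add: abs_mult)
  moreover have "0 \<le> 1 - a\<^sup>2" "1 - a\<^sup>2 \<le> 1" using assms by (auto simp: abs_square_le_1)
  ultimately have "(1 - a\<^sup>2) / (1 - A * a) \<le> 1 / (1 - \<bar>A\<bar>)"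
    using assms by (intro frac_le) auto
  moreover have "0 \<le> (1 - a\<^sup>2) / (1 - A * a)"
    using one_minus_mult_pos[OF assms] \<open>0 \<le> 1 - a\<^sup>2\<close> by simp
  ultimately show ?thesis unfolding flux_def by linarith
qed

text \<open>Convexity is read off an exact identity: the gap between the flux and its tangent is
  \<open>(1 - A\<^sup>2) * (a - b)\<^sup>2\<close> over a positive denominator.\<close>

lemma flux_tangent:
  assumes "\<bar>A\<bar> < 1" "\<bar>a\<bar> \<le> 1" "\<bar>b\<bar> \<le> 1"
  shows "fan_speed A b * (a - b) \<le> flux A a - flux A b"
proof -
  have p: "0 < 1 - A * a" "0 < 1 - A * b" using one_minus_mult_pos assms by auto
  have "flux A a - flux A b - fan_speed A b * (a - b)
      = (1 - A\<^sup>2) * (a - b)\<^sup>2 / ((1 - A * a) * (1 - A * b)\<^sup>2)"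
    using p by (simp add: flux_def fan_speed_def divide_simps, simp add: power2_eq_square algebra_simps)
  also have "\<dots> \<ge> 0" using p assms by (simp add: abs_square_le_1)
  finally show ?thesis by simp
qed

lemma c_speed_pos: "\<bar>A\<bar> < 1 \<Longrightarrow> s \<in> {1, -1} \<Longrightarrow> 0 < c_speed A s"
  by (auto simp: c_speed_def)

lemma fan_speed_ends:
  assumes "\<bar>A\<bar> < 1"
  shows "fan_speed A 1 = c_speed A 1" "fan_speed A (-1) = - c_speed A (-1)"
proof -
  have nz: "1 - A \<noteq> 0" "1 + A \<noteq> 0" using assms by auto
  then show "fan_speed A 1 = c_speed A 1"
    by (simp add: fan_speed_def c_speed_def divide_simps) (simp add: power2_eq_square algebra_simps)
  show "fan_speed A (-1) = - c_speed A (-1)"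
    using nz by (simp add: fan_speed_def c_speed_def divide_simps) (simp add: power2_eq_square algebra_simps)
qed

lemma fan_nonempty: "\<bar>A\<bar> < 1 \<Longrightarrow> 0 \<le> t \<Longrightarrow> - c_speed A (-1) * t \<le> c_speed A 1 * t"
  using c_speed_pos[of A 1] c_speed_pos[of A "-1"] by (intro mult_right_mono) auto

text \<open>On a ray of the fan the radicand in \<open>vartheta\<close> is a perfect square, so the
  quotient becomes rational and reduces to \<open>a\<close>. Thus \<open>vartheta\<close> inverts
  the ray speed.\<close>

lemma vartheta_fan_speed:
  assumes A: "\<bar>A\<bar> < 1" and t: "0 < t" and a: "\<bar>a\<bar> \<le> 1"
  shows "vartheta A t (t * fan_speed A a) = a"
proof -
  have p: "0 < 1 - A * a" using one_minus_mult_pos A a by auto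
  have q: "0 < 1 - A\<^sup>2" using A by (simp add: abs_square_less_1)
  have D: "t + A * (t * fan_speed A a) = t * (1 - A\<^sup>2) / (1 - A * a)\<^sup>2"
    using p by (simp add: fan_speed_def divide_simps, simp add: power2_eq_square algebra_simps)
  have "(1 - A\<^sup>2) * t * (t * (1 - A\<^sup>2) / (1 - A * a)\<^sup>2) = (t * (1 - A\<^sup>2) / (1 - A * a))\<^sup>2"
    by (simp add: power2_eq_square)
  then have R: "sqrt ((1 - A\<^sup>2) * t * (t * (1 - A\<^sup>2) / (1 - A * a)\<^sup>2)) = t * (1 - A\<^sup>2) / (1 - A * a)"
    using p q t by simp
  have s: "t * (1 - A\<^sup>2) / (1 - A * a)\<^sup>2 + t * (1 - A\<^sup>2) / (1 - A * a)
      = t * (1 - A\<^sup>2) * (2 - A * a) / (1 - A * a)\<^sup>2"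
    using p by (simp add: divide_simps, simp add: power2_eq_square algebra_simps)
  have n: "t * fan_speed A a + A * t = a * (t * (1 - A\<^sup>2) * (2 - A * a) / (1 - A * a)\<^sup>2)"
    using p by (simp add: fan_speed_def divide_simps, simp add: power2_eq_square algebra_simps)
  have "t * (1 - A\<^sup>2) * (2 - A * a) / (1 - A * a)\<^sup>2 > 0" using t q p by simp
  then have "t * (1 - A\<^sup>2) * (2 - A * a) / (1 - A * a)\<^sup>2 \<noteq> 0" by (rule less_imp_neq[symmetric])
  then show ?thesis unfolding vartheta_def D R s n by (rule nonzero_mult_div_cancel_right)
qed

lemma fan_speed_surj:
  assumes A: "\<bar>A\<bar> < 1" and y: "- c_speed A (-1) \<le> \<xi>" "\<xi> \<le> c_speed A 1"
  obtains a where "\<bar>a\<bar> \<le> 1" "fan_speed A a = \<xi>"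
proof -
  have "continuous_on {-1..1} (fan_speed A)"
    unfolding fan_speed_def
  proof (intro continuous_intros ballI)
    fix a :: real assume "a \<in> {-1..1}"
    then have "0 < 1 - A * a" by (intro one_minus_mult_pos[OF A]) auto
    then show "(1 - A * a)\<^sup>2 \<noteq> 0" by simp
  qed
  then have "\<exists>a. -1 \<le> a \<and> a \<le> 1 \<and> fan_speed A a = \<xi>"
    using y fan_speed_ends[OF A] by (intro IVT') auto
  then show thesis using that by (metis abs_le_iff minus_le_iff)
qed

text \<open>The edges of the fan are the rays of \<open>a = 1\<close> and \<open>a = -1\<close>, so
  the intermediate value theorem puts every height between them on some ray, where
  \<open>vartheta\<close> is known.\<close>

lemma vartheta_in_fan:
  assumes A: "\<bar>A\<bar> < 1" and t: "0 < t" and y: "- c_speed A (-1) * t \<le> y" "y \<le> c_speed A 1 * t"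
  shows "\<bar>vartheta A t y\<bar> \<le> 1" "t * fan_speed A (vartheta A t y) = y"
proof -
  have "- c_speed A (-1) \<le> y / t" "y / t \<le> c_speed A 1" using t y by (auto simp: field_simps)
  then obtain a where a: "\<bar>a\<bar> \<le> 1" "fan_speed A a = y / t" by (rule fan_speed_surj[OF A])
  have "vartheta A t y = a" using vartheta_fan_speed[OF A t a(1)] a(2) t by simp
  then show "\<bar>vartheta A t y\<bar> \<le> 1" "t * fan_speed A (vartheta A t y) = y" using a t by auto
qed

lemma vartheta_strict:
  assumes A: "\<bar>A\<bar> < 1" and t: "0 < t" and y: "- c_speed A (-1) * t < y" "y < c_speed A 1 * t"
  shows "\<bar>vartheta A t y\<bar> < 1"
proof -
  have 1: "\<bar>vartheta A t y\<bar> \<le> 1" and 2: "t * fan_speed A (vartheta A t y) = y"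
    using vartheta_in_fan[OF A t] y by auto
  have "vartheta A t y \<noteq> 1" "vartheta A t y \<noteq> -1"
    using 2 fan_speed_ends[OF A] y by (auto simp: mult.commute)
  then show ?thesis using 1 by linarith
qed

text \<open>With \<open>a\<close> the value of \<open>vartheta\<close>, the expression equals
  \<open>t * (1 - A\<^sup>2) / (1 - A * a)\<^sup>2\<close>. This keeps the denominator of
  \<open>vartheta\<close> away from zero up to the edges of the fan.\<close>

lemma fan_radicand_pos:
  assumes A: "\<bar>A\<bar> < 1" and t: "0 < t" and y: "- c_speed A (-1) * t \<le> y" "y \<le> c_speed A 1 * t"
  shows "0 < t + A * y"
proof -
  let ?a = "vartheta A t y"
  have 1: "\<bar>?a\<bar> \<le> 1" and 2: "y = t * fan_speed A ?a"
    using vartheta_in_fan[OF A t] y by auto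
  have p: "0 < 1 - A * ?a" using one_minus_mult_pos A 1 by auto
  have q: "0 < 1 - A\<^sup>2" using A by (simp add: abs_square_less_1)
  have "t + A * (t * fan_speed A ?a) = t * (1 - A\<^sup>2) / (1 - A * ?a)\<^sup>2"
    using p by (simp add: fan_speed_def divide_simps, simp add: power2_eq_square algebra_simps)
  then have "t + A * y = t * (1 - A\<^sup>2) / (1 - A * ?a)\<^sup>2" using 2 by simp
  also have "\<dots> > 0" using p q t by simp
  finally show ?thesis .
qed

lemma vartheta_ends:
  assumes A: "\<bar>A\<bar> < 1" and t: "0 < t"
  shows "vartheta A t (c_speed A 1 * t) = 1" "vartheta A t (- c_speed A (-1) * t) = -1"
  using vartheta_fan_speed[OF A t, of 1] vartheta_fan_speed[OF A t, of "-1"] fan_speed_ends[OF A]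
  by (auto simp: mult.commute)

lemma continuous_on_vartheta:
  assumes A: "\<bar>A\<bar> < 1"
  shows "continuous_on {(t, y). 0 < t \<and> - c_speed A (-1) * t \<le> y \<and> y \<le> c_speed A 1 * t}
    (\<lambda>(t, y). vartheta A t y)"
proof -
  let ?S = "{(t, y). 0 < t \<and> - c_speed A (-1) * t \<le> y \<and> y \<le> c_speed A 1 * t}"
  have "fst p + A * snd p + sqrt ((1 - A\<^sup>2) * fst p * (fst p + A * snd p)) \<noteq> 0" if "p \<in> ?S" for p
  proof -
    from that have "0 < fst p" "0 < fst p + A * snd p" using fan_radicand_pos[OF A] by auto
    moreover have "0 < 1 - A\<^sup>2" using A by (simp add: abs_square_less_1)
    ultimately have "0 < fst p + A * snd p + sqrt ((1 - A\<^sup>2) * fst p * (fst p + A * snd p))"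
      by (simp add: add_pos_nonneg)
    then show ?thesis by simp
  qed
  then show ?thesis unfolding vartheta_def case_prod_beta by (intro continuous_intros) auto
qed

section \<open>The profile on the line and its convex potential\<close>

definition plane_profile :: "real \<Rightarrow> real \<Rightarrow> real \<Rightarrow> real" where
  "plane_profile A t y = (if t \<le> 0 then sgn y
      else if y > c_speed A 1 * t then 1
      else if y < - c_speed A (-1) * t then -1
      else vartheta A t y)"

lemma Theta_plane_eq_profile: "Theta_plane A t x = plane_profile A t (snd x)"
  by (simp add: Theta_plane_def plane_profile_def planar_def)

lemma plane_profile_bound: "\<bar>A\<bar> < 1 \<Longrightarrow> \<bar>plane_profile A t y\<bar> \<le> 1"
  using vartheta_in_fan(1)[of A t y] by (auto simp: plane_profile_def sgn_if)

text \<open>Clamping the height to the fan absorbs the two outer cases, because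
  \<open>vartheta\<close> takes the values \<open>1\<close> and \<open>-1\<close> on the edges.
  Joint continuity then becomes continuity of a composition.\<close>

lemma plane_profile_clamp:
  assumes A: "\<bar>A\<bar> < 1" and t: "0 < t"
  shows "plane_profile A t y = vartheta A t (max (- c_speed A (-1) * t) (min y (c_speed A 1 * t)))"
proof -
  have c: "0 < c_speed A 1 * t" "0 < c_speed A (-1) * t" using c_speed_pos[OF A] t by auto
  note e = vartheta_ends[OF A t]
  show ?thesis
  proof (cases "y > c_speed A 1 * t")
    case True
    then have "max (- c_speed A (-1) * t) (min y (c_speed A 1 * t)) = c_speed A 1 * t" using c by auto
    then show ?thesis using e True t by (simp add: plane_profile_def)
  next
    case False
    then have "min y (c_speed A 1 * t) = y" by simp
    then show ?thesis
      using t e False by (cases "y < - c_speed A (-1) * t") (simp_all add: plane_profile_def max_absorb1 max_absorb2)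
  qed
qed

lemma continuous_on_plane_profile:
  assumes A: "\<bar>A\<bar> < 1"
  shows "continuous_on {p. 0 < fst p} (\<lambda>p. plane_profile A (fst p) (snd p))"
proof -
  let ?c = "\<lambda>p. (fst p, max (- c_speed A (-1) * fst p) (min (snd p) (c_speed A 1 * fst p)))"
  have "continuous_on {p. 0 < fst p} ((\<lambda>(t, y). vartheta A t y) \<circ> ?c)"
  proof (rule continuous_on_compose)
    show "continuous_on {p::real\<times>real. 0 < fst p} ?c" by (intro continuous_intros)
    show "continuous_on (?c ` {p. 0 < fst p}) (\<lambda>(t, y). vartheta A t y)"
      using fan_nonempty[OF A] by (intro continuous_on_subset[OF continuous_on_vartheta[OF A]]) auto
  qed
  then show ?thesis
    by (rule continuous_on_eq) (auto simp: plane_profile_clamp[OF A])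
qed

lemma plane_profile_tendsto_time:
  assumes A: "\<bar>A\<bar> < 1" and t: "0 \<le> t" "t = 0 \<Longrightarrow> y \<noteq> 0"
  shows "((\<lambda>s. plane_profile A s y) \<longlongrightarrow> plane_profile A t y) (at t within {0..})"
proof (cases "t = 0")
  case True
  \<comment> \<open>At time zero the fan has width zero: a fixed height \<open>y \<noteq> 0\<close>
    lies outside it for all small times, where the profile is already \<open>sgn y\<close>.\<close>
  have "eventually (\<lambda>s. c_speed A 1 * s < \<bar>y\<bar> \<and> c_speed A (-1) * s < \<bar>y\<bar>) (at t within {0..})"
    using t True by (intro eventually_conj order_tendstoD(2)[where y = 0]) (auto intro!: tendsto_eq_intros)
  moreover have "eventually (\<lambda>s. s \<in> {0..}) (at t within {0..})"
    by (simp add: eventually_at_filter)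
  ultimately have "eventually (\<lambda>s. plane_profile A s y = sgn y) (at t within {0..})"
  proof eventually_elim
    case (elim s)
    have "0 < c_speed A 1" "0 < c_speed A (-1)" using c_speed_pos[OF A] by auto
    then have "0 \<le> c_speed A 1 * s" "0 \<le> c_speed A (-1) * s" using elim by auto
    then show ?case using elim by (cases "y > 0") (auto simp: plane_profile_def abs_if sgn_if)
  qed
  then show ?thesis using True by (simp add: plane_profile_def tendsto_eventually)
next
  case False
  then have "t > 0" using t by simp
  have "isCont (\<lambda>p. plane_profile A (fst p) (snd p)) (t, y)"
    using continuous_on_plane_profile[OF A] \<open>t > 0\<close>
    by (subst (asm) continuous_on_eq_continuous_at) (auto intro!: open_Collect_less continuous_intros)
  then have "((\<lambda>p. plane_profile A (fst p) (snd p)) \<longlongrightarrow> plane_profile A t y) (at (t, y))" by (simp add: isCont_def)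
  then have "((\<lambda>s. (\<lambda>p. plane_profile A (fst p) (snd p)) (s, y)) \<longlongrightarrow> plane_profile A t y) (at t)"
    using \<open>isCont _ (t, y)\<close>
    by (intro isCont_tendsto_compose[where g = "\<lambda>p. plane_profile A (fst p) (snd p)", THEN tendsto_eq_rhs]) (auto intro!: tendsto_intros)
  then show ?thesis by (simp add: tendsto_within_subset[where S = UNIV])
qed

lemma plane_profile_isCont_space:
  assumes A: "\<bar>A\<bar> < 1" and t: "0 < t"
  shows "isCont (plane_profile A t) y"
proof -
  have "isCont (\<lambda>p. plane_profile A (fst p) (snd p)) (t, y)"
    using continuous_on_plane_profile[OF A] t
    by (subst (asm) continuous_on_eq_continuous_at) (auto intro!: open_Collect_less continuous_intros)
  then have "((\<lambda>z. (\<lambda>p. plane_profile A (fst p) (snd p)) (t, z)) \<longlongrightarrow> plane_profile A t y) (at y)"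
    by (intro isCont_tendsto_compose[where g = "\<lambda>p. plane_profile A (fst p) (snd p)", THEN tendsto_eq_rhs]) (auto intro!: tendsto_intros)
  then show ?thesis by (simp add: isCont_def)
qed

text \<open>The Hopf-Lax value for the initial potential \<open>\<bar>y\<bar>\<close>, written with
  its maximiser inserted instead of a maximum.\<close>

definition plane_potential :: "real \<Rightarrow> real \<Rightarrow> real \<Rightarrow> real" where
  "plane_potential A t y = y * plane_profile A t y - t * flux A (plane_profile A t y)"

lemma plane_potential_max:
  assumes A: "\<bar>A\<bar> < 1" and t: "0 \<le> t" and a: "\<bar>a\<bar> \<le> 1"
  shows "y * a - t * flux A a \<le> plane_potential A t y"
proof (cases "t = 0")
  case True
  have "y * a \<le> \<bar>y\<bar>"
    using abs_ge_self[of "y * a"] mult_left_le[of "\<bar>a\<bar>" "\<bar>y\<bar>"] a by (simp add: abs_mult)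
  also have "\<dots> = y * sgn y" by (simp add: abs_sgn)
  finally show ?thesis using True by (simp add: plane_potential_def plane_profile_def)
next
  case False
  then have t: "0 < t" using t by simp
  let ?b = "plane_profile A t y"
  \<comment> \<open>Inside the fan \<open>y = t * fan_speed A ?b\<close> gives equality. Outside,
    \<open>?b\<close> is an end point of \<open>{-1..1}\<close>, so \<open>a - ?b\<close> has a
    fixed sign, and replacing \<open>y\<close> by the nearer edge of the fan can only increase the
    product.\<close>
  have "y * (a - ?b) \<le> t * fan_speed A ?b * (a - ?b)"
  proof -
    consider "y > c_speed A 1 * t" | "y < - c_speed A (-1) * t"
      | "- c_speed A (-1) * t \<le> y" "y \<le> c_speed A 1 * t" by linarith
    then show ?thesis
    proof cases
      case 1
      then have b: "?b = 1" using t by (auto simp: plane_profile_def)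
      show ?thesis unfolding b fan_speed_ends[OF A]
        using a 1 by (intro mult_right_mono_neg) (auto simp: mult.commute)
    next
      case 2
      have b: "?b = -1" using 2 t fan_nonempty[OF A, of t] by (auto simp: plane_profile_def)
      show ?thesis unfolding b fan_speed_ends[OF A]
        using a 2 by (intro mult_right_mono) (auto simp: mult.commute)
    next
      case 3
      then show ?thesis using t vartheta_in_fan(2)[OF A t 3] by (auto simp: plane_profile_def)
    qed
  qed
  also have "\<dots> \<le> t * (flux A a - flux A ?b)"
    using flux_tangent[OF A a plane_profile_bound[OF A], of t y] t by (simp add: mult.assoc mult_left_mono)
  finally show ?thesis by (simp add: plane_potential_def algebra_simps)
qed

lemma plane_potential_subgradient:
  assumes A: "\<bar>A\<bar> < 1" and t: "0 \<le> t'"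
  shows "plane_profile A t y * (y' - y) - flux A (plane_profile A t y) * (t' - t) \<le> plane_potential A t' y' - plane_potential A t y"
  using plane_potential_max[OF A t plane_profile_bound[OF A], of y' t y]
  by (simp add: plane_potential_def algebra_simps)

lemma plane_potential_lipschitz_time:
  assumes A: "\<bar>A\<bar> < 1" and t: "0 \<le> t" "0 \<le> t'"
  shows "\<bar>plane_potential A t' y - plane_potential A t y\<bar> \<le> 1 / (1 - \<bar>A\<bar>) * \<bar>t' - t\<bar>"
proof -
  let ?C = "1 / (1 - \<bar>A\<bar>)"
  have *: "\<bar>flux A (plane_profile A s y) * d\<bar> \<le> ?C * \<bar>d\<bar>" for s d
    unfolding abs_mult by (intro mult_right_mono flux_bound plane_profile_bound A) auto
  show ?thesis
    using plane_potential_subgradient[OF A t(2), of t y y] plane_potential_subgradient[OF A t(1), of t' y y]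
      *[of t "t' - t"] *[of t' "t - t'"] by (simp add: abs_le_iff abs_minus_commute)
qed

text \<open>The subgradient inequalities at \<open>x\<close> and at \<open>z\<close> enclose the
  difference quotient between \<open>g x\<close> and \<open>g z\<close>, and continuity of
  \<open>g\<close> closes the gap. This serves for both partial derivatives of the
  potential.\<close>

lemma has_real_derivative_squeeze:
  fixes f g :: "real \<Rightarrow> real"
  assumes lo: "\<And>y z. y \<in> S \<Longrightarrow> z \<in> S \<Longrightarrow> g y * (z - y) \<le> f z - f y"
    and x: "x \<in> S" and S: "open S" and g: "isCont g x"
  shows "(f has_real_derivative g x) (at x)"
proof -
  have ev: "eventually (\<lambda>z. z \<in> S) (at x)" using S x by (rule eventually_at_in_open')
  have "eventually (\<lambda>z. \<bar>(f z - f x) / (z - x) - g x\<bar> \<le> \<bar>g z - g x\<bar>) (at x)"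
    using ev eventually_neq_at_within[of x x UNIV]
  proof eventually_elim
    case (elim z)
    have 1: "g x * (z - x) \<le> f z - f x" "f z - f x \<le> g z * (z - x)"
      using lo[OF x elim(1)] lo[OF elim(1) x] by (auto simp: algebra_simps)
    show ?case
    proof (cases "z > x")
      case True
      then have "g x \<le> (f z - f x) / (z - x)" "(f z - f x) / (z - x) \<le> g z"
        using 1 by (auto simp: pos_le_divide_eq pos_divide_le_eq)
      then show ?thesis by linarith
    next
      case False
      then have "z - x < 0" using elim by simp
      then have "(f z - f x) / (z - x) \<le> g x" "g z \<le> (f z - f x) / (z - x)"
        using 1 by (auto simp: neg_le_divide_eq neg_divide_le_eq)
      then show ?thesis by linarith
    qed
  qed
  moreover have "((\<lambda>z. \<bar>g z - g x\<bar>) \<longlongrightarrow> 0) (at x)"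
    using g by (auto simp: isCont_def intro!: tendsto_eq_intros)
  ultimately have "((\<lambda>z. (f z - f x) / (z - x) - g x) \<longlongrightarrow> 0) (at x)"
    unfolding real_norm_def[symmetric] by (rule Lim_null_comparison)
  then show ?thesis unfolding has_field_derivative_iff by (rule LIM_zero_cancel)
qed

lemma plane_potential_deriv_space:
  assumes A: "\<bar>A\<bar> < 1" and t: "0 < t"
  shows "(plane_potential A t has_real_derivative plane_profile A t y) (at y)"
  by (rule has_real_derivative_squeeze[where S = UNIV])
     (use plane_potential_subgradient[OF A, of t t] t plane_profile_isCont_space[OF A t] in auto)

lemma isCont_flux:
  assumes "\<bar>A\<bar> < 1" "\<bar>a\<bar> \<le> 1"
  shows "isCont (flux A) a"
  unfolding flux_def using one_minus_mult_pos[OF assms] by (auto intro!: continuous_intros)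

lemma plane_potential_deriv_time:
  assumes A: "\<bar>A\<bar> < 1" and t: "0 < t"
  shows "((\<lambda>t. plane_potential A t y) has_real_derivative - flux A (plane_profile A t y)) (at t)"
proof (rule has_real_derivative_squeeze[where S = "{0<..}" and g = "\<lambda>t. - flux A (plane_profile A t y)"])
  have "((\<lambda>s. plane_profile A s y) \<longlongrightarrow> plane_profile A t y) (at t)"
    using plane_profile_tendsto_time[OF A, of t y] t at_within_interior[of t "{0..}"] by (simp add: interior_real_atLeast)
  then show "isCont (\<lambda>t. - flux A (plane_profile A t y)) t"
    unfolding isCont_def by (intro tendsto_minus isCont_tendsto_compose[OF isCont_flux] A plane_profile_bound)
qed (use plane_potential_subgradient[OF A, of _ _ y y] t in auto)

section \<open>The reflected fronts\<close>

text \<open>The weighted energy \<open>(g t)\<^sup>2 * exp (- 2 * L * t)\<close> starts at zero and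
  cannot increase.\<close>

lemma gronwall_zero:
  fixes g :: "real \<Rightarrow> real"
  assumes ab: "a \<le> b" and cont: "continuous_on {a..b} g" and 0: "g a = 0"
    and der: "\<And>t. a < t \<Longrightarrow> t < b \<Longrightarrow> (g has_real_derivative g' t) (at t)"
    and bd: "\<And>t. a < t \<Longrightarrow> t < b \<Longrightarrow> \<bar>g' t\<bar> \<le> L * \<bar>g t\<bar>"
  shows "g b = 0"
proof -
  define h where "h = (\<lambda>t. (g t)\<^sup>2 * exp (- 2 * L * t))"
  have "h b \<le> h a"
  proof (rule DERIV_nonpos_imp_decreasing_open[OF ab])
    fix t assume t: "a < t" "t < b"
    have "(h has_real_derivative (2 * g t * g' t - 2 * L * (g t)\<^sup>2) * exp (- 2 * L * t)) (at t)"
      unfolding h_def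
      by (rule derivative_eq_intros der[OF t] refl)+ (simp add: algebra_simps power2_eq_square)
    moreover have "g t * g' t \<le> L * (g t)\<^sup>2"
    proof -
      have "g t * g' t \<le> \<bar>g t\<bar> * \<bar>g' t\<bar>" by (metis abs_ge_self abs_mult)
      also have "\<dots> \<le> \<bar>g t\<bar> * (L * \<bar>g t\<bar>)" by (intro mult_left_mono bd t) auto
      finally show ?thesis by (simp add: power2_eq_square mult_ac)
    qed
    ultimately show "\<exists>y. (h has_real_derivative y) (at t) \<and> y \<le> 0"
      by (intro exI conjI) (auto simp: mult_le_0_iff)
  qed (auto simp: h_def intro!: continuous_intros cont)
  then have "(g b)\<^sup>2 * exp (- 2 * L * b) \<le> 0" by (simp add: h_def 0)
  then show ?thesis by (simp add: mult_le_0_iff)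
qed

lemma inverse_c_speed: "1 / c_speed A s = (1 - s * A) / 2"
  by (simp add: c_speed_def)

lemma vartheta_reflect: "vartheta (- A) t (- y) = - vartheta A t y"
  by (simp add: vartheta_def minus_divide_left del: divide_minus_left)

text \<open>
  Conservation of mass above a ray \<open>y = t G'(\<theta>)\<close> gives \<open>t (1 - B) ((1 + \<theta>) / (1 - B \<theta>))\<^sup>2 = 2\<close> at the
  point where the ray meets the upper front; solving for the front yields the formula. The lower
  front is the upper one for \<open>B = - A\<close>.
\<close>

definition front_solution :: "real \<Rightarrow> real \<Rightarrow> real" where
  "front_solution B t = (1 - B + 2 * t - 2 * sqrt (2 * ((1 - B) * t))) / (1 + B)"

lemma front_complement:
  "(1 :: real) + B \<noteq> 0 \<Longrightarrow> 1 - (1 - B + q - 2 * p) / (1 + B) = (2 * B - q + 2 * p) / (1 + B)"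
  by (simp add: field_simps)

lemma sqrt_scaled_deriv:
  assumes "0 < c * t"
  shows "((\<lambda>t. sqrt (c * t)) has_real_derivative c / (2 * sqrt (c * t))) (at t)"
proof -
  have "((\<lambda>t. c * t) has_real_derivative c) (at t)" by (auto intro!: derivative_eq_intros)
  then have "((\<lambda>t. sqrt (c * t)) has_real_derivative inverse (sqrt (c * t)) / 2 * c) (at t)"
    by (rule DERIV_chain2[where f = sqrt and g = "\<lambda>t. c * t", OF DERIV_real_sqrt[OF assms]])
  then show ?thesis by (rule DERIV_cong) (simp add: field_simps)
qed

text \<open>In the parameter \<open>p\<close> the time, the front and the value on the front are
  rational, which turns the front equation into field algebra. The start of the front is
  \<open>p = 1 - B\<close>, whence \<open>p + 2 * B \<ge> 1 + B > 0\<close>.\<close>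

lemma front_param:
  assumes B: "\<bar>B\<bar> < 1" and t: "(1 - B) / 2 \<le> t"
  defines "p \<equiv> sqrt (2 * ((1 - B) * t))"
  shows "1 - B \<le> p" "p\<^sup>2 = 2 * ((1 - B) * t)" "0 < p" "0 < p + 2 * B"
proof -
  have "(1 - B) * (1 - B) \<le> (1 - B) * (2 * t)" using B t by (intro mult_left_mono) auto
  then have *: "(1 - B)\<^sup>2 \<le> 2 * ((1 - B) * t)" by (simp add: power2_eq_square mult_ac)
  then show 1: "1 - B \<le> p" unfolding p_def by (rule real_le_rsqrt)
  show "p\<^sup>2 = 2 * ((1 - B) * t)" unfolding p_def using * by (simp add: order_trans[OF zero_le_power2])
  show "0 < p" "0 < p + 2 * B" using 1 B by auto
qed

text \<open>The value comes from solving \<open>(1 + \<theta>) / (1 - B * \<theta>) = 2 / p\<close>,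
  the mass balance after taking roots. It suffices to check that the front lies on the ray of this
  value; the inversion of the ray speed then gives \<open>vartheta\<close> without simplifying its
  square root.\<close>

lemma vartheta_front:
  assumes B: "\<bar>B\<bar> < 1" and t: "(1 - B) / 2 \<le> t"
  defines "p \<equiv> sqrt (2 * ((1 - B) * t))"
  shows "vartheta B t (1 - front_solution B t) = (2 - p) / (p + 2 * B)"
    and "\<bar>(2 - p) / (p + 2 * B)\<bar> \<le> 1"
    and "1 - front_solution B t = t * fan_speed B ((2 - p) / (p + 2 * B))"
proof -
  note p = front_param[OF B t, folded p_def]
  have t_eq: "t = p\<^sup>2 / (2 * (1 - B))" using p(2) B by (simp add: field_simps)
  have F: "front_solution B t = (1 - B + p\<^sup>2 / (1 - B) - 2 * p) / (1 + B)"
  proof -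
    have "2 * t = p\<^sup>2 / (1 - B)" using p(2) B by simp
    then show ?thesis unfolding front_solution_def p_def[symmetric] by simp
  qed
  have "(2 - p) / (p + 2 * B) \<le> 1" "-1 \<le> (2 - p) / (p + 2 * B)"
    using p B by (simp_all add: pos_divide_le_eq pos_le_divide_eq)
  then show a: "\<bar>(2 - p) / (p + 2 * B)\<bar> \<le> 1" unfolding abs_le_iff by linarith
  have nz: "p + 2 * B \<noteq> 0" "1 - B \<noteq> 0" "1 + B \<noteq> 0" "p \<noteq> 0" using p B by auto
  have 1: "1 - B * ((2 - p) / (p + 2 * B)) = p * (1 + B) / (p + 2 * B)"
    using nz by (simp add: field_simps)
  have 2: "2 * ((2 - p) / (p + 2 * B)) - B * ((2 - p) / (p + 2 * B))\<^sup>2 - B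
      = (2 * (2 - p) * (p + 2 * B) - B * (2 - p)\<^sup>2 - B * (p + 2 * B)\<^sup>2) / (p + 2 * B)\<^sup>2"
    using nz by (simp add: power_divide divide_simps, simp add: power2_eq_square algebra_simps)
  have "t * fan_speed B ((2 - p) / (p + 2 * B))
     = (p\<^sup>2 / (2 * (1 - B))) * ((2 * (2 - p) * (p + 2 * B) - B * (2 - p)\<^sup>2 - B * (p + 2 * B)\<^sup>2) / (p * (1 + B))\<^sup>2)"
    unfolding fan_speed_def 1 2 using nz t_eq by (simp add: power_divide)
  also have "\<dots> = (2 * (2 - p) * (p + 2 * B) - B * (2 - p)\<^sup>2 - B * (p + 2 * B)\<^sup>2) / (2 * (1 - B) * (1 + B)\<^sup>2)"
    using nz by (simp add: power_mult_distrib)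
  also have "\<dots> = (2 * B - p\<^sup>2 / (1 - B) + 2 * p) / (1 + B)"
    using nz by (simp add: divide_simps, simp add: power2_eq_square algebra_simps)
  also have "\<dots> = 1 - front_solution B t"
    unfolding F by (rule front_complement[symmetric]) (rule nz)
  finally show eq: "1 - front_solution B t = t * fan_speed B ((2 - p) / (p + 2 * B))" by simp
  have "0 < t" using t B by (smt (verit) divide_pos_pos abs_less_iff)
  then show "vartheta B t (1 - front_solution B t) = (2 - p) / (p + 2 * B)"
    unfolding eq using vartheta_fan_speed[OF B _ a] by simp
qed

section \<open>Existence and uniqueness for the front equation\<close>

definition front_rate :: "real \<Rightarrow> real \<Rightarrow> real \<Rightarrow> real" where
  "front_rate B t y = (1 - vartheta B t y) / (1 - B * vartheta B t y)"

lemma front_solution_deriv: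
  assumes B: "\<bar>B\<bar> < 1" and t: "(1 - B) / 2 \<le> t"
  shows "(front_solution B has_real_derivative front_rate B t (1 - front_solution B t)) (at t)"
proof -
  define p where "p = sqrt (2 * ((1 - B) * t))"
  note p = front_param[OF B t, folded p_def]
  have nz: "p + 2 * B \<noteq> 0" "1 - B \<noteq> 0" "1 + B \<noteq> 0" "p \<noteq> 0" using p B by auto
  have "0 < 2 * ((1 - B) * t)" using p(2,3) by (metis zero_less_power)
  then have sqrt_deriv: "((\<lambda>t. sqrt (2 * ((1 - B) * t))) has_real_derivative (1 - B) / p) (at t)"
    using sqrt_scaled_deriv[of "2 * (1 - B)" t] mult_divide_mult_cancel_left[of 2 "1 - B" p]
    unfolding p_def by (simp only: mult.assoc)
  have "(front_solution B has_real_derivative (2 - 2 * ((1 - B) / p)) / (1 + B)) (at t)"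
  proof -
    have "((\<lambda>t. 1 - B + 2 * t) has_real_derivative 2) (at t)" by (auto intro!: derivative_eq_intros)
    from DERIV_cdivide[OF DERIV_diff[OF this DERIV_cmult[OF sqrt_deriv, of 2]], of "1 + B"]
    show ?thesis by (simp only: front_solution_def[abs_def])
  qed
  also have "(2 - 2 * ((1 - B) / p)) / (1 + B) = 2 * (p - (1 - B)) / (p * (1 + B))"
    using nz by (simp add: field_simps)
  \<comment> \<open>Expanding by \<open>p + 2 * B\<close> produces the numerator
    \<open>1 - \<theta>\<close> and the denominator \<open>1 - B * \<theta>\<close> for the value
    \<theta> of \<open>vartheta\<close> on the front.\<close>
  also have "\<dots> = (2 * (p - (1 - B)) / (p + 2 * B)) / (p * (1 + B) / (p + 2 * B))"
    using nz by simp
  also have "\<dots> = front_rate B t (1 - front_solution B t)"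
  proof -
    have "1 - (2 - p) / (p + 2 * B) = 2 * (p - (1 - B)) / (p + 2 * B)"
      "1 - B * ((2 - p) / (p + 2 * B)) = p * (1 + B) / (p + 2 * B)"
      using nz by (simp_all add: field_simps)
    then show ?thesis unfolding front_rate_def vartheta_front(1)[OF B t, folded p_def] by simp
  qed
  finally show ?thesis .
qed

text \<open>This form has no division by \<open>B\<close>, so that \<open>B = 0\<close> needs no separate treatment.\<close>

lemma front_rate_rationalized:
  assumes B: "\<bar>B\<bar> < 1" and t: "0 < t" and D: "0 < t + B * y"
  defines "R \<equiv> sqrt ((1 - B\<^sup>2) * t * (t + B * y))"
  shows "front_rate B t y = (2 * t - (1 - B) * y) / ((1 + B) * t + R)"
proof -
  have K: "0 < (1 - B\<^sup>2) * t" using B t by (simp add: abs_square_less_1)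
  then have R2: "R\<^sup>2 = (1 - B\<^sup>2) * t * (t + B * y)" and R0: "0 < R" using D by (auto simp: R_def)
  have N: "0 < t + B * y + R" "0 < (1 - B\<^sup>2) * t + R" "0 < (1 + B) * t + R"
    using D R0 K B t by (auto intro!: add_pos_pos)
  have "1 - vartheta B t y = ((1 - B) * (t - y) + R) / (t + B * y + R)"
    using N(1) unfolding vartheta_def R_def[symmetric] by (simp add: field_simps)
  moreover have "1 - B * vartheta B t y = ((1 - B\<^sup>2) * t + R) / (t + B * y + R)"
    using N(1) unfolding vartheta_def R_def[symmetric] by (simp add: field_simps power2_eq_square)
  ultimately have "front_rate B t y = ((1 - B) * (t - y) + R) / ((1 - B\<^sup>2) * t + R)"
    using N(1) by (simp add: front_rate_def)
  also have "\<dots> = (2 * t - (1 - B) * y) / ((1 + B) * t + R)"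
  proof -
    \<comment> \<open>The two fractions agree by cross multiplication, once \<open>R\<^sup>2\<close>
      is replaced by the radicand.\<close>
    have "((1 - B) * (t - y) + R) * ((1 + B) * t + R)
        = (1 - B\<^sup>2) * t * (t - y) + R * (2 * t - (1 - B) * y) + R\<^sup>2"
      by (simp add: power2_eq_square algebra_simps)
    also have "\<dots> = (2 * t - (1 - B) * y) * ((1 - B\<^sup>2) * t + R)"
      unfolding R2 by (simp add: power2_eq_square algebra_simps)
    finally show ?thesis using N(2,3) by (simp add: frac_eq_eq)
  qed
  finally show ?thesis .
qed

text \<open>An exact formula rather than an estimate: the sum \<open>R y + R y'\<close> is what a
  difference of square roots leaves in the denominator. A lower bound for one of the two roots
  therefore already gives a Lipschitz estimate.\<close>

lemma front_rate_diff:
  assumes B: "\<bar>B\<bar> < 1" and t: "0 < t" and D: "0 < t + B * y" "0 < t + B * y'"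
  defines "R \<equiv> \<lambda>y. sqrt ((1 - B\<^sup>2) * t * (t + B * y))"
  shows "front_rate B t y - front_rate B t y' = - (1 - B) * (y - y') / (R y + R y')"
proof -
  have K: "0 < (1 - B\<^sup>2) * t" using B t by (simp add: abs_square_less_1)
  have R2: "(R y)\<^sup>2 = (1 - B\<^sup>2) * t * (t + B * y)" "(R y')\<^sup>2 = (1 - B\<^sup>2) * t * (t + B * y')"
    and R0: "0 < R y" "0 < R y'" using D K by (auto simp: R_def)
  define c where "c = (1 + B) * t"
  have c: "0 < c" using B t by (auto simp: c_def)
  have nz: "c + R y \<noteq> 0" "c + R y' \<noteq> 0" "R y + R y' \<noteq> 0" using c R0 by auto
  have "((2 * t - (1 - B) * y) * (c + R y') - (2 * t - (1 - B) * y') * (c + R y)) * (R y + R y')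
     = - (1 - B) * c * (y - y') * (R y + R y') - (1 - B) * (y - y') * (R y * R y')
       + 2 * t * ((R y')\<^sup>2 - (R y)\<^sup>2) - (1 - B) * (y * (R y')\<^sup>2 - y' * (R y)\<^sup>2)"
    by (simp add: power2_eq_square algebra_simps)
  also have "\<dots> = - (1 - B) * (y - y') * ((c + R y) * (c + R y'))"
    unfolding R2 by (simp add: power2_eq_square algebra_simps c_def)
  finally have *: "((2 * t - (1 - B) * y) * (c + R y') - (2 * t - (1 - B) * y') * (c + R y)) * (R y + R y')
     = - (1 - B) * (y - y') * ((c + R y) * (c + R y'))" .
  have "front_rate B t y - front_rate B t y'
     = (2 * t - (1 - B) * y) / (c + R y) - (2 * t - (1 - B) * y') / (c + R y')"
    using front_rate_rationalized[OF B t] D by (simp add: R_def c_def)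
  also have "\<dots> = ((2 * t - (1 - B) * y) * (c + R y') - (2 * t - (1 - B) * y') * (c + R y)) / ((c + R y) * (c + R y'))"
    using nz by (simp add: diff_frac_eq)
  also have "\<dots> = - (1 - B) * (y - y') / (R y + R y')"
    using nz * by (simp only: frac_eq_eq mult_eq_0_iff simp_thms)
  finally show ?thesis .
qed

text \<open>Along the explicit front the root is \<open>p * (p + 2 * B) / 2\<close>, which is
  smallest at the start \<open>p = 1 - B\<close>. The bound is thus uniform in time.\<close>

lemma front_solution_radicand:
  assumes B: "\<bar>B\<bar> < 1" and t: "(1 - B) / 2 \<le> t"
  shows "(1 - B) * (1 + B) / 2 \<le> sqrt ((1 - B\<^sup>2) * t * (t + B * (1 - front_solution B t)))"
    and "0 < t + B * (1 - front_solution B t)"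
proof -
  define p where "p = sqrt (2 * ((1 - B) * t))"
  note p = front_param[OF B t, folded p_def]
  have nz: "1 - B \<noteq> 0" "1 + B \<noteq> 0" using B by auto
  have t_eq: "t = p\<^sup>2 / (2 * (1 - B))" using p(2) B by (simp add: field_simps)
  have F: "front_solution B t = (1 - B + p\<^sup>2 / (1 - B) - 2 * p) / (1 + B)"
  proof -
    have "2 * t = p\<^sup>2 / (1 - B)" using p(2) B by simp
    then show ?thesis unfolding front_solution_def p_def[symmetric] by simp
  qed
  have D: "t + B * (1 - front_solution B t) = (p + 2 * B)\<^sup>2 / (2 * (1 + B))"
  proof -
    have "t + B * (1 - front_solution B t) = p\<^sup>2 / (2 * (1 - B)) + B * ((2 * B - p\<^sup>2 / (1 - B) + 2 * p) / (1 + B))"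
      unfolding F front_complement[OF nz(2)] by (simp add: t_eq)
    also have "\<dots> = (p + 2 * B)\<^sup>2 / (2 * (1 + B))"
      using nz by (simp add: divide_simps, simp add: power2_eq_square algebra_simps)
    finally show ?thesis .
  qed
  show "0 < t + B * (1 - front_solution B t)" unfolding D using p B by simp
  have "(1 - B\<^sup>2) * t * (t + B * (1 - front_solution B t)) = (p * (p + 2 * B) / 2)\<^sup>2"
    unfolding D using nz by (simp add: t_eq divide_simps, simp add: power2_eq_square algebra_simps)
  then have "sqrt ((1 - B\<^sup>2) * t * (t + B * (1 - front_solution B t))) = p * (p + 2 * B) / 2"
    using p by simp
  moreover have "(1 - B) * (1 + B) \<le> p * (p + 2 * B)" using p B by (intro mult_mono) auto
  ultimately show "(1 - B) * (1 + B) / 2 \<le> sqrt ((1 - B\<^sup>2) * t * (t + B * (1 - front_solution B t)))" by simp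
qed

text \<open>Only the root on the explicit front has to be bounded below; the root at
  \<open>1 - x\<close> enters with its sign alone. Hence the constant \<open>2 / (1 + B)\<close> is
  the same for every competitor \<open>x\<close>.\<close>

lemma front_rate_lipschitz:
  assumes B: "\<bar>B\<bar> < 1" and t: "(1 - B) / 2 \<le> t" and D: "0 < t + B * (1 - x)"
  shows "\<bar>front_rate B t (1 - x) - front_rate B t (1 - front_solution B t)\<bar>
    \<le> 2 / (1 + B) * \<bar>x - front_solution B t\<bar>"
proof -
  have t0: "0 < t" using t B by (smt (verit) divide_pos_pos abs_less_iff)
  have K: "0 < (1 - B\<^sup>2) * t" using B t0 by (simp add: abs_square_less_1)
  let ?R = "\<lambda>y. sqrt ((1 - B\<^sup>2) * t * (t + B * y))"
  have R: "0 \<le> ?R (1 - x)" using D K by simp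
  have R': "(1 - B) * (1 + B) / 2 \<le> ?R (1 - front_solution B t)" by (rule front_solution_radicand[OF B t])
  have p: "0 < (1 - B) * (1 + B) / 2" using B by auto
  have pos: "0 < ?R (1 - x) + ?R (1 - front_solution B t)" using R R' p by linarith
  have "\<bar>front_rate B t (1 - x) - front_rate B t (1 - front_solution B t)\<bar>
     = (1 - B) * \<bar>x - front_solution B t\<bar> / (?R (1 - x) + ?R (1 - front_solution B t))"
    unfolding front_rate_diff[OF B t0 D front_solution_radicand(2)[OF B t]]
    using pos B by (simp add: abs_mult abs_minus_commute)
  also have "\<dots> \<le> (1 - B) * \<bar>x - front_solution B t\<bar> / ((1 - B) * (1 + B) / 2)"
    using R R' p B pos by (intro divide_left_mono mult_pos_pos mult_nonneg_nonneg) linarith+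
  also have "\<dots> = (1 - B) * (2 * \<bar>x - front_solution B t\<bar>) / ((1 - B) * (1 + B))" by simp
  also have "\<dots> = 2 / (1 + B) * \<bar>x - front_solution B t\<bar>"
    using B by (subst mult_divide_mult_cancel_left) auto
  finally show ?thesis .
qed

text \<open>\<open>vartheta\<close> is odd under the simultaneous reflection of \<open>A\<close> and
  \<open>y\<close>, so the lower front for \<open>A\<close> obeys the equation of the upper front
  for \<open>- A\<close>.\<close>

lemma is_front_reflect:
  assumes "s \<in> {1, -1}"
  shows "is_front A s f \<longleftrightarrow> is_front (s * A) 1 f"
proof -
  have "(1 - s * vartheta A t (s * y)) / (1 - A * vartheta A t (s * y))
      = (1 - 1 * vartheta (s * A) t (1 * y)) / (1 - s * A * vartheta (s * A) t (1 * y))" for t y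
    using assms vartheta_reflect[of A t "- y"] by auto
  moreover have "c_speed A s = c_speed (s * A) 1" by (simp add: c_speed_def)
  ultimately show ?thesis unfolding is_front_def by presburger
qed

lemma front_solution_zero: "\<bar>B\<bar> < 1 \<Longrightarrow> front_solution B ((1 - B) / 2) = 0"
proof -
  assume B: "\<bar>B\<bar> < 1"
  have "2 * ((1 - B) * ((1 - B) / 2)) = (1 - B)\<^sup>2" by (simp add: power2_eq_square)
  then have "sqrt (2 * ((1 - B) * ((1 - B) / 2))) = 1 - B" using B by simp
  then show ?thesis unfolding front_solution_def by (simp add: field_simps)
qed

lemma is_front_front_solution:
  assumes B: "\<bar>B\<bar> < 1"
  shows "is_front B 1 (restrict (front_solution B) {1 / c_speed B 1..})"
proof -
  have "(restrict (front_solution B) {(1 - B) / 2..} has_real_derivative front_rate B t (1 - front_solution B t))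
      (at t within {(1 - B) / 2..})" if t: "(1 - B) / 2 \<le> t" for t
    by (rule has_field_derivative_transform_within[OF
          has_field_derivative_at_within[OF front_solution_deriv[OF B t]] zero_less_one])
       (use t in auto)
  then show ?thesis
    unfolding is_front_def inverse_c_speed using front_solution_zero[OF B]
    by (auto simp: front_rate_def)
qed

text \<open>
  The rate is Lipschitz only where \<open>t + B y > 0\<close>, which is not known a priori along an arbitrary
  solution. It holds just after the last time at which that solution agrees with the explicit one.
\<close>

lemma is_front_unique:
  assumes B: "\<bar>B\<bar> < 1" and f: "is_front B 1 f" and t: "1 / c_speed B 1 \<le> t"
  shows "f t = front_solution B t"
proof (rule ccontr)
  assume ne: "f t \<noteq> front_solution B t"
  define a where "a = (1 - B) / 2"
  have f0: "f a = 0"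
    and fd: "\<And>s. a \<le> s \<Longrightarrow> (f has_real_derivative front_rate B s (1 - f s)) (at s within {a..})"
    using f unfolding is_front_def inverse_c_speed a_def by (auto simp: front_rate_def)
  have at: "a \<le> t" using t by (simp add: inverse_c_speed a_def)
  have cf: "continuous_on {a..} f"
    using fd by (intro DERIV_continuous_on) auto
  have cF: "continuous_on {a..} (front_solution B)"
    unfolding a_def by (rule DERIV_continuous_on) (rule has_field_derivative_at_within[OF front_solution_deriv[OF B]], simp)
  have cg: "continuous_on {a..} (\<lambda>s. f s - front_solution B s)" by (intro continuous_intros cf cF)
  define S where "S = {s \<in> {a..t}. f s - front_solution B s = 0}"
  have clS: "closed S"
    unfolding S_def by (intro continuous_closed_preimage_constant continuous_on_subset[OF cg]) auto
  have "a \<in> S" using at f0 front_solution_zero[OF B] by (simp add: S_def a_def)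
  moreover have bdd: "bdd_above S" by (auto simp: S_def)
  ultimately have "Sup S \<in> S" using clS by (intro closed_contains_Sup) auto
  define b where "b = Sup S"
  have "b \<in> S" using \<open>Sup S \<in> S\<close> by (simp add: b_def)
  moreover from this have "b \<noteq> t" using ne by (auto simp: S_def)
  ultimately have b: "a \<le> b" "b < t" "f b = front_solution B b" by (auto simp: S_def)
  \<comment> \<open>At \<open>b\<close> both fronts coincide, so the positivity known for the
    explicit one holds for \<open>f\<close>, and continuity preserves it on a short interval after
    \<open>b\<close>.\<close>
  have "0 < b + B * (1 - f b)" using front_solution_radicand(2)[OF B, of b] b by (simp add: a_def)
  moreover have "((\<lambda>s. s + B * (1 - f s)) \<longlongrightarrow> b + B * (1 - f b)) (at b within {a..})"
    using cf b(1) by (auto simp: continuous_on_def intro!: tendsto_intros)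
  ultimately have "eventually (\<lambda>s. 0 < s + B * (1 - f s)) (at b within {a..})"
    by (rule order_tendstoD(1)[rotated])
  then obtain d where d: "0 < d" "\<And>s. s \<in> {a..} \<Longrightarrow> s \<noteq> b \<Longrightarrow> dist s b < d \<Longrightarrow> 0 < s + B * (1 - f s)"
    unfolding eventually_at by auto
  \<comment> \<open>Half of \<open>d\<close> keeps \<open>e\<close> inside that interval, the
    minimum with \<open>t\<close> keeps it in the range of \<open>S\<close>. Agreement at
    \<open>e > b\<close> contradicts the choice of \<open>b\<close>.\<close>
  define e where "e = min t (b + d / 2)"
  have e: "b < e" "e \<le> t" "e < b + d" using b d by (auto simp: e_def)
  have "f e - front_solution B e = 0"
  proof (rule gronwall_zero[where a = b and b = e and L = "2 / (1 + B)"])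
    show "continuous_on {b..e} (\<lambda>s. f s - front_solution B s)"
      using b by (intro continuous_on_subset[OF cg]) auto
    fix s assume s: "b < s" "s < e"
    have "(f has_real_derivative front_rate B s (1 - f s)) (at s)"
      using fd[of s] at_within_interior[of s "{a..}"] s b by simp
    then show "((\<lambda>s. f s - front_solution B s) has_real_derivative
        front_rate B s (1 - f s) - front_rate B s (1 - front_solution B s)) (at s)"
      using s b by (intro derivative_intros front_solution_deriv[OF B]) (auto simp: a_def)
    show "\<bar>front_rate B s (1 - f s) - front_rate B s (1 - front_solution B s)\<bar> \<le> 2 / (1 + B) * \<bar>f s - front_solution B s\<bar>"
      using s b d(2)[of s] e by (intro front_rate_lipschitz[OF B]) (auto simp: a_def dist_real_def)
  qed (use e b in auto)
  then have "e \<in> S" using e b by (auto simp: S_def)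
  then have "e \<le> b" unfolding b_def by (rule cSup_upper[OF _ bdd])
  then show False using e by simp
qed

lemma ex1_front:
  assumes A: "\<bar>A\<bar> < 1" and s: "s \<in> {1, -1}"
  shows "\<exists>!f. is_front A s f"
    and front_eq: "front A s = restrict (front_solution (s * A)) {1 / c_speed A s..}"
proof -
  have B: "\<bar>s * A\<bar> < 1" using A s by (auto simp: abs_mult)
  let ?F = "restrict (front_solution (s * A)) {1 / c_speed A s..}"
  have c: "c_speed A s = c_speed (s * A) 1" by (simp add: c_speed_def)
  have F: "is_front A s ?F" using is_front_front_solution[OF B] is_front_reflect[OF s] c by simp
  moreover have "f = ?F" if f: "is_front A s f" for f
  proof (rule extensionalityI)
    show "f \<in> extensional {1 / c_speed A s..}" using f by (simp add: is_front_def)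
    show "f t = ?F t" if "t \<in> {1 / c_speed A s..}" for t
      using that is_front_unique[OF B, of f t] f is_front_reflect[OF s] c by simp
  qed simp
  ultimately show "\<exists>!f. is_front A s f" "front A s = ?F"
    unfolding front_def by (blast, intro the_equality)
qed

section \<open>Monotonicity of the fronts and the collapse time\<close>

lemma front_solution_square:
  assumes B: "\<bar>B\<bar> < 1" and t: "0 \<le> t"
  shows "front_solution B t = (sqrt (2 * t) - sqrt (1 - B))\<^sup>2 / (1 + B)"
proof -
  have "sqrt (2 * ((1 - B) * t)) = sqrt (2 * t) * sqrt (1 - B)"
    by (simp add: real_sqrt_mult[symmetric] mult_ac)
  then show ?thesis using B t by (simp add: front_solution_def power2_diff)
qed

text \<open>In the square form of the front the base \<open>sqrt (2 * t) - sqrt (1 - B)\<close>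
  increases, and it is nonnegative exactly from \<open>t = (1 - B) / 2\<close> on.\<close>

lemma front_solution_strict_mono:
  assumes B: "\<bar>B\<bar> < 1" and t: "(1 - B) / 2 \<le> t" "t < t'"
  shows "front_solution B t < front_solution B t'"
proof -
  have t0: "0 \<le> t" using t B by (smt (verit) divide_pos_pos abs_less_iff)
  have "sqrt (1 - B) \<le> sqrt (2 * t)" "sqrt (2 * t) < sqrt (2 * t')" using t by auto
  then have "(sqrt (2 * t) - sqrt (1 - B))\<^sup>2 < (sqrt (2 * t') - sqrt (1 - B))\<^sup>2"
    by (intro power_strict_mono) auto
  then show ?thesis using front_solution_square[OF B] t0 t B by (simp add: divide_strict_right_mono)
qed

text \<open>With \<open>k = sqrt (1 - B\<^sup>2)\<close> the radicand at time \<open>1 + k\<close>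
  is the square of \<open>1 - B + k\<close>, and the numerator of the front reduces to
  \<open>1 + B\<close>.\<close>

lemma front_solution_collapse:
  assumes B: "\<bar>B\<bar> < 1"
  shows "front_solution B (1 + sqrt (1 - B\<^sup>2)) = 1"
proof -
  define k where "k = sqrt (1 - B\<^sup>2)"
  have k: "0 \<le> k" "k\<^sup>2 = 1 - B\<^sup>2" using B by (auto simp: k_def abs_square_less_1 less_imp_le)
  have "2 * ((1 - B) * (1 + k)) = (1 - B + k)\<^sup>2"
    using k(2) by (simp add: power2_eq_square algebra_simps)
  then have "sqrt (2 * ((1 - B) * (1 + k))) = 1 - B + k"
    using k(1) B by simp
  then show ?thesis unfolding front_solution_def k_def[symmetric] using B by simp
qed

text \<open>The candidate is even in \<open>A\<close>, which is why both fronts reach the centre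
  together. Strict monotonicity of the upper front excludes any other time.\<close>

lemma collapse_time_eq:
  assumes A: "\<bar>A\<bar> < 1"
  shows "is_collapse_time A t \<longleftrightarrow> t = 1 + sqrt (1 - A\<^sup>2)"
    and "collapse_time A = 1 + sqrt (1 - A\<^sup>2)"
proof -
  let ?T = "1 + sqrt (1 - A\<^sup>2)"
  have k: "0 \<le> sqrt (1 - A\<^sup>2)" using A by (simp add: abs_square_less_1 less_imp_le)
  have B: "\<bar>s * A\<bar> < 1" if "s \<in> {1, -1}" for s using A that by (auto simp: abs_mult)
  have le: "1 / c_speed A s \<le> ?T" if "s \<in> {1, -1}" for s
  proof -
    have "1 / c_speed A s \<le> 1" using that A by (auto simp: inverse_c_speed)
    also have "1 \<le> ?T" using k by simp
    finally show ?thesis .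
  qed
  have *: "is_collapse_time A t \<longleftrightarrow> t = ?T" for t
  proof
    assume "t = ?T"
    then show "is_collapse_time A t"
      unfolding is_collapse_time_def
      using le front_solution_collapse[OF A] front_solution_collapse[of "- A"] A front_eq[OF A] by auto
  next
    assume "is_collapse_time A t"
    then have t: "(1 - A) / 2 \<le> t" "front_solution A t = 1"
      using front_eq[OF A, of 1] by (auto simp: is_collapse_time_def inverse_c_speed)
    show "t = ?T"
      using front_solution_strict_mono[OF A t(1), of ?T] front_solution_strict_mono[OF A, of ?T t]
        front_solution_collapse[OF A] t le[of 1]
      by (cases t ?T rule: linorder_cases) (auto simp: inverse_c_speed)
  qed
  show "is_collapse_time A t \<longleftrightarrow> t = ?T" by (rule *)
  show "collapse_time A = ?T" unfolding collapse_time_def * by simp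
qed

section \<open>The confined profile\<close>

text \<open>On the ray \<open>y = t * fan_speed A a\<close>, \<open>t\<close> times the left side is
  \<open>plane_potential A t y + y\<close>. Setting this equal to \<open>2\<close> is the mass
  balance behind the formula for the front.\<close>

lemma fan_speed_shock:
  assumes "\<bar>A\<bar> < 1" "\<bar>a\<bar> \<le> 1"
  shows "fan_speed A a * (1 + a) - flux A a = (1 - A) * ((1 + a) / (1 - A * a))\<^sup>2"
proof -
  have nz: "1 - A * a \<noteq> 0" using one_minus_mult_pos[OF assms] by simp
  then show ?thesis
    by (simp add: fan_speed_def flux_def power_divide divide_simps, simp add: power2_eq_square algebra_simps)
qed

lemma plane_profile_fan_interior:
  assumes A: "\<bar>A\<bar> < 1" and t: "0 < t" and y: "- c_speed A (-1) * t \<le> y" "y \<le> c_speed A 1 * t"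
  shows "plane_profile A t y = vartheta A t y"
  using t y by (simp add: plane_profile_def)

lemma plane_profile_gt:
  assumes A: "\<bar>A\<bar> < 1" and t: "0 < t" and y: "- c_speed A (-1) * t < y"
  shows "-1 < plane_profile A t y"
proof (cases "y < c_speed A 1 * t")
  case True
  then show ?thesis
    using vartheta_strict[OF A t y True] plane_profile_fan_interior[OF A t, of y] y by simp
next
  case False
  then show ?thesis
    using vartheta_fan_speed[OF A t, of 1] fan_speed_ends(1)[OF A] t y
    by (cases "y = c_speed A 1 * t") (auto simp: plane_profile_def mult.commute)
qed

text \<open>The slope is \<open>1 + plane_profile A t y\<close>, which is positive above the lower
  edge of the fan. So \<open>\<Psi> + y\<close> takes the value \<open>2\<close> at most once there,
  and comparing it with \<open>2\<close> amounts to comparing \<open>y\<close> with the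
  front.\<close>

lemma plane_potential_plus_strict_mono:
  assumes A: "\<bar>A\<bar> < 1" and t: "0 < t" and y: "- c_speed A (-1) * t < y" "y < y'"
  shows "plane_potential A t y + y < plane_potential A t y' + y'"
proof -
  have "0 < (1 + plane_profile A t y) * (y' - y)" using plane_profile_gt[OF A t y(1)] y(2) by simp
  moreover have "plane_profile A t y * (y' - y) \<le> plane_potential A t y' - plane_potential A t y"
    using plane_potential_subgradient[OF A, of t t y y'] t by simp
  ultimately show ?thesis by (simp add: algebra_simps)
qed

lemma ell_one_late:
  assumes A: "\<bar>A\<bar> < 1" and t: "(1 - A) / 2 \<le> t"
  shows "ell A 1 t = 1 - front_solution A t"
proof (cases "t = (1 - A) / 2")
  case True
  show ?thesis using A front_solution_zero[OF A] unfolding True by (simp add: ell_def c_speed_def)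
next
  case False
  then show ?thesis using t front_eq[OF A, of 1] by (simp add: ell_def inverse_c_speed)
qed

lemma ell_reflect:
  assumes A: "\<bar>A\<bar> < 1"
  shows "ell A (-1) t = - ell (- A) 1 t"
proof -
  have "c_speed A (-1) = c_speed (- A) 1" by (simp add: c_speed_def)
  then show ?thesis using front_eq[OF A, of "-1"] front_eq[of "- A" 1] A by (simp add: ell_def)
qed

lemma collapse_time_reflect: "\<bar>A\<bar> < 1 \<Longrightarrow> collapse_time (- A) = collapse_time A"
  using collapse_time_eq(2)[of A] collapse_time_eq(2)[of "- A"] by simp

lemma collapse_time_ge: "\<bar>A\<bar> < 1 \<Longrightarrow> 1 \<le> collapse_time A"
  using collapse_time_eq(2)[of A] abs_square_less_1[of A] by simp

lemma ell_one_collapse: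
  assumes A: "\<bar>A\<bar> < 1"
  shows "ell A 1 (collapse_time A) = 0"
proof -
  have "(1 - A) / 2 \<le> collapse_time A" using collapse_time_ge[OF A] A by auto
  from ell_one_late[OF A this] show ?thesis
    using front_solution_collapse[OF A] collapse_time_eq(2)[OF A] by simp
qed

lemma ell_one_less:
  assumes A: "\<bar>A\<bar> < 1" and t: "(1 - A) / 2 < t"
  shows "ell A 1 t < 1" "ell A 1 t < c_speed A 1 * t"
proof -
  show "ell A 1 t < 1"
    using front_solution_strict_mono[OF A _ t] front_solution_zero[OF A] ell_one_late[OF A] t by simp
  also have "1 < c_speed A 1 * t" using A t by (simp add: c_speed_def field_simps)
  finally show "ell A 1 t < c_speed A 1 * t" .
qed

lemma ell_one_pos:
  assumes A: "\<bar>A\<bar> < 1" and t: "0 < t" "t < collapse_time A"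
  shows "0 < ell A 1 t"
proof (cases "t \<le> (1 - A) / 2")
  case True
  then show ?thesis using A t c_speed_pos[OF A, of 1] by (simp add: ell_def inverse_c_speed)
next
  case False
  then show ?thesis
    using front_solution_strict_mono[OF A _ t(2)] front_solution_collapse[OF A] collapse_time_eq(2)[OF A]
      ell_one_late[OF A] by simp
qed

lemma ell_one_le:
  assumes A: "\<bar>A\<bar> < 1"
  shows "ell A 1 t \<le> c_speed A 1 * t"
  using ell_one_less[OF A, of t] by (cases "t \<le> (1 - A) / 2") (auto simp: ell_def inverse_c_speed)

text \<open>On the front \<open>(1 + a) / (1 - A * a)\<close> is \<open>2 / p\<close>, and
  \<open>t * (1 - A) * (2 / p)\<^sup>2 = 2\<close> by the choice of \<open>p\<close>. This places
  the kink of the confined potential on the curve given by the differential equation.\<close>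

lemma plane_potential_ell:
  assumes A: "\<bar>A\<bar> < 1" and t: "(1 - A) / 2 \<le> t" "t \<le> collapse_time A"
  shows "plane_potential A t (ell A 1 t) + ell A 1 t = 2"
proof -
  define p where "p = sqrt (2 * ((1 - A) * t))"
  note p = front_param[OF A t(1), folded p_def]
  note v = vartheta_front[OF A t(1), folded p_def]
  define a where "a = (2 - p) / (p + 2 * A)"
  define y where "y = ell A 1 t"
  have y: "y = 1 - front_solution A t" unfolding y_def by (rule ell_one_late[OF A t(1)])
  have t0: "0 < t" using A t(1) by auto
  \<comment> \<open>Up to the collapse the front stays in the closed upper half, hence above the
    lower edge of the fan.\<close>
  have "0 \<le> y"
    using ell_one_pos[OF A t0] ell_one_collapse[OF A] t(2) by (cases "t = collapse_time A") (auto simp: y_def)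
  moreover have "0 \<le> c_speed A (-1) * t" using c_speed_pos[OF A, of "-1"] t0 by simp
  ultimately have "- c_speed A (-1) * t \<le> y" by simp
  then have "plane_profile A t y = a"
    using ell_one_le[OF A, of t] v(1) plane_profile_fan_interior[OF A t0, of y]
    by (simp add: y[symmetric] a_def) (simp add: y_def)
  moreover have "y = t * fan_speed A a" using v(3) by (simp add: a_def y)
  ultimately have "plane_potential A t y + y = t * (fan_speed A a * (1 + a) - flux A a)"
    by (simp add: plane_potential_def algebra_simps)
  also have "\<dots> = t * ((1 - A) * ((1 + a) / (1 - A * a))\<^sup>2)"
    using fan_speed_shock[OF A v(2)] by (simp add: a_def)
  also have "(1 + a) / (1 - A * a) = 2 / p"
  proof -
    have "1 + a = (1 + A) * 2 / (p + 2 * A)" "1 - A * a = (1 + A) * p / (p + 2 * A)"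
      using p(4) by (simp_all add: a_def field_simps)
    then have "(1 + a) / (1 - A * a) = ((1 + A) * 2) / ((1 + A) * p)" using p(4) by simp
    also have "\<dots> = 2 / p" using A by (intro mult_divide_mult_cancel_left) auto
    finally show ?thesis .
  qed
  also have "t * ((1 - A) * (2 / p)\<^sup>2) = 2 * (2 * ((1 - A) * t)) / p\<^sup>2"
    by (simp add: power_divide)
  also have "\<dots> = 2" using p(2,3) A t0 by auto
  finally show ?thesis by (simp add: y_def)
qed

definition square_profile :: "real \<Rightarrow> real \<Rightarrow> real \<Rightarrow> real" where
  "square_profile A t y =
     (if t \<le> 0 then sgn y
      else if t < collapse_time A then
        (if y > ell A 1 t then (if c_speed A 1 * t \<le> 1 then 1 else -1)
         else if y < ell A (-1) t then (if c_speed A (-1) * t \<le> 1 then -1 else 1)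
         else vartheta A t y)
      else - sgn y)"

lemma Theta_square_eq_profile: "Theta_square A t x = square_profile A t (snd x)"
  by (simp add: Theta_square_def square_profile_def planar_def)

lemma ell_neg:
  assumes A: "\<bar>A\<bar> < 1" and t: "0 < t" "t < collapse_time A"
  shows "ell A (-1) t < 0" "- c_speed A (-1) * t \<le> ell A (-1) t"
  using ell_one_pos[of "- A" t] ell_one_le[of "- A" t] A t
  by (simp_all add: collapse_time_reflect ell_reflect) (simp add: c_speed_def)

lemma square_profile_interior:
  assumes A: "\<bar>A\<bar> < 1" and t: "0 < t" "t < collapse_time A"
    and y: "ell A (-1) t \<le> y" "y \<le> ell A 1 t"
  shows "square_profile A t y = vartheta A t y" "plane_profile A t y = vartheta A t y"
  using t y ell_one_le[OF A, of t] ell_neg[OF A t] by (auto simp: square_profile_def plane_profile_def)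

lemma square_profile_bound:
  assumes A: "\<bar>A\<bar> < 1"
  shows "\<bar>square_profile A t y\<bar> \<le> 1"
proof (cases "0 < t \<and> t < collapse_time A \<and> ell A (-1) t \<le> y \<and> y \<le> ell A 1 t")
  case True
  then show ?thesis using square_profile_interior[OF A, of t y] plane_profile_bound[OF A, of t y] by simp
next
  case False
  then show ?thesis by (auto simp: square_profile_def sgn_if)
qed

lemma plane_profile_reflect:
  assumes A: "\<bar>A\<bar> < 1"
  shows "plane_profile (- A) t (- y) = - plane_profile A t y"
proof -
  have "c_speed (- A) 1 = c_speed A (-1)" "c_speed (- A) (-1) = c_speed A 1"
    by (simp_all add: c_speed_def)
  then show ?thesis
    using fan_nonempty[OF A, of t]
    by (cases "t \<le> 0") (auto simp: plane_profile_def vartheta_reflect sgn_minus)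
qed

lemma flux_reflect: "flux (- A) (- a) = flux A a"
  by (simp add: flux_def)

lemma plane_potential_reflect:
  assumes A: "\<bar>A\<bar> < 1"
  shows "plane_potential (- A) t (- y) = plane_potential A t y"
  by (simp add: plane_potential_def plane_profile_reflect[OF A] flux_reflect)

lemma square_profile_reflect:
  assumes A: "\<bar>A\<bar> < 1"
  shows "square_profile (- A) t (- y) = - square_profile A t y"
proof -
  have c: "c_speed (- A) 1 = c_speed A (-1)" "c_speed (- A) (-1) = c_speed A 1"
    by (simp_all add: c_speed_def)
  have e: "ell (- A) 1 t = - ell A (-1) t" "ell (- A) (-1) t = - ell A 1 t"
    using ell_reflect[of A t] ell_reflect[of "- A" t] A by auto
  show ?thesis
    using ell_neg(1)[OF A, of t] ell_one_pos[OF A, of t]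
    by (cases "t \<le> 0")
      (auto simp: square_profile_def collapse_time_reflect[OF A] c e vartheta_reflect sgn_minus)
qed

text \<open>The sign of \<open>plane_potential A t y + y - 2\<close> tells which branch of the
  minimum is active. Strict monotonicity in \<open>y\<close> translates it into the position
  relative to the front; this is the link between the profile defined by curves and the
  potential.\<close>

lemma square_profile_upper:
  assumes A: "\<bar>A\<bar> < 1" and t: "0 \<le> t" and y: "0 < y" "y < 1"
  shows "(plane_potential A t y + y < 2 \<longrightarrow> square_profile A t y = plane_profile A t y) \<and>
    (2 < plane_potential A t y + y \<longrightarrow> square_profile A t y = - 1) \<and>
    (plane_potential A t y + y = 2 \<longrightarrow> y = ell A 1 t)"
proof -
  have T: "1 \<le> collapse_time A" by (rule collapse_time_ge[OF A])
  have lo: "- c_speed A (-1) * t \<le> 0" using c_speed_pos[OF A, of "-1"] t by simp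
  consider "t = 0" | "0 < t" "t \<le> (1 - A) / 2" | "(1 - A) / 2 < t" "t < collapse_time A" "0 < t"
    | "collapse_time A \<le> t" "0 < t"
    using t by fastforce
  then show ?thesis
  proof cases
    case 1
    then show ?thesis using y by (simp add: plane_potential_def plane_profile_def square_profile_def)
  next
    case 2
    have tT: "t < collapse_time A" using 2 T A by auto
    have c1: "1 \<ge> c_speed A 1 * t" using 2 A by (simp add: c_speed_def field_simps)
    \<comment> \<open>Until the fan passes the wall, the profile at the wall is \<open>1\<close>, so
      the potential there is \<open>1\<close> and the sum at height \<open>1\<close> is exactly
      \<open>2\<close>; lower heights stay strictly below this value.\<close>
    have "plane_profile A t 1 = 1"
    proof (cases "c_speed A 1 * t = 1")
      case True
      then show ?thesis
        using vartheta_fan_speed[OF A 2(1), of 1] fan_speed_ends(1)[OF A] lo 2(1)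
        by (simp add: plane_profile_def mult.commute)
    qed (use c1 2 in \<open>simp add: plane_profile_def\<close>)
    then have "plane_potential A t 1 = 1" by (simp add: plane_potential_def flux_def)
    then have "plane_potential A t y + y < 2"
      using plane_potential_plus_strict_mono[OF A 2(1) _ y(2)] lo y by simp
    moreover have "square_profile A t y = plane_profile A t y"
    proof (cases "y \<le> ell A 1 t")
      case True
      then show ?thesis using square_profile_interior[OF A 2(1) tT, of y] ell_neg(1)[OF A 2(1) tT] y by simp
    next
      case False
      then show ?thesis using 2 tT c1 by (simp add: square_profile_def plane_profile_def ell_def inverse_c_speed)
    qed
    ultimately show ?thesis by simp
  next
    case 3
    have pos: "0 < ell A 1 t" by (rule ell_one_pos[OF A 3(3,2)])
    have e: "plane_potential A t (ell A 1 t) + ell A 1 t = 2" using plane_potential_ell[OF A, of t] 3 by simp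
    have c1: "1 < c_speed A 1 * t" using 3 A by (simp add: c_speed_def field_simps)
    consider "y < ell A 1 t" | "y = ell A 1 t" | "ell A 1 t < y" by linarith
    then show ?thesis
    proof cases
      case 1
      then show ?thesis
        using plane_potential_plus_strict_mono[OF A 3(3) _ 1] e lo y
          square_profile_interior[OF A 3(3,2), of y] ell_neg(1)[OF A 3(3,2)] by simp
    next
      case 2
      then show ?thesis using e by simp
    next
      case 3
      then show ?thesis
        using plane_potential_plus_strict_mono[OF A \<open>0 < t\<close> _ 3] e lo pos c1 \<open>0 < t\<close> \<open>t < collapse_time A\<close>
        by (simp add: square_profile_def)
    qed
  next
    case 4
    \<comment> \<open>As the flux is nonpositive, the subgradient inequality keeps the potential at
      height \<open>0\<close> at least at its value \<open>2\<close> from the collapse time.\<close>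
    have "- flux A (plane_profile A (collapse_time A) 0) * (t - collapse_time A)
        \<le> plane_potential A t 0 - plane_potential A (collapse_time A) 0"
      using plane_potential_subgradient[OF A t, of "collapse_time A" 0 0] by simp
    moreover have "0 \<le> - flux A (plane_profile A (collapse_time A) 0) * (t - collapse_time A)"
      using flux_nonpos[OF A plane_profile_bound[OF A]] 4 by (intro mult_nonneg_nonneg) auto
    moreover have "plane_potential A (collapse_time A) 0 = 2"
      using plane_potential_ell[OF A, of "collapse_time A"] ell_one_collapse[OF A] T A by auto
    moreover have "plane_potential A t 0 + 0 < plane_potential A t y + y"
      using c_speed_pos[OF A, of "-1"] 4 y by (intro plane_potential_plus_strict_mono[OF A]) auto
    ultimately have "2 < plane_potential A t y + y" by simp
    then show ?thesis using 4 y by (simp add: square_profile_def)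
  qed
qed

text \<open>Heights at which the confined profile may jump; \<open>0\<close> accounts for
  \<open>sgn\<close> at time zero and after the collapse. Finitely many horizontal lines form a null
  set.\<close>

definition interfaces :: "real \<Rightarrow> real \<Rightarrow> real set" where
  "interfaces A t = {0, ell A 1 t, ell A (-1) t}"

lemma square_profile_cases:
  assumes A: "\<bar>A\<bar> < 1" and t: "0 \<le> t" and y: "y \<noteq> 0" "\<bar>y\<bar> < 1"
  shows "plane_potential A t y < 2 - \<bar>y\<bar> \<Longrightarrow> square_profile A t y = plane_profile A t y"
    and "2 - \<bar>y\<bar> < plane_potential A t y \<Longrightarrow> square_profile A t y = - sgn y"
    and "y \<notin> interfaces A t \<Longrightarrow> plane_potential A t y \<noteq> 2 - \<bar>y\<bar>"
proof -
  have "(plane_potential A t y < 2 - \<bar>y\<bar> \<longrightarrow> square_profile A t y = plane_profile A t y) \<and>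
    (2 - \<bar>y\<bar> < plane_potential A t y \<longrightarrow> square_profile A t y = - sgn y) \<and>
    (y \<notin> interfaces A t \<longrightarrow> plane_potential A t y \<noteq> 2 - \<bar>y\<bar>)"
  proof (cases "y > 0")
    case True
    then show ?thesis using square_profile_upper[OF A t, of y] y by (auto simp: interfaces_def)
  next
    case False
    then have "0 < - y" "- y < 1" using y by auto
    moreover have "\<bar>- A\<bar> < 1" using A by simp
    ultimately show ?thesis
      using square_profile_upper[of "- A" t "- y"] y t False
      by (auto simp: interfaces_def square_profile_reflect[OF A] plane_profile_reflect[OF A] plane_potential_reflect[OF A]
          ell_reflect[OF A])
  qed
  then show "plane_potential A t y < 2 - \<bar>y\<bar> \<Longrightarrow> square_profile A t y = plane_profile A t y"
    and "2 - \<bar>y\<bar> < plane_potential A t y \<Longrightarrow> square_profile A t y = - sgn y"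
    and "y \<notin> interfaces A t \<Longrightarrow> plane_potential A t y \<noteq> 2 - \<bar>y\<bar>" by blast+
qed

definition square_potential :: "real \<Rightarrow> real \<Rightarrow> real \<Rightarrow> real" where
  "square_potential A t y = min (plane_potential A t y) (2 - \<bar>y\<bar>)"

text \<open>Off the interfaces one branch of the minimum is strictly smaller and, by continuity,
  stays smaller nearby, so its derivative is the derivative of the minimum.\<close>

lemma square_potential_deriv_space:
  assumes A: "\<bar>A\<bar> < 1" and t: "0 < t" and y: "\<bar>y\<bar> < 1" "y \<notin> interfaces A t"
  shows "(square_potential A t has_real_derivative square_profile A t y) (at y)"
proof -
  have y0: "y \<noteq> 0" using y by (auto simp: interfaces_def)
  have c: "continuous_on UNIV (plane_potential A t)"
    using plane_potential_deriv_space[OF A t] by (intro DERIV_continuous_on) (auto intro: has_field_derivative_at_within)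
  consider "plane_potential A t y < 2 - \<bar>y\<bar>" | "2 - \<bar>y\<bar> < plane_potential A t y"
    using square_profile_cases(3)[OF A _ y0 y] t by fastforce
  then show ?thesis
  proof cases
    case 1
    have "square_profile A t y = plane_profile A t y" using square_profile_cases(1)[OF A _ y0 y(1) 1] t by simp
    moreover have "(square_potential A t has_real_derivative plane_profile A t y) (at y)"
      by (rule has_field_derivative_transform_within_open[OF plane_potential_deriv_space[OF A t],
            where S = "{z. plane_potential A t z < 2 - \<bar>z\<bar>}"])
         (use 1 in \<open>auto simp: square_potential_def intro!: open_Collect_less continuous_intros c\<close>)
    ultimately show ?thesis by simp
  next
    case 2
    have "square_profile A t y = - sgn y" using square_profile_cases(2)[OF A _ y0 y(1) 2] t by simp
    \<comment> \<open>On the half line of the \<open>z\<close> with the sign of \<open>y\<close>,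
      the branch \<open>2 - \<bar>z\<bar>\<close> is this affine function.\<close>
    moreover have "((\<lambda>z. 2 - sgn y * z) has_real_derivative - sgn y) (at y)"
      by (auto intro!: derivative_eq_intros)
    then have "(square_potential A t has_real_derivative - sgn y) (at y)"
    proof (rule has_field_derivative_transform_within_open)
      show "open ({z. 2 - \<bar>z\<bar> < plane_potential A t z} \<inter> {z. 0 < sgn y * z})"
        by (intro open_Int open_Collect_less continuous_intros c)
      show "y \<in> {z. 2 - \<bar>z\<bar> < plane_potential A t z} \<inter> {z. 0 < sgn y * z}"
        using 2 y0 by (auto simp: sgn_if)
    qed (auto simp: square_potential_def sgn_if split: if_splits)
    ultimately show ?thesis by simp
  qed
qed

lemma square_potential_deriv_time:
  assumes A: "\<bar>A\<bar> < 1" and t: "0 < t" and y: "\<bar>y\<bar> < 1" "y \<notin> interfaces A t"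
  shows "((\<lambda>s. square_potential A s y) has_real_derivative - flux A (square_profile A t y)) (at t)"
proof -
  have y0: "y \<noteq> 0" using y by (auto simp: interfaces_def)
  have c: "continuous_on {0<..} (\<lambda>s. plane_potential A s y)"
    using plane_potential_deriv_time[OF A] by (intro DERIV_continuous_on) (auto intro: has_field_derivative_at_within)
  note o = continuous_open_preimage[OF c open_greaterThan open_lessThan, of "2 - \<bar>y\<bar>"]
    continuous_open_preimage[OF c open_greaterThan open_greaterThan, of "2 - \<bar>y\<bar>"]
  consider "plane_potential A t y < 2 - \<bar>y\<bar>" | "2 - \<bar>y\<bar> < plane_potential A t y"
    using square_profile_cases(3)[OF A _ y0 y] t by fastforce
  then show ?thesis
  proof cases
    case 1
    have "square_profile A t y = plane_profile A t y" using square_profile_cases(1)[OF A _ y0 y(1) 1] t by simp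
    moreover have "((\<lambda>s. square_potential A s y) has_real_derivative - flux A (plane_profile A t y)) (at t)"
      by (rule has_field_derivative_transform_within_open[OF plane_potential_deriv_time[OF A t] o(1)])
         (use 1 t in \<open>auto simp: square_potential_def\<close>)
    ultimately show ?thesis by simp
  next
    case 2
    \<comment> \<open>The flux vanishes at the pure values \<open>1\<close> and \<open>-1\<close>,
      which matches a branch that is constant in time.\<close>
    have "flux A (square_profile A t y) = 0"
      using square_profile_cases(2)[OF A _ y0 y(1) 2] t y0 by (auto simp: flux_def sgn_if)
    moreover have "((\<lambda>s. square_potential A s y) has_real_derivative 0) (at t)"
      by (rule has_field_derivative_transform_within_open[OF DERIV_const[of "2 - \<bar>y\<bar>"] o(2)])
         (use 2 t in \<open>auto simp: square_potential_def\<close>)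
    ultimately show ?thesis by simp
  qed
qed

text \<open>A strict order between the two branches persists for nearby times, also one-sidedly at
  time zero, so the profile follows a single branch.\<close>

lemma square_profile_tendsto_time:
  assumes A: "\<bar>A\<bar> < 1" and t: "0 \<le> t" and y: "\<bar>y\<bar> < 1" "y \<notin> interfaces A t"
  shows "((\<lambda>s. square_profile A s y) \<longlongrightarrow> square_profile A t y) (at t within {0..})"
proof -
  have y0: "y \<noteq> 0" using y by (auto simp: interfaces_def)
  have "((\<lambda>s. plane_potential A s y) \<longlongrightarrow> y * plane_profile A t y - t * flux A (plane_profile A t y)) (at t within {0..})"
    unfolding plane_potential_def
    by (intro tendsto_intros isCont_tendsto_compose[OF isCont_flux] A plane_profile_bound plane_profile_tendsto_time t y0)
  then have lim: "((\<lambda>s. plane_potential A s y) \<longlongrightarrow> plane_potential A t y) (at t within {0..})"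
    by (simp add: plane_potential_def)
  have nn: "eventually (\<lambda>s. 0 \<le> s) (at t within {0..})" by (simp add: eventually_at_filter)
  consider "plane_potential A t y < 2 - \<bar>y\<bar>" | "2 - \<bar>y\<bar> < plane_potential A t y"
    using square_profile_cases(3)[OF A _ y0 y] t by fastforce
  then show ?thesis
  proof cases
    case 1
    have ev: "eventually (\<lambda>s. plane_profile A s y = square_profile A s y) (at t within {0..})"
      using order_tendstoD(2)[OF lim 1] nn
      by eventually_elim (simp add: square_profile_cases(1)[OF A _ y0 y(1)])
    have e: "square_profile A t y = plane_profile A t y" using square_profile_cases(1)[OF A _ y0 y(1) 1] t by simp
    show ?thesis unfolding e
      by (rule Lim_transform_eventually[OF plane_profile_tendsto_time[OF A t y0] ev])
  next
    case 2
    have ev: "eventually (\<lambda>s. square_profile A s y = - sgn y) (at t within {0..})"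
      using order_tendstoD(1)[OF lim 2] nn
      by eventually_elim (simp add: square_profile_cases(2)[OF A _ y0 y(1)])
    have e: "square_profile A t y = - sgn y" using square_profile_cases(2)[OF A _ y0 y(1) 2] t by simp
    show ?thesis unfolding e using ev by (rule tendsto_eventually)
  qed
qed

lemma square_potential_lipschitz_time:
  assumes A: "\<bar>A\<bar> < 1" and t: "0 \<le> t" "0 \<le> t'"
  shows "\<bar>square_potential A t' y - square_potential A t y\<bar> \<le> 1 / (1 - \<bar>A\<bar>) * \<bar>t' - t\<bar>"
  using plane_potential_lipschitz_time[OF A t, of y] by (auto simp: square_potential_def min_def)

text \<open>Testing the maximum with the slopes \<open>1\<close> and \<open>-1\<close>, where the
  flux vanishes, shows that the fan branch is at least \<open>1\<close> at the walls; the other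
  branch equals \<open>1\<close> there. A constant potential at a wall is the no-flux
  condition.\<close>

lemma square_potential_end:
  assumes A: "\<bar>A\<bar> < 1" and t: "0 \<le> t"
  shows "square_potential A t 1 = 1" "square_potential A t (-1) = 1"
  using plane_potential_max[OF A t, of 1 1] plane_potential_max[OF A t, of "-1" "-1"]
  by (auto simp: square_potential_def flux_def)

lemma continuous_on_plane_potential: "\<bar>A\<bar> < 1 \<Longrightarrow> 0 < t \<Longrightarrow> continuous_on S (plane_potential A t)"
  using plane_potential_deriv_space[of A t]
  by (intro DERIV_continuous_on) (auto intro: has_field_derivative_at_within)

lemma continuous_on_square_potential: "\<bar>A\<bar> < 1 \<Longrightarrow> 0 < t \<Longrightarrow> continuous_on S (square_potential A t)"
  unfolding square_potential_def by (intro continuous_intros continuous_on_plane_potential)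

section \<open>Measurability of the profiles\<close>

lemma borel_measurable_vartheta [measurable]: "vartheta A t \<in> borel_measurable borel"
  unfolding vartheta_def by measurable

lemma borel_measurable_plane_profile [measurable]: "plane_profile A t \<in> borel_measurable borel"
  unfolding plane_profile_def by measurable

lemma borel_measurable_square_profile [measurable]: "square_profile A t \<in> borel_measurable borel"
  unfolding square_profile_def by measurable

lemma borel_measurable_flux [measurable]: "flux A \<in> borel_measurable borel"
  unfolding flux_def by measurable

section \<open>Integration on the plane\<close>

text \<open>The passage to \<open>lborel\<close> on the whole space gives access to its product
  structure, and so to iterated integrals.\<close>

lemma integral_lebesgue_on_lborel:
  fixes f :: "'a::euclidean_space \<Rightarrow> real"
  assumes S: "S \<in> sets borel" and f: "(\<lambda>x. indicator S x * f x) \<in> borel_measurable borel"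
  shows "(\<integral>x. f x \<partial>lebesgue_on S) = (\<integral>x. indicator S x * f x \<partial>lborel)"
proof -
  have "(\<integral>x. f x \<partial>lebesgue_on S) = (\<integral>x. indicator S x *\<^sub>R f x \<partial>lebesgue)"
    using S by (intro integral_restrict_space) auto
  also have "\<dots> = (\<integral>x. indicator S x * f x \<partial>lborel)"
    using f by (simp add: integral_completion)
  finally show ?thesis .
qed

lemma integrable_lborel_bounded:
  fixes g :: "'a::euclidean_space \<Rightarrow> real"
  assumes g: "g \<in> borel_measurable borel" and bd: "\<And>x. \<bar>g x\<bar> \<le> C"
    and 0: "\<And>x. x \<notin> cbox a b \<Longrightarrow> g x = 0"
  shows "integrable lborel g"
proof (rule Bochner_Integration.integrable_bound)
  show "integrable lborel (\<lambda>x. C * indicator (cbox a b) x :: real)"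
    using emeasure_lborel_cbox_finite[of a b]
    by (intro integrable_mult_right integrable_real_indicator) auto
  show "AE x in lborel. norm (g x) \<le> norm (C * indicator (cbox a b) x)"
    using order_trans[OF bd abs_ge_self[of C]] 0 by (intro AE_I2) (auto simp: indicator_def)
qed (use g in auto)

text \<open>\<open>N\<close> is meant for the kinks of \<open>F\<close>: continuity across finitely
  many of them is enough for the fundamental theorem.\<close>

lemma integral_lborel_deriv:
  fixes F g :: "real \<Rightarrow> real"
  assumes g: "g \<in> borel_measurable borel" and bd: "\<And>y. \<bar>g y\<bar> \<le> C"
    and 0: "\<And>y. y \<notin> {a<..<b} \<Longrightarrow> g y = 0" and ab: "a \<le> b" and N: "finite N"
    and der: "\<And>y. y \<in> {a<..<b} - N \<Longrightarrow> (F has_real_derivative g y) (at y)"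
    and cont: "continuous_on {a..b} F" and ends: "F a = F b"
  shows "(\<integral>y. g y \<partial>lborel) = 0"
proof -
  have "(g has_integral (F b - F a)) {a..b}"
    using der cont N ab
    by (intro fundamental_theorem_of_calculus_interior_strong[of N])
       (auto simp: has_real_derivative_iff_has_vector_derivative)
  then have "(g has_integral 0) {a..b}" using ends by simp
  then have "(g has_integral 0) UNIV"
    by (rule has_integral_on_superset) (use 0 in auto)
  moreover have "(g has_integral (integral\<^sup>L lborel g)) UNIV"
    by (intro has_integral_integral_lborel integrable_lborel_bounded[OF g bd, of a b])
       (use 0 in auto)
  ultimately show ?thesis by (rule has_integral_unique[symmetric])
qed

text \<open>Vertical lines serve the integration by parts in the weak formulation, horizontal lines
  serve the curl constraint; hence the disjunction.\<close>

lemma integral_lborel_iterated_zero: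
  fixes g :: "plane \<Rightarrow> real"
  assumes g: "g \<in> borel_measurable borel" and bd: "\<And>x. \<bar>g x\<bar> \<le> C"
    and 0: "\<And>x. x \<notin> cbox a b \<Longrightarrow> g x = 0"
    and iter: "(\<forall>x1. (\<integral>x2. g (x1, x2) \<partial>lborel) = 0) \<or> (\<forall>x2. (\<integral>x1. g (x1, x2) \<partial>lborel) = 0)"
  shows "(\<integral>x. g x \<partial>lborel) = 0"
proof -
  have int: "integrable (lborel \<Otimes>\<^sub>M lborel) g"
    using integrable_lborel_bounded[OF g bd 0] by (simp add: lborel_prod)
  have "(\<integral>x. g x \<partial>lborel) = (\<integral>x1. (\<integral>x2. g (x1, x2) \<partial>lborel) \<partial>lborel)"
    using lborel_pair.integral_fst'[OF int] by (simp add: lborel_prod)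
  moreover have "(\<integral>x. g x \<partial>lborel) = (\<integral>x2. (\<integral>x1. g (x1, x2) \<partial>lborel) \<partial>lborel)"
    using lborel_pair.integral_snd[of "\<lambda>x1 x2. g (x1, x2)"] int by (simp add: lborel_prod)
  ultimately show ?thesis using iter by auto
qed

lemma borel_measurable_snd:
  fixes f :: "real \<Rightarrow> 'b::topological_space"
  assumes "f \<in> borel_measurable borel"
  shows "(\<lambda>x :: plane. f (snd x)) \<in> borel_measurable borel"
  by (rule measurable_compose[OF borel_measurable_continuous_onI assms]) (intro continuous_intros)

lemma borel_measurable_fst:
  fixes f :: "plane \<Rightarrow> plane"
  assumes "f \<in> borel_measurable borel"
  shows "(\<lambda>x. fst (f x)) \<in> borel_measurable borel"
  by (rule measurable_compose[OF assms borel_measurable_continuous_onI]) (intro continuous_intros)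

lemma continuous_on_compact_bounded:
  fixes f :: "'a::topological_space \<Rightarrow> 'b::real_normed_vector"
  assumes "compact S" "continuous_on S f"
  obtains B where "0 < B" "\<And>x. x \<in> S \<Longrightarrow> norm (f x) \<le> B"
  using compact_imp_bounded[OF compact_continuous_image[OF assms(2,1)]]
  unfolding bounded_pos by blast

definition open_box :: "real \<Rightarrow> plane set" where
  "open_box r = {-r<..<r} \<times> {-r<..<r}"

lemma open_box_sets [simp]: "open_box r \<in> sets borel" "open (open_box r)"
  unfolding open_box_def by (auto intro!: borel_open open_Times)

text \<open>On each vertical line the integrand is the derivative of the product of \<open>K\<close>
  and \<open>\<psi>\<close>. Only the product has to vanish at the ends, which covers both
  applications: in the plane the test function vanishes there, in the square the factor
  \<open>K\<close> does.\<close>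

lemma integral_by_parts_box:
  fixes K k :: "real \<Rightarrow> real" and \<psi> \<psi>2 :: "plane \<Rightarrow> real"
  assumes r: "0 < r" and N: "finite N"
    and K: "continuous_on {-r..r} K" "\<And>y. y \<in> {-r<..<r} - N \<Longrightarrow> (K has_real_derivative k y) (at y)"
    and k: "k \<in> borel_measurable borel" "\<And>y. \<bar>k y\<bar> \<le> C"
    and \<psi>: "continuous_on ({-r..r} \<times> {-r..r}) \<psi>" "continuous_on ({-r..r} \<times> {-r..r}) \<psi>2"
    and der: "\<And>x1 y. x1 \<in> {-r<..<r} \<Longrightarrow> y \<in> {-r<..<r} \<Longrightarrow>
      ((\<lambda>y. \<psi> (x1, y)) has_real_derivative \<psi>2 (x1, y)) (at y)"
    and bd: "\<And>x1. x1 \<in> {-r<..<r} \<Longrightarrow> K r * \<psi> (x1, r) = 0 \<and> K (-r) * \<psi> (x1, -r) = 0"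
  shows "(\<integral>x. k (snd x) * \<psi> x + K (snd x) * \<psi>2 x \<partial>lebesgue_on (open_box r)) = 0"
proof -
  let ?Q = "{-r..r} \<times> {-r..r}"
  define f where "f = (\<lambda>x. k (snd x) * \<psi> x + K (snd x) * \<psi>2 x)"
  define g where "g = (\<lambda>x. indicator (open_box r) x * f x)"
  have sub: "open_box r \<subseteq> ?Q" by (auto simp: open_box_def)
  have KQ: "continuous_on ?Q (\<lambda>x. K (snd x))"
    by (intro continuous_on_compose2[OF K(1)] continuous_intros) auto
  have m1: "(\<lambda>x. indicator (open_box r) x *\<^sub>R \<psi> x) \<in> borel_measurable borel"
    by (intro borel_measurable_continuous_on_indicator continuous_on_subset[OF \<psi>(1) sub]) simp
  have m2: "(\<lambda>x. indicator (open_box r) x *\<^sub>R (K (snd x) * \<psi>2 x)) \<in> borel_measurable borel"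
    by (intro borel_measurable_continuous_on_indicator continuous_on_subset[OF _ sub]
        continuous_on_mult KQ \<psi>(2)) simp
  \<comment> \<open>\<open>\<psi>\<close> is controlled only on the closed box, so the indicator is
    attached to it before the multiplication by \<open>k\<close>, which is Borel on the whole
    line.\<close>
  have "(\<lambda>x. k (snd x) * (indicator (open_box r) x *\<^sub>R \<psi> x)
      + indicator (open_box r) x *\<^sub>R (K (snd x) * \<psi>2 x)) \<in> borel_measurable borel"
    by (intro borel_measurable_add borel_measurable_times borel_measurable_snd k(1) m1 m2)
  also have "(\<lambda>x. k (snd x) * (indicator (open_box r) x *\<^sub>R \<psi> x)
      + indicator (open_box r) x *\<^sub>R (K (snd x) * \<psi>2 x)) = g"
    by (auto simp: g_def f_def algebra_simps)
  finally have gm: "g \<in> borel_measurable borel" .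
  have cQ: "compact ?Q" by (intro compact_Times) auto
  obtain B1 where B1: "\<And>x. x \<in> ?Q \<Longrightarrow> \<bar>\<psi> x\<bar> \<le> B1"
    using continuous_on_compact_bounded[OF cQ \<psi>(1)] unfolding real_norm_def by metis
  obtain B2 where B2: "\<And>x. x \<in> ?Q \<Longrightarrow> \<bar>K (snd x) * \<psi>2 x\<bar> \<le> B2"
    using continuous_on_compact_bounded[OF cQ continuous_on_mult[OF KQ \<psi>(2)]]
    unfolding real_norm_def by metis
  have C0: "0 \<le> C" using k(2)[of 0] by linarith
  have B0: "0 \<le> B1" "0 \<le> B2" using B1[of "(0, 0)"] B2[of "(0, 0)"] r by auto
  have gb: "\<bar>g x\<bar> \<le> C * B1 + B2" for x
  proof (cases "x \<in> open_box r")
    case True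
    then have x: "x \<in> ?Q" using sub by auto
    have "\<bar>k (snd x) * \<psi> x\<bar> \<le> C * B1"
      unfolding abs_mult using k(2) B1[OF x] C0 by (intro mult_mono) auto
    then show ?thesis using True B2[OF x] by (simp add: g_def f_def)
  next
    case False
    then show ?thesis using B0 C0 by (simp add: g_def)
  qed
  have "(\<integral>x. g x \<partial>lborel) = 0"
  proof (rule integral_lborel_iterated_zero[OF gm gb, of "(-r, -r)" "(r, r)"])
    fix x assume "x \<notin> cbox (-r, -r) (r, r)"
    then show "g x = 0" by (cases x) (auto simp: g_def open_box_def indicator_def cbox_Pair_eq)
  next
    have "(\<integral>x2. g (x1, x2) \<partial>lborel) = 0" for x1
    proof (cases "x1 \<in> {-r<..<r}")
      case False
      then have "(\<lambda>x2. g (x1, x2)) = (\<lambda>_. 0)" by (auto simp: g_def open_box_def indicator_def)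
      then show ?thesis by simp
    next
      case True
      let ?F = "\<lambda>y. K y * \<psi> (x1, y)"
      show ?thesis
      proof (rule integral_lborel_deriv[where a = "-r" and b = r and F = ?F])
        show "(\<lambda>x2. g (x1, x2)) \<in> borel_measurable borel" using gm by measurable
        show "\<bar>g (x1, y)\<bar> \<le> C * B1 + B2" for y by (rule gb)
        show "g (x1, y) = 0" if "y \<notin> {-r<..<r}" for y
          using that by (auto simp: g_def open_box_def indicator_def)
        show "(?F has_real_derivative g (x1, y)) (at y)" if y: "y \<in> {-r<..<r} - N" for y
        proof -
          have "g (x1, y) = k y * \<psi> (x1, y) + \<psi>2 (x1, y) * K y"
            using True y by (auto simp: g_def f_def open_box_def)
          then show ?thesis using DERIV_mult[OF K(2)[OF y] der[OF True, of y]] y by simp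
        qed
        show "continuous_on {-r..r} ?F"
          using True
          by (intro continuous_on_mult K(1) continuous_on_compose2[OF \<psi>(1)] continuous_intros) auto
        show "?F (-r) = ?F r" using bd[OF True] by auto
      qed (use r N in auto)
    qed
    then show "(\<forall>x1. (\<integral>x2. g (x1, x2) \<partial>lborel) = 0) \<or> (\<forall>x2. (\<integral>x1. g (x1, x2) \<partial>lborel) = 0)"
      by blast
  qed
  then show ?thesis
    using integral_lebesgue_on_lborel[of "open_box r" f] gm by (simp add: g_def f_def)
qed

text \<open>At an interior point the derivative within \<open>S\<close> is the full derivative and
  hence unique, and near a point off the support the function is constantly zero.\<close>

lemma C1c_zero_outside_support:
  assumes S: "C1c S \<phi> D\<phi>" and x: "x \<in> interior S" "x \<notin> closure {x \<in> S. \<phi> x \<noteq> 0}"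
  shows "D\<phi> x = 0"
proof -
  let ?K = "closure {x \<in> S. \<phi> x \<noteq> 0}"
  have xS: "x \<in> S" using x interior_subset by auto
  have "(\<phi> has_derivative (\<lambda>h. D\<phi> x \<bullet> h)) (at x within S)" using S xS by (auto simp: C1c_def)
  then have 1: "(\<phi> has_derivative (\<lambda>h. D\<phi> x \<bullet> h)) (at x)" using x at_within_interior by metis
  have o: "open (interior S \<inter> - ?K)" by auto
  have "((\<lambda>_. 0) has_derivative (\<lambda>h. D\<phi> x \<bullet> h)) (at x)"
  proof (rule has_derivative_transform_within_open[OF 1 o])
    show "x \<in> interior S \<inter> - ?K" using x by auto
    show "\<phi> z = 0" if "z \<in> interior S \<inter> - ?K" for z
      using that interior_subset[of S] closure_subset[of "{x \<in> S. \<phi> x \<noteq> 0}"] by auto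
  qed
  then have "(\<lambda>h. D\<phi> x \<bullet> h) = (\<lambda>h. 0)"
    by (rule has_derivative_unique) simp
  then show ?thesis by (metis inner_eq_zero_iff)
qed

text \<open>On a horizontal line the weight is constant, and what remains is the integral of a
  derivative with compact support. This is why stratified states satisfy the curl
  constraint.\<close>

lemma integral_tangential_derivative:
  fixes D :: "plane set"
  assumes D: "open D" and \<psi>: "C1c D \<psi> D\<psi>"
    and W: "W \<in> borel_measurable borel" "\<And>y. \<bar>W y\<bar> \<le> C"
  shows "(\<integral>x. W (snd x) * fst (D\<psi> x) \<partial>lebesgue_on D) = 0"
proof -
  define K where "K = closure {x \<in> D. \<psi> x \<noteq> 0}"
  have K: "compact K" "K \<subseteq> D" and Dc: "continuous_on D D\<psi>"
    and der: "\<And>x. x \<in> D \<Longrightarrow> (\<psi> has_derivative (\<lambda>h. D\<psi> x \<bullet> h)) (at x)"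
    using \<psi> at_within_open[OF _ D] unfolding C1c_def K_def[symmetric] by (simp_all del: split_paired_All)
  have D0: "D\<psi> x = 0" if "x \<in> D" "x \<notin> K" for x
    using C1c_zero_outside_support[OF \<psi>, of x] that D by (auto simp: K_def interior_open)
  have \<psi>0: "\<psi> x = 0" if "x \<in> D" "x \<notin> K" for x
    using that closure_subset[of "{x \<in> D. \<psi> x \<noteq> 0}"] by (auto simp: K_def)
  obtain R where R: "K \<subseteq> cbox (-R, -R) (R, R)" "0 < R"
  proof -
    obtain b where b: "\<And>x. x \<in> K \<Longrightarrow> norm x \<le> b" using compact_imp_bounded[OF K(1)] unfolding bounded_iff by blast
    have "K \<subseteq> cbox (- max b 1, - max b 1) (max b 1, max b 1)"
    proof
      fix x assume "x \<in> K"
      then have "\<bar>fst x\<bar> \<le> max b 1" "\<bar>snd x\<bar> \<le> max b 1"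
        using b[of x] norm_fst_le[of "fst x" "snd x"] norm_snd_le[of "snd x" "fst x"] by auto
      then show "x \<in> cbox (- max b 1, - max b 1) (max b 1, max b 1)"
        by (cases x) (auto simp: cbox_Pair_eq)
    qed
    then show thesis by (intro that[of "max b 1"]) auto
  qed
  define g where "g = (\<lambda>x. indicator D x * (W (snd x) * fst (D\<psi> x)))"
  have "(\<lambda>x. indicator D x *\<^sub>R D\<psi> x) \<in> borel_measurable borel"
    by (intro borel_measurable_continuous_on_indicator Dc borel_open D)
  then have "(\<lambda>x. W (snd x) * fst (indicator D x *\<^sub>R D\<psi> x)) \<in> borel_measurable borel"
    by (intro borel_measurable_times borel_measurable_snd W(1) borel_measurable_fst)
  also have "(\<lambda>x. W (snd x) * fst (indicator D x *\<^sub>R D\<psi> x)) = g"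
    by (auto simp: g_def indicator_def)
  finally have gm: "g \<in> borel_measurable borel" .
  obtain B where B: "\<And>x. x \<in> K \<Longrightarrow> norm (D\<psi> x) \<le> B" "0 < B"
    using continuous_on_compact_bounded[OF K(1) continuous_on_subset[OF Dc K(2)]] by blast
  have C0: "0 \<le> C" using W(2)[of 0] by linarith
  have g0: "g x = 0" if "x \<notin> K" for x using D0 that by (auto simp: g_def indicator_def)
  have gb: "\<bar>g x\<bar> \<le> C * B" for x
  proof (cases "x \<in> K")
    case True
    have "\<bar>fst (D\<psi> x)\<bar> \<le> B"
      using B(1)[OF True] norm_fst_le[of "fst (D\<psi> x)" "snd (D\<psi> x)"] by simp
    then have "\<bar>W (snd x) * fst (D\<psi> x)\<bar> \<le> C * B"
      unfolding abs_mult using W(2) C0 by (intro mult_mono) auto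
    then show ?thesis using True K by (auto simp: g_def)
  qed (use g0 C0 B(2) in auto)
  have "(\<integral>x. g x \<partial>lborel) = 0"
  proof (rule integral_lborel_iterated_zero[OF gm gb, of "(-R, -R)" "(R, R)"])
    show "g x = 0" if "x \<notin> cbox (-R, -R) (R, R)" for x using g0[of x] R(1) that by blast
    have "(\<integral>x1. g (x1, x2) \<partial>lborel) = 0" for x2
    proof -
      \<comment> \<open>Extension by zero is smooth along the line even if the line leaves
        \<open>D\<close>: the support \<open>K\<close> is a compact subset of \<open>D\<close>, so
        every point outside \<open>D\<close> has a neighbourhood free of \<open>K\<close>.\<close>
      let ?F = "\<lambda>x1. W x2 * (if (x1, x2) \<in> D then \<psi> (x1, x2) else 0)"
      have F: "(?F has_real_derivative g (x1, x2)) (at x1)" for x1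
      proof (cases "(x1, x2) \<in> D")
        case True
        have "((\<lambda>z. (z, x2)) has_derivative (\<lambda>h. (h, 0))) (at x1)"
          by (auto intro!: derivative_eq_intros)
        from has_derivative_compose[OF this der[OF True]]
        have "((\<lambda>z. \<psi> (z, x2)) has_real_derivative fst (D\<psi> (x1, x2))) (at x1)"
          by (simp add: has_field_derivative_def inner_prod_def mult_commute_abs)
        then have "((\<lambda>z. W x2 * \<psi> (z, x2)) has_real_derivative g (x1, x2)) (at x1)"
          using DERIV_cmult[of _ _ x1 UNIV "W x2"] True by (simp add: g_def)
        moreover have "open ((\<lambda>z. (z, x2)) -` D)"
          by (intro open_vimage D continuous_intros)
        ultimately show ?thesis
          by (rule has_field_derivative_transform_within_open) (use True in auto)
      next
        case False
        have "open ((\<lambda>z. (z, x2)) -` (- K))"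
          by (intro open_vimage continuous_intros) (use K compact_imp_closed in auto)
        moreover have "(x1, x2) \<notin> K" using False K by auto
        ultimately have "(?F has_real_derivative 0) (at x1)"
          by (intro has_field_derivative_transform_within_open[OF DERIV_const[of 0], where S = "(\<lambda>z. (z, x2)) -` (- K)"])
             (use \<psi>0 in auto)
        then show ?thesis using False by (simp add: g_def)
      qed
      show ?thesis
      proof (rule integral_lborel_deriv[where a = "-R - 1" and b = "R + 1" and F = ?F and N = "{}"])
        show "(\<lambda>x1. g (x1, x2)) \<in> borel_measurable borel" using gm by measurable
        show "\<bar>g (x1, x2)\<bar> \<le> C * B" for x1 by (rule gb)
        show "g (x1, x2) = 0" if "x1 \<notin> {-R - 1<..<R + 1}" for x1
          using that R by (intro g0) (auto simp: cbox_Pair_eq)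
        show "continuous_on {-R - 1..R + 1} ?F"
          by (rule DERIV_continuous_on) (rule has_field_derivative_at_within[OF F])
        \<comment> \<open>The margin \<open>1\<close> puts both end points off the support.\<close>
        have "(-R - 1, x2) \<notin> K" "(R + 1, x2) \<notin> K" using R by (auto simp: cbox_Pair_eq)
        then show "?F (-R - 1) = ?F (R + 1)" using \<psi>0 by simp
      qed (use R F in auto)
    qed
    then show "(\<forall>x1. (\<integral>x2. g (x1, x2) \<partial>lborel) = 0) \<or> (\<forall>x2. (\<integral>x1. g (x1, x2) \<partial>lborel) = 0)"
      by blast
  qed
  then show ?thesis
    using integral_lebesgue_on_lborel[of D "\<lambda>x. W (snd x) * fst (D\<psi> x)"] gm D by (simp add: g_def)
qed

text \<open>Dominated convergence for a continuous parameter, obtained by testing with all sequences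
  in \<open>S - {t}\<close> that tend to \<open>t\<close>.\<close>

lemma tendsto_integral_within:
  fixes f :: "real \<Rightarrow> 'a \<Rightarrow> real"
  assumes f: "\<And>s. s \<in> S - {t} \<Longrightarrow> f s \<in> borel_measurable M" and h: "h \<in> borel_measurable M"
    and w: "integrable M w"
    and lim: "AE x in M. ((\<lambda>s. f s x) \<longlongrightarrow> h x) (at t within S)"
    and bd: "\<And>s. s \<in> S - {t} \<Longrightarrow> AE x in M. norm (f s x) \<le> w x"
  shows "((\<lambda>s. \<integral>x. f s x \<partial>M) \<longlongrightarrow> (\<integral>x. h x \<partial>M)) (at t within S)"
  unfolding tendsto_at_iff_sequentially comp_def
proof (intro allI impI)
  fix X assume X: "\<forall>i. X i \<in> S - {t}" "X \<longlonglongrightarrow> t"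
  show "(\<lambda>i. \<integral>x. f (X i) x \<partial>M) \<longlonglongrightarrow> (\<integral>x. h x \<partial>M)"
  proof (rule integral_dominated_convergence[OF h _ w])
    show "AE x in M. (\<lambda>i. f (X i) x) \<longlonglongrightarrow> h x"
      using lim
    proof eventually_elim
      case (elim x)
      then show ?case using X unfolding tendsto_at_iff_sequentially comp_def by blast
    qed
  qed (use X f bd in auto)
qed

section \<open>Null lines and slices of test functions\<close>

lemma AE_snd_notin_finite:
  assumes D: "D \<in> sets lebesgue" and N: "finite N"
  shows "AE x in lebesgue_on D. snd (x::plane) \<notin> N"
proof -
  have "negligible (\<Union>c\<in>N. {x::plane. (0, 1) \<bullet> x = c})"
    by (intro negligible_Union finite_imageI N) (auto intro!: negligible_hyperplane simp: zero_prod_def)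
  moreover have "(\<Union>c\<in>N. {x::plane. (0, 1) \<bullet> x = c}) = {x. snd x \<in> N}"
    by (auto simp: inner_prod_def)
  ultimately have "AE x in lebesgue. x \<notin> {x::plane. snd x \<in> N}"
    by (intro AE_not_in) (simp add: negligible_iff_null_sets)
  then show ?thesis using D by (subst AE_restrict_space_iff) (auto elim: eventually_mono)
qed

lemma has_real_derivative_time_slice:
  fixes \<phi> :: "real \<times> plane \<Rightarrow> real"
  assumes der: "(\<phi> has_derivative (\<lambda>h. d \<bullet> h)) (at (s, x) within T \<times> Q)" and x: "x \<in> Q"
  shows "((\<lambda>s. \<phi> (s, x)) has_real_derivative fst d) (at s within T)"
proof -
  have 1: "((\<lambda>s. (s, x)) has_derivative (\<lambda>h. (h, 0))) (at s within T)"
    by (auto intro!: derivative_eq_intros)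
  have "(\<phi> has_derivative (\<lambda>h. d \<bullet> h)) (at (s, x) within (\<lambda>s. (s, x)) ` T)"
    by (rule has_derivative_subset[OF der]) (use x in auto)
  from has_derivative_in_compose[OF 1 this] show ?thesis
    by (simp add: has_field_derivative_def inner_prod_def mult_commute_abs)
qed

lemma has_real_derivative_vertical_slice:
  fixes \<phi> :: "real \<times> plane \<Rightarrow> real"
  assumes der: "(\<phi> has_derivative (\<lambda>h. d \<bullet> h)) (at (s, (x1, y)) within T \<times> (X \<times> Y))"
    and s: "s \<in> T" "x1 \<in> X"
  shows "((\<lambda>y. \<phi> (s, (x1, y))) has_real_derivative snd (snd d)) (at y within Y)"
proof -
  have 1: "((\<lambda>y. (s, (x1, y))) has_derivative (\<lambda>h. (0, (0, h)))) (at y within Y)"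
    by (auto intro!: derivative_eq_intros)
  have "(\<phi> has_derivative (\<lambda>h. d \<bullet> h)) (at (s, (x1, y)) within (\<lambda>y. (s, (x1, y))) ` Y)"
    by (rule has_derivative_subset[OF der]) (use s in auto)
  from has_derivative_in_compose[OF 1 this] show ?thesis
    by (simp add: has_field_derivative_def inner_prod_def mult_commute_abs zero_prod_def)
qed

lemma measurable_lebesgue_on_snd:
  fixes f :: "real \<Rightarrow> 'b::topological_space"
  assumes "f \<in> borel_measurable borel"
  shows "(\<lambda>x :: plane. f (snd x)) \<in> borel_measurable (lebesgue_on D)"
  using borel_measurable_snd[OF assms] by (intro measurable_restrict_space1 measurable_completion) simp

text \<open>
  As \<open>\<phi>\<close> is only \<open>C\<^sup>1\<close>, it has no mixed second derivatives to integrate by parts with. Instead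
  \<open>\<integral> \<theta> \<phi>\<close> is differentiated in time, where the difference quotient of \<open>\<theta> = \<partial>\<^sub>y \<Psi>\<close> is moved onto
  \<open>\<phi>\<close> before passing to the limit.
\<close>

lemma weak_formulation_box:
  fixes \<theta> m \<Psi> :: "real \<Rightarrow> real \<Rightarrow> real" and \<phi> :: "real \<times> plane \<Rightarrow> real"
  assumes r: "0 < r" and t: "0 \<le> t"
    and \<theta>_meas: "\<And>s. 0 \<le> s \<Longrightarrow> \<theta> s \<in> borel_measurable borel"
    and m_meas: "\<And>s. 0 \<le> s \<Longrightarrow> m s \<in> borel_measurable borel"
    and \<theta>_bd: "\<And>s y. 0 \<le> s \<Longrightarrow> \<bar>\<theta> s y\<bar> \<le> 1"
    and m_bd: "\<And>s y. 0 \<le> s \<Longrightarrow> \<bar>m s y\<bar> \<le> C"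
    and N: "\<And>s. 0 \<le> s \<Longrightarrow> finite (N s)"
    and \<theta>_lim: "\<And>s y. 0 \<le> s \<Longrightarrow> y \<in> {-r<..<r} - N s \<Longrightarrow>
      ((\<lambda>s. \<theta> s y) \<longlongrightarrow> \<theta> s y) (at s within {0..})"
    and \<Psi>_space: "\<And>s y. 0 < s \<Longrightarrow> y \<in> {-r<..<r} - N s \<Longrightarrow> (\<Psi> s has_real_derivative \<theta> s y) (at y)"
    and \<Psi>_cont: "\<And>s. 0 < s \<Longrightarrow> continuous_on {-r..r} (\<Psi> s)"
    and \<Psi>_time: "\<And>s y. 0 < s \<Longrightarrow> y \<in> {-r<..<r} - N s \<Longrightarrow>
      ((\<lambda>s. \<Psi> s y) has_real_derivative - m s y) (at s)"
    and \<Psi>_lip: "\<And>s s' y. 0 < s \<Longrightarrow> 0 < s' \<Longrightarrow> \<bar>\<Psi> s' y - \<Psi> s y\<bar> \<le> C * \<bar>s' - s\<bar>"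
    and der: "\<And>p. p \<in> {0..} \<times> ({-r..r} \<times> {-r..r}) \<Longrightarrow>
      (\<phi> has_derivative (\<lambda>h. D\<phi> p \<bullet> h)) (at p within {0..} \<times> ({-r..r} \<times> {-r..r}))"
    and D\<phi>_cont: "continuous_on ({0..} \<times> ({-r..r} \<times> {-r..r})) D\<phi>"
    and ends: "\<And>s s' x1 b. 0 < s \<Longrightarrow> 0 < s' \<Longrightarrow> x1 \<in> {-r<..<r} \<Longrightarrow> b \<in> {r, -r} \<Longrightarrow>
      (\<Psi> s' b - \<Psi> s b) * \<phi> (s, (x1, b)) = 0"
  shows "(\<integral>\<tau>. (\<integral>x. \<theta> \<tau> (snd x) * fst (D\<phi> (\<tau>, x)) + m \<tau> (snd x) * snd (snd (D\<phi> (\<tau>, x)))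
        \<partial>lebesgue_on (open_box r)) \<partial>lebesgue_on {0..t})
      = (\<integral>x. \<theta> t (snd x) * \<phi> (t, x) \<partial>lebesgue_on (open_box r))
        - (\<integral>x. \<theta> 0 (snd x) * \<phi> (0, x) \<partial>lebesgue_on (open_box r))"
proof -
  let ?Q = "{-r..r} \<times> {-r..r}" and ?\<mu> = "lebesgue_on (open_box r)"
  \<comment> \<open>\<open>M\<close> pairs the profile with the test function and \<open>M'\<close>
    is its expected time derivative; the claim is the fundamental theorem for this pair.\<close>
  define M where "M = (\<lambda>s. \<integral>x. \<theta> s (snd x) * \<phi> (s, x) \<partial>?\<mu>)"
  define M' where "M' = (\<lambda>s. \<integral>x. \<theta> s (snd x) * fst (D\<phi> (s, x)) + m s (snd x) * snd (snd (D\<phi> (s, x))) \<partial>?\<mu>)"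
  have sub: "open_box r \<subseteq> ?Q" by (auto simp: open_box_def)
  have box_leb: "open_box r \<in> sets lebesgue" by auto
  have "open_box r \<in> lmeasurable"
    by (rule bounded_set_imp_lmeasurable[OF bounded_subset[OF _ sub] box_leb]) (intro bounded_Times; simp)
  then interpret finite_measure ?\<mu> by (rule finite_measure_lebesgue_on)
  have \<phi>_cont: "continuous_on ({0..} \<times> ?Q) \<phi>"
    by (rule has_derivative_continuous_on[OF der])
  have slice: "continuous_on ?Q (\<lambda>x. f (s, x))" if "continuous_on ({0..} \<times> ?Q) f" "0 \<le> s"
    for s and f :: "real \<times> plane \<Rightarrow> 'b::topological_space"
    using that by (intro continuous_on_compose2[OF that(1)] continuous_intros) auto
  have meas: "f \<in> borel_measurable ?\<mu>" if "continuous_on ?Q f" for f :: "plane \<Rightarrow> real"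
    by (rule continuous_imp_measurable_on_sets_lebesgue[OF continuous_on_subset[OF that sub] box_leb])
  have \<phi>s: "continuous_on ?Q (\<lambda>x. \<phi> (s, x))" if "0 \<le> s" for s by (rule slice[OF \<phi>_cont that])
  have \<phi>t: "continuous_on ?Q (\<lambda>x. fst (D\<phi> (s, x)))" if "0 \<le> s" for s
    by (intro continuous_on_fst slice[OF D\<phi>_cont that])
  have \<phi>y: "continuous_on ?Q (\<lambda>x. snd (snd (D\<phi> (s, x))))" if "0 \<le> s" for s
    by (intro continuous_on_snd slice[OF D\<phi>_cont that])
  have \<theta>m: "(\<lambda>x. \<theta> s (snd x)) \<in> borel_measurable ?\<mu>" "(\<lambda>x. m s (snd x)) \<in> borel_measurable ?\<mu>"
    if "0 \<le> s" for s
    using \<theta>_meas[OF that] m_meas[OF that] by (auto intro: measurable_lebesgue_on_snd)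
  \<comment> \<open>The margin \<open>1\<close> lets the times \<open>s'\<close> on either side of
    an \<open>s < t\<close> obey the same bounds.\<close>
  have cpt: "compact ({0..t + 1} \<times> ?Q)" by (intro compact_Times) auto
  have subS: "{0..t + 1} \<times> ?Q \<subseteq> {0..} \<times> ?Q" by auto
  obtain B1 where B1: "0 < B1" "\<And>p. p \<in> {0..t + 1} \<times> ?Q \<Longrightarrow> norm (\<phi> p) \<le> B1"
    using continuous_on_compact_bounded[OF cpt continuous_on_subset[OF \<phi>_cont subS]] by metis
  obtain B2 where B2: "0 < B2" "\<And>p. p \<in> {0..t + 1} \<times> ?Q \<Longrightarrow> norm (D\<phi> p) \<le> B2"
    using continuous_on_compact_bounded[OF cpt continuous_on_subset[OF D\<phi>_cont subS]] by metis
  have C0: "0 \<le> C" using m_bd[of 0 0] by simp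
  have b1: "\<bar>\<phi> (s, x)\<bar> \<le> B1" if "0 \<le> s" "s \<le> t + 1" "x \<in> ?Q" for s x
    using B1(2)[of "(s, x)"] that by simp
  have bt: "\<bar>fst (D\<phi> (s, x))\<bar> \<le> B2" if "0 \<le> s" "s \<le> t + 1" "x \<in> ?Q" for s x
    using B2(2)[of "(s, x)"] norm_fst_le[of "fst (D\<phi> (s, x))" "snd (D\<phi> (s, x))"] that by simp
  have b_y: "\<bar>snd (snd (D\<phi> (s, x)))\<bar> \<le> B2" if "0 \<le> s" "s \<le> t + 1" "x \<in> ?Q" for s x
  proof -
    have "\<bar>snd (snd (D\<phi> (s, x)))\<bar> \<le> norm (snd (D\<phi> (s, x)))"
      using norm_snd_le[of "snd (snd (D\<phi> (s, x)))" "fst (snd (D\<phi> (s, x)))"] by simp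
    also have "\<dots> \<le> norm (D\<phi> (s, x))"
      using norm_snd_le[of "snd (D\<phi> (s, x))" "fst (D\<phi> (s, x))"] by simp
    also have "\<dots> \<le> B2" using B2(2)[of "(s, x)"] that by simp
    finally show ?thesis .
  qed
  have dt: "((\<lambda>s. \<phi> (s, x)) has_real_derivative fst (D\<phi> (s, x))) (at s within {0..})"
    if "0 \<le> s" "x \<in> ?Q" for s x
    using der[of "(s, x)"] that by (intro has_real_derivative_time_slice) auto
  have dy: "((\<lambda>y. \<phi> (s, (x1, y))) has_real_derivative snd (snd (D\<phi> (s, (x1, y))))) (at y)"
    if "0 \<le> s" "x1 \<in> {-r<..<r}" "y \<in> {-r<..<r}" for s x1 y
  proof -
    have "((\<lambda>y. \<phi> (s, (x1, y))) has_real_derivative snd (snd (D\<phi> (s, (x1, y))))) (at y within {-r..r})"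
      using der[of "(s, (x1, y))"] that by (intro has_real_derivative_vertical_slice) auto
    moreover have "at y within {-r..r} = at y" using that by (intro at_within_interior) simp
    ultimately show ?thesis by simp
  qed
  have mvt: "\<bar>\<phi> (s', x) - \<phi> (s, x)\<bar> \<le> B2 * \<bar>s' - s\<bar>"
    if "s \<in> {0..t + 1}" "s' \<in> {0..t + 1}" "x \<in> ?Q" for s s' x
  proof -
    have "norm (\<phi> (s', x) - \<phi> (s, x)) \<le> B2 * norm (s' - s)"
    proof (rule field_differentiable_bound[where S = "{0..t + 1}"])
      fix z assume z: "z \<in> {0..t + 1}"
      show "((\<lambda>s. \<phi> (s, x)) has_real_derivative fst (D\<phi> (z, x))) (at z within {0..t + 1})"
        by (rule has_field_derivative_subset[OF dt]) (use z that in auto)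
      show "norm (fst (D\<phi> (z, x))) \<le> B2" using bt z that by simp
    qed (use that in auto)
    then show ?thesis by simp
  qed
  have AEN: "AE x in ?\<mu>. x \<in> open_box r \<and> snd x \<in> {-r<..<r} - N s" if "0 \<le> s" for s
    using AE_snd_notin_finite[OF box_leb N[OF that]] AE_space[of ?\<mu>]
    by eventually_elim (auto simp: open_box_def space_restrict_space)
  have inbox: "AE x in ?\<mu>. P x" if "\<And>x. x \<in> open_box r \<Longrightarrow> P x" for P
    using AE_space[of ?\<mu>] by eventually_elim (use that in \<open>auto simp: space_restrict_space\<close>)
  have int_bdd: "integrable ?\<mu> f" if "f \<in> borel_measurable ?\<mu>" "\<And>x. x \<in> open_box r \<Longrightarrow> \<bar>f x\<bar> \<le> B" for B :: real and f :: "plane \<Rightarrow> real"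
    using that by (intro integrable_const_bound[of _ B] inbox) auto

  \<comment> \<open>Continuity reaches down to time zero, where it rests on the limit of
    \<open>\<theta>\<close> alone; the potential enters only at positive times.\<close>
  have M_cont: "continuous_on {0..t} M"
  proof -
    have "(M \<longlongrightarrow> M s) (at s within {0..t})" if s: "s \<in> {0..t}" for s
    proof -
      have s0: "0 \<le> s" using s by simp
      show ?thesis
        unfolding M_def
      proof (rule tendsto_integral_within[where w = "\<lambda>_. B1"])
        fix s' assume s': "s' \<in> {0..t} - {s}"
        then show "(\<lambda>x. \<theta> s' (snd x) * \<phi> (s', x)) \<in> borel_measurable ?\<mu>"
          by (intro borel_measurable_times \<theta>m meas \<phi>s) auto
        show "AE x in ?\<mu>. norm (\<theta> s' (snd x) * \<phi> (s', x)) \<le> B1"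
        proof (rule inbox)
          fix x assume "x \<in> open_box r"
          then have "\<bar>\<theta> s' (snd x)\<bar> * \<bar>\<phi> (s', x)\<bar> \<le> 1 * B1"
            using s' sub by (intro mult_mono \<theta>_bd b1) auto
          then show "norm (\<theta> s' (snd x) * \<phi> (s', x)) \<le> B1" by (simp add: abs_mult)
        qed
      next
        show "(\<lambda>x. \<theta> s (snd x) * \<phi> (s, x)) \<in> borel_measurable ?\<mu>"
          using s by (intro borel_measurable_times \<theta>m meas \<phi>s) auto
        show "AE x in ?\<mu>. ((\<lambda>s. \<theta> s (snd x) * \<phi> (s, x)) \<longlongrightarrow> \<theta> s (snd x) * \<phi> (s, x)) (at s within {0..t})"
          using AEN[OF s0]
        proof eventually_elim
          case (elim x)
          have "((\<lambda>s. \<phi> (s, x)) \<longlongrightarrow> \<phi> (s, x)) (at s within {0..})"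
            using DERIV_continuous[OF dt[of s x]] s elim sub by (auto simp: continuous_within)
          moreover have "((\<lambda>s. \<theta> s (snd x)) \<longlongrightarrow> \<theta> s (snd x)) (at s within {0..})"
            using \<theta>_lim[of s "snd x"] s elim by auto
          ultimately have "((\<lambda>s. \<theta> s (snd x) * \<phi> (s, x)) \<longlongrightarrow> \<theta> s (snd x) * \<phi> (s, x)) (at s within {0..})"
            by (intro tendsto_mult)
          then show ?case by (rule tendsto_within_subset) auto
        qed
      qed auto
    qed
    then show ?thesis by (auto simp: continuous_on_def)
  qed

  have M_deriv: "(M has_real_derivative M' s) (at s)" if s: "0 < s" "s < t" for s
  proof -
    \<comment> \<open>Discrete product rule: the quotient of the product is \<open>\<theta>\<close>
      at \<open>s'\<close> times the quotient of \<open>\<phi>\<close>, plus the quotient of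
      \<open>\<theta>\<close> times \<open>\<phi>\<close> at \<open>s\<close>. The second term
      appears here already integrated by parts.\<close>
    let ?q = "\<lambda>s' x. \<theta> s' (snd x) * ((\<phi> (s', x) - \<phi> (s, x)) / (s' - s))
      + - ((\<Psi> s' (snd x) - \<Psi> s (snd x)) / (s' - s)) * snd (snd (D\<phi> (s, x)))"
    have quot: "(M s' - M s) / (s' - s) = (\<integral>x. ?q s' x \<partial>?\<mu>)" if s': "s' \<in> {0<..<t + 1} - {s}" for s'
    proof -
      define K where "K = (\<lambda>y. (\<Psi> s' y - \<Psi> s y) / (s' - s))"
      define k where "k = (\<lambda>y. (\<theta> s' y - \<theta> s y) / (s' - s))"
      have nz: "s' - s \<noteq> 0" using s' by auto
      have Km: "continuous_on {-r..r} K" unfolding K_def using s s' nz by (intro continuous_intros \<Psi>_cont) auto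
      have km: "k \<in> borel_measurable borel"
        unfolding k_def using \<theta>_meas[of s] \<theta>_meas[of s'] s s' by auto
      have kb: "\<bar>k y\<bar> \<le> 2 / \<bar>s' - s\<bar>" for y
        unfolding k_def abs_divide using \<theta>_bd[of s y] \<theta>_bd[of s' y] s s'
        by (intro divide_right_mono) auto
      have zero: "(\<integral>x. k (snd x) * \<phi> (s, x) + K (snd x) * snd (snd (D\<phi> (s, x))) \<partial>?\<mu>) = 0"
      proof (rule integral_by_parts_box[OF r, of "N s \<union> N s'" K k "2 / \<bar>s' - s\<bar>"])
        show "finite (N s \<union> N s')" using N s s' by auto
        show "(K has_real_derivative k y) (at y)" if "y \<in> {-r<..<r} - (N s \<union> N s')" for y
          unfolding K_def k_def using that s s' by (intro DERIV_cdivide DERIV_diff \<Psi>_space) auto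
        show "K r * \<phi> (s, x1, r) = 0 \<and> K (-r) * \<phi> (s, x1, -r) = 0" if "x1 \<in> {-r<..<r}" for x1
          using ends[of s s' x1 r] ends[of s s' x1 "-r"] that s s' by (auto simp: K_def)
      qed (use Km km kb \<phi>s \<phi>y dy s in auto)
      have m1: "(\<lambda>x. \<theta> u (snd x) * \<phi> (v, x)) \<in> borel_measurable ?\<mu>" if "0 \<le> u" "0 \<le> v" for u v
        using that by (intro borel_measurable_times \<theta>m meas \<phi>s) auto
      have i1: "integrable ?\<mu> (\<lambda>x. \<theta> u (snd x) * \<phi> (v, x))" if "0 \<le> u" "v \<in> {0..t + 1}" for u v
      proof (rule int_bdd[of _ "1 * B1"])
        fix x assume "x \<in> open_box r"
        then show "\<bar>\<theta> u (snd x) * \<phi> (v, x)\<bar> \<le> 1 * B1"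
          unfolding abs_mult using that sub by (intro mult_mono \<theta>_bd b1) auto
      qed (use m1 that in auto)
      have i2: "integrable ?\<mu> (\<lambda>x. k (snd x) * \<phi> (s, x) + K (snd x) * snd (snd (D\<phi> (s, x))))"
      proof -
        have "integrable ?\<mu> (\<lambda>x. (\<theta> s' (snd x) * \<phi> (s, x) - \<theta> s (snd x) * \<phi> (s, x)) / (s' - s))"
          using s s' by (intro integrable_divide Bochner_Integration.integrable_diff i1) auto
        moreover have "(\<lambda>x. (\<theta> s' (snd x) * \<phi> (s, x) - \<theta> s (snd x) * \<phi> (s, x)) / (s' - s)) = (\<lambda>x. k (snd x) * \<phi> (s, x))"
          by (simp add: k_def left_diff_distrib diff_divide_distrib)
        moreover have c: "continuous_on ?Q (\<lambda>x. K (snd x) * snd (snd (D\<phi> (s, x))))"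
          using s by (intro continuous_on_mult \<phi>y continuous_on_compose2[OF Km] continuous_intros) auto
        moreover obtain B where "\<And>x. x \<in> ?Q \<Longrightarrow> norm (K (snd x) * snd (snd (D\<phi> (s, x)))) \<le> B"
          using continuous_on_compact_bounded[OF compact_Times[OF compact_Icc compact_Icc] c] by metis
        then have "integrable ?\<mu> (\<lambda>x. K (snd x) * snd (snd (D\<phi> (s, x))))"
          by (intro int_bdd[of _ B] meas c) (use sub in auto)
        ultimately show ?thesis by simp
      qed
      have "(M s' - M s) / (s' - s) = (\<integral>x. (\<theta> s' (snd x) * \<phi> (s', x) - \<theta> s (snd x) * \<phi> (s, x)) / (s' - s) \<partial>?\<mu>)"
        unfolding M_def using i1 s s' by simp
      \<comment> \<open>Subtracting a vanishing integral trades the quotient of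
        \<open>\<theta>\<close> for the quotient of the potential.\<close>
      also have "\<dots> = (\<integral>x. (\<theta> s' (snd x) * \<phi> (s', x) - \<theta> s (snd x) * \<phi> (s, x)) / (s' - s) \<partial>?\<mu>)
          - (\<integral>x. k (snd x) * \<phi> (s, x) + K (snd x) * snd (snd (D\<phi> (s, x))) \<partial>?\<mu>)"
        using zero by simp
      also have "\<dots> = (\<integral>x. (\<theta> s' (snd x) * \<phi> (s', x) - \<theta> s (snd x) * \<phi> (s, x)) / (s' - s)
          - (k (snd x) * \<phi> (s, x) + K (snd x) * snd (snd (D\<phi> (s, x)))) \<partial>?\<mu>)"
        using i1 i2 s s' by (intro Bochner_Integration.integral_diff[symmetric]) auto
      also have "\<dots> = (\<integral>x. ?q s' x \<partial>?\<mu>)"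
        unfolding K_def k_def
        by (intro Bochner_Integration.integral_cong refl)
           (simp add: diff_divide_distrib algebra_simps)
      finally show ?thesis .
    qed
    \<comment> \<open>The mean value inequality bounds the quotient of \<open>\<phi>\<close> by
      \<open>B2\<close>, the Lipschitz estimate bounds that of the potential by \<open>C\<close>. A
      constant thus dominates, and the box has finite measure.\<close>
    have lim: "((\<lambda>s'. \<integral>x. ?q s' x \<partial>?\<mu>) \<longlongrightarrow> M' s) (at s within {0<..<t + 1})"
      unfolding M'_def
    proof (rule tendsto_integral_within[where w = "\<lambda>_. B2 + C * B2"])
      fix s' assume s': "s' \<in> {0<..<t + 1} - {s}"
      have \<Psi>c: "continuous_on ?Q (\<lambda>x. (\<Psi> s' (snd x) - \<Psi> s (snd x)) / (s' - s))"
        using s s' by (intro continuous_intros continuous_on_compose2[OF \<Psi>_cont]) auto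
      show "?q s' \<in> borel_measurable ?\<mu>"
        using s s' by (intro borel_measurable_add borel_measurable_times \<theta>m borel_measurable_uminus
            meas \<Psi>c \<phi>y continuous_intros \<phi>s) auto
      show "AE x in ?\<mu>. norm (?q s' x) \<le> B2 + C * B2"
      proof (rule inbox)
        fix x assume x: "x \<in> open_box r"
        have q1: "\<bar>(\<phi> (s', x) - \<phi> (s, x)) / (s' - s)\<bar> \<le> B2"
          using mvt[of s s' x] s s' x sub by (auto simp: abs_divide pos_divide_le_eq)
        have q2: "\<bar>(\<Psi> s' (snd x) - \<Psi> s (snd x)) / (s' - s)\<bar> \<le> C"
          using \<Psi>_lip[of s s' "snd x"] s s' by (auto simp: abs_divide pos_divide_le_eq)
        have "norm (?q s' x) \<le> \<bar>\<theta> s' (snd x)\<bar> * \<bar>(\<phi> (s', x) - \<phi> (s, x)) / (s' - s)\<bar>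
          + \<bar>(\<Psi> s' (snd x) - \<Psi> s (snd x)) / (s' - s)\<bar> * \<bar>snd (snd (D\<phi> (s, x)))\<bar>"
          unfolding real_norm_def by (rule order_trans[OF abs_triangle_ineq]) (simp only: abs_mult abs_minus_cancel order_refl)
        also have "\<dots> \<le> 1 * B2 + C * B2"
          using s s' x sub C0 B2(1) by (intro add_mono mult_mono \<theta>_bd q1 q2 b_y) auto
        finally show "norm (?q s' x) \<le> B2 + C * B2" by simp
      qed
    next
      show "(\<lambda>x. \<theta> s (snd x) * fst (D\<phi> (s, x)) + m s (snd x) * snd (snd (D\<phi> (s, x)))) \<in> borel_measurable ?\<mu>"
        using s by (intro borel_measurable_add borel_measurable_times \<theta>m meas \<phi>t \<phi>y) auto
      have sx: "at s within {0<..<t + 1} = at s" using s by (intro at_within_open) auto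
      show "AE x in ?\<mu>. ((\<lambda>s'. ?q s' x) \<longlongrightarrow>
          \<theta> s (snd x) * fst (D\<phi> (s, x)) + m s (snd x) * snd (snd (D\<phi> (s, x)))) (at s within {0<..<t + 1})"
        using AEN[OF less_imp_le[OF s(1)]]
      proof eventually_elim
        case (elim x)
        have i: "s \<in> interior {0..}" using s by (simp add: interior_real_atLeast)
        have "((\<lambda>s. \<phi> (s, x)) has_real_derivative fst (D\<phi> (s, x))) (at s)"
          using dt[of s x] s elim sub by (auto simp: at_within_interior[OF i])
        then have 1: "((\<lambda>s'. (\<phi> (s', x) - \<phi> (s, x)) / (s' - s)) \<longlongrightarrow> fst (D\<phi> (s, x))) (at s)"
          by (simp add: has_field_derivative_iff)
        have 2: "((\<lambda>s'. (\<Psi> s' (snd x) - \<Psi> s (snd x)) / (s' - s)) \<longlongrightarrow> - m s (snd x)) (at s)"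
          using \<Psi>_time[of s "snd x"] s elim by (auto simp: has_field_derivative_iff)
        have 3: "((\<lambda>s. \<theta> s (snd x)) \<longlongrightarrow> \<theta> s (snd x)) (at s)"
          using \<theta>_lim[of s "snd x"] s elim by (auto simp: at_within_interior[OF i])
        have "((\<lambda>s'. ?q s' x) \<longlongrightarrow> \<theta> s (snd x) * fst (D\<phi> (s, x)) + - (- m s (snd x)) * snd (snd (D\<phi> (s, x)))) (at s)"
          by (intro tendsto_add tendsto_mult tendsto_minus 1 2 3 tendsto_const)
        then show ?case unfolding sx by simp
      qed
    qed auto
    have sx: "at s within {0<..<t + 1} = at s" using s by (intro at_within_open) auto
    have "eventually (\<lambda>s'. s' \<in> {0<..<t + 1} - {s}) (at s)"
      using eventually_at_in_open[of "{0<..<t + 1}" s] s by auto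
    then have "eventually (\<lambda>s'. (\<integral>x. ?q s' x \<partial>?\<mu>) = (M s' - M s) / (s' - s)) (at s)"
      by eventually_elim (rule quot[symmetric])
    from Lim_transform_eventually[OF lim[unfolded sx] this] show ?thesis
      by (simp add: has_field_derivative_iff)
  qed

  have "(M' has_integral (M t - M 0)) {0..t}"
    using M_deriv by (intro fundamental_theorem_of_calculus_interior[OF t M_cont])
      (auto simp: has_real_derivative_iff_has_vector_derivative)
  \<comment> \<open>The fundamental theorem yields a gauge integral; boundedness of
    \<open>M'\<close> on the compact interval makes it a Lebesgue integral.\<close>
  moreover have M'_bd: "norm (M' s) \<le> (B2 + C * B2) * measure ?\<mu> (space ?\<mu>)" if s: "s \<in> {0..t}" for s
  proof -
    have "norm (M' s) \<le> (\<integral>x. norm (\<theta> s (snd x) * fst (D\<phi> (s, x)) + m s (snd x) * snd (snd (D\<phi> (s, x)))) \<partial>?\<mu>)"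
      unfolding M'_def by (rule integral_norm_bound)
    also have "\<dots> \<le> (\<integral>x. B2 + C * B2 \<partial>?\<mu>)"
    proof (rule integral_mono_AE)
      have bdd: "\<bar>\<theta> s (snd x) * fst (D\<phi> (s, x)) + m s (snd x) * snd (snd (D\<phi> (s, x)))\<bar> \<le> B2 + C * B2"
        if x: "x \<in> open_box r" for x
      proof -
        have "\<bar>\<theta> s (snd x)\<bar> * \<bar>fst (D\<phi> (s, x))\<bar> + \<bar>m s (snd x)\<bar> * \<bar>snd (snd (D\<phi> (s, x)))\<bar> \<le> 1 * B2 + C * B2"
          using s x sub C0 B2(1) by (intro add_mono mult_mono \<theta>_bd m_bd bt b_y) auto
        then show ?thesis by (simp add: abs_mult[symmetric])
      qed
      have "(\<lambda>x. \<theta> s (snd x) * fst (D\<phi> (s, x)) + m s (snd x) * snd (snd (D\<phi> (s, x)))) \<in> borel_measurable ?\<mu>"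
        using s by (intro borel_measurable_add borel_measurable_times \<theta>m meas \<phi>t \<phi>y) auto
      then show "integrable ?\<mu> (\<lambda>x. norm (\<theta> s (snd x) * fst (D\<phi> (s, x)) + m s (snd x) * snd (snd (D\<phi> (s, x)))))"
        using bdd by (intro integrable_norm int_bdd)
      show "AE x in ?\<mu>. norm (\<theta> s (snd x) * fst (D\<phi> (s, x)) + m s (snd x) * snd (snd (D\<phi> (s, x)))) \<le> B2 + C * B2"
        using bdd by (intro inbox) simp
    qed simp
    finally show ?thesis by (simp add: mult.commute)
  qed
  ultimately have int: "M' integrable_on {0..t}" "integral {0..t} M' = M t - M 0"
    by (auto simp: integrable_on_def integral_unique)
  have "M' absolutely_integrable_on {0..t}"
    by (rule absolutely_integrable_integrable_bound[OF M'_bd int(1)]) auto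
  then have "integrable (lebesgue_on {0..t}) M'"
    by (simp add: integrable_restrict_space set_integrable_def)
  then have "(\<integral>\<tau>. M' \<tau> \<partial>lebesgue_on {0..t}) = integral {0..t} M'"
    by (rule lebesgue_integral_eq_integral) auto
  then show ?thesis using int(2) by (simp add: M_def M'_def)
qed

section \<open>Subsolutions from profiles\<close>

definition fan_state :: "real \<Rightarrow> real \<Rightarrow> real \<Rightarrow> state" where
  "fan_state A \<alpha> a = (a, 0, (\<alpha> * flux A a) *\<^sub>R e_vert)"

lemma z_breve_fan_state: "z_breve \<Theta> A \<alpha> t x = fan_state A \<alpha> (\<Theta> A (\<alpha> * t) x)"
  by (simp add: z_breve_def fan_state_def flux_def Let_def)

lemma norm_e_vert [simp]: "norm e_vert = 1"
  by (simp add: e_vert_def norm_prod_def)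

lemma continuous_on_flux:
  assumes A: "\<bar>A\<bar> < 1"
  shows "continuous_on {-1..1} (flux A)"
  using isCont_flux[OF A] by (auto intro!: continuous_at_imp_continuous_on)

lemma continuous_on_fan_state:
  assumes A: "\<bar>A\<bar> < 1"
  shows "continuous_on {-1..1} (fan_state A \<alpha>)"
  unfolding fan_state_def by (intro continuous_intros continuous_on_flux[OF A])

text \<open>With zero velocity the vector in the hull condition is
  \<open>(1 - 2 * \<alpha>) * (1 - a\<^sup>2)\<close> times \<open>e_vert\<close>, so the strict
  inequality reads \<open>\<bar>1 - 2 * \<alpha>\<bar> < 1\<close>.\<close>

lemma fan_state_in_U:
  assumes A: "\<bar>A\<bar> < 1" and \<alpha>: "0 < \<alpha>" "\<alpha> < 1" and a: "\<bar>a\<bar> < 1"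
  shows "fan_state A \<alpha> a \<in> U_set A"
proof -
  have p: "0 < 1 - A * a" using one_minus_mult_pos[OF A] a by simp
  have q: "0 < 1 - a\<^sup>2" using a by (simp add: abs_square_less_1)
  have "(1 - a * A) * flux A a = - (1 - a\<^sup>2)" using p by (simp add: flux_def mult.commute)
  moreover have "2 * (1 - a * A) * (\<alpha> * flux A a) = 2 * \<alpha> * ((1 - a * A) * flux A a)"
    by (simp only: mult_ac)
  ultimately have "2 * (1 - a * A) * (\<alpha> * flux A a) = 2 * \<alpha> * (- (1 - a\<^sup>2))" by (simp only:)
  moreover have "2 * \<alpha> * (- (1 - a\<^sup>2)) + (1 - a\<^sup>2) = (1 - 2 * \<alpha>) * (1 - a\<^sup>2)"
    by (simp add: algebra_simps)
  ultimately have "(2 * (1 - a * A)) *\<^sub>R ((\<alpha> * flux A a) *\<^sub>R e_vert) + (1 - a\<^sup>2) *\<^sub>R e_vert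
      = ((1 - 2 * \<alpha>) * (1 - a\<^sup>2)) *\<^sub>R e_vert"
    by (simp only: scaleR_scaleR scaleR_left_distrib[symmetric])
  then have "norm ((2 * (1 - a * A)) *\<^sub>R ((\<alpha> * flux A a) *\<^sub>R e_vert) + (1 - a\<^sup>2) *\<^sub>R e_vert)
      = \<bar>1 - 2 * \<alpha>\<bar> * (1 - a\<^sup>2)"
    using q by (simp add: abs_mult)
  also have "\<dots> < 1 * (1 - a\<^sup>2)" using q \<alpha> by (intro mult_strict_right_mono) auto
  finally show ?thesis using a by (auto simp: U_set_def fan_state_def)
qed

text \<open>At \<open>a = 1\<close> and \<open>a = -1\<close> the strict inequality degenerates, and
  the pure states are reached as limits of states in the open hull.\<close>

lemma fan_state_in_closure_U:
  assumes A: "\<bar>A\<bar> < 1" and \<alpha>: "0 < \<alpha>" "\<alpha> < 1" and a: "\<bar>a\<bar> \<le> 1"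
  shows "fan_state A \<alpha> a \<in> closure (U_set A)"
proof -
  have "fan_state A \<alpha> ` closure {-1<..<1} \<subseteq> closure (U_set A)"
  proof (rule image_closure_subset)
    show "continuous_on (closure {-1<..<1}) (fan_state A \<alpha>)"
      using continuous_on_fan_state[OF A] by simp
    show "fan_state A \<alpha> ` {-1<..<1} \<subseteq> closure (U_set A)"
    proof (rule image_subsetI)
      fix b :: real assume "b \<in> {-1<..<1}"
      then have "fan_state A \<alpha> b \<in> U_set A" by (intro fan_state_in_U[OF A \<alpha>]) auto
      then show "fan_state A \<alpha> b \<in> closure (U_set A)" using closure_subset by blast
    qed
  qed simp
  moreover have "a \<in> closure {-1<..<1}" using a by auto
  ultimately show ?thesis by blast
qed

lemma norm_fan_state:
  assumes A: "\<bar>A\<bar> < 1" and \<alpha>: "0 < \<alpha>" "\<alpha> < 1" and a: "\<bar>a\<bar> \<le> 1"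
  shows "norm (fan_state A \<alpha> a) \<le> 1 + 1 / (1 - \<bar>A\<bar>)"
proof -
  have "norm (fan_state A \<alpha> a) \<le> norm a + norm ((0 :: plane), (\<alpha> * flux A a) *\<^sub>R e_vert)"
    unfolding fan_state_def by (rule norm_Pair_le)
  also have "norm ((0 :: plane), (\<alpha> * flux A a) *\<^sub>R e_vert) = \<bar>\<alpha>\<bar> * \<bar>flux A a\<bar>"
    by (simp add: norm_Pair abs_mult)
  also have "\<bar>\<alpha>\<bar> * \<bar>flux A a\<bar> \<le> 1 * (1 / (1 - \<bar>A\<bar>))"
    using \<alpha> by (intro mult_mono flux_bound A a) auto
  finally show ?thesis using a by simp
qed

lemma fan_state_measurable:
  assumes "\<theta> \<in> borel_measurable borel"
  shows "(\<lambda>y. fan_state A \<alpha> (\<theta> y)) \<in> borel_measurable borel"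
  unfolding fan_state_def using assms by measurable

text \<open>Zero velocity settles the divergence constraint. In the curl constraint the field is
  vertical and depends on the height only; paired with a rotated gradient it meets only the
  horizontal derivative.\<close>

lemma fan_profile_in_Linf_S:
  fixes \<theta> :: "real \<Rightarrow> real"
  assumes A: "\<bar>A\<bar> < 1" and \<alpha>: "0 < \<alpha>" "\<alpha> < 1" and D: "open D"
    and \<theta>: "\<theta> \<in> borel_measurable borel" "\<And>y. \<bar>\<theta> y\<bar> \<le> 1"
  shows "(\<lambda>x. fan_state A \<alpha> (\<theta> (snd x))) \<in> Linf_S A D"
proof -
  let ?W = "\<lambda>y. A * (\<alpha> * flux A (\<theta> y)) + \<theta> y"
  have W: "?W \<in> borel_measurable borel" using \<theta>(1) by measurable
  have Wb: "\<bar>?W y\<bar> \<le> 1 * (1 * (1 / (1 - \<bar>A\<bar>))) + 1" for y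
  proof -
    have "\<bar>A\<bar> * (\<bar>\<alpha>\<bar> * \<bar>flux A (\<theta> y)\<bar>) + \<bar>\<theta> y\<bar> \<le> 1 * (1 * (1 / (1 - \<bar>A\<bar>))) + 1"
      using A \<alpha> by (intro add_mono mult_mono flux_bound \<theta>(2)) auto
    then show ?thesis
      using abs_triangle_ineq[of "A * (\<alpha> * flux A (\<theta> y))" "\<theta> y"] unfolding abs_mult by linarith
  qed
  have tang: "(\<integral>x. ?W (snd x) * fst (D\<psi> x) \<partial>lebesgue_on D) = 0" if "C1c D \<psi> D\<psi>" for \<psi> D\<psi>
    by (rule integral_tangential_derivative[OF D that W Wb])
  have "(\<lambda>x. fan_state A \<alpha> (\<theta> (snd x))) \<in> Linf D"
    unfolding Linf_def
    using measurable_lebesgue_on_snd[OF fan_state_measurable[OF \<theta>(1)]]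
      norm_fan_state[OF A \<alpha> \<theta>(2)] by blast
  moreover have "(u_of s + A *\<^sub>R m_of s + theta_of s *\<^sub>R e_vert) \<bullet> perp d = (A * (\<alpha> * flux A a) + a) * fst d"
    if "s = fan_state A \<alpha> a" for s a d
    unfolding that by (simp add: fan_state_def perp_def e_vert_def distrib_right)
  note i = this[OF refl]
  moreover have "u_of (fan_state A \<alpha> a) = 0" for a by (simp add: fan_state_def)
  ultimately show ?thesis
    unfolding Linf_S_def using fan_state_in_closure_U[OF A \<alpha> \<theta>(2)] tang by simp
qed

text \<open>A uniform bound and pointwise convergence almost everywhere suffice, because each
  generating set of the topology tests against one integrable \<open>g\<close>, to which dominated
  convergence applies.\<close>

lemma weak_star_continuous:
  fixes z :: "real \<Rightarrow> plane \<Rightarrow> state"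
  assumes D: "D \<in> sets lebesgue" and z: "\<And>t. 0 \<le> t \<Longrightarrow> z t \<in> Linf_S A D"
    and bd: "\<And>t x. 0 \<le> t \<Longrightarrow> norm (z t x) \<le> C"
    and lim: "\<And>t. 0 \<le> t \<Longrightarrow> AE x in lebesgue_on D. ((\<lambda>s. z s x) \<longlongrightarrow> z t x) (at t within {0..})"
  shows "continuous_map (top_of_set {0..}) (subtopology (weak_star D) (Linf_S A D)) z"
proof -
  have zL: "z t \<in> Linf D" if "0 \<le> t" for t using z[OF that] by (auto simp: Linf_S_def)
  have zm: "z t \<in> borel_measurable (lebesgue_on D)" if "0 \<le> t" for t
    using zL[OF that] by (auto simp: Linf_def)
  have cont: "continuous_on {0..} (\<lambda>t. \<integral>x. z t x \<bullet> g x \<partial>lebesgue_on D)"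
    if g: "integrable (lebesgue_on D) g" for g
    unfolding continuous_on_def
  proof
    fix t :: real assume t: "t \<in> {0..}"
    show "((\<lambda>t. \<integral>x. z t x \<bullet> g x \<partial>lebesgue_on D) \<longlongrightarrow> (\<integral>x. z t x \<bullet> g x \<partial>lebesgue_on D)) (at t within {0..})"
    proof (rule tendsto_integral_within[where w = "\<lambda>x. C * norm (g x)"])
      show "(\<lambda>x. z s x \<bullet> g x) \<in> borel_measurable (lebesgue_on D)" if "s \<in> {0..} - {t}" for s
        using that zm g by (intro borel_measurable_inner) auto
      show "(\<lambda>x. z t x \<bullet> g x) \<in> borel_measurable (lebesgue_on D)"
        using t zm g by (intro borel_measurable_inner) auto
      show "integrable (lebesgue_on D) (\<lambda>x. C * norm (g x))" using g by auto
      show "AE x in lebesgue_on D. ((\<lambda>s. z s x \<bullet> g x) \<longlongrightarrow> z t x \<bullet> g x) (at t within {0..})"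
        using lim[of t] t by (auto elim!: eventually_mono intro!: tendsto_inner)
      fix s :: real assume s: "s \<in> {0..} - {t}"
      have "norm (z s x \<bullet> g x) \<le> C * norm (g x)" for x
        using Cauchy_Schwarz_ineq2[of "z s x" "g x"] mult_right_mono[OF bd[of s x], of "norm (g x)"] s by simp
      then show "AE x in lebesgue_on D. norm (z s x \<bullet> g x) \<le> C * norm (g x)" by simp
    qed
  qed
  have "continuous_map (top_of_set {0..}) (weak_star D) z"
    unfolding weak_star_def
  proof (rule continuous_on_generated_topo)
    fix U assume "U \<in> {{z \<in> Linf D. (\<integral>x. z x \<bullet> g x \<partial>lebesgue_on D) \<in> V} | g V.
        integrable (lebesgue_on D) g \<and> open V}"
    then obtain g V where U: "U = {z \<in> Linf D. (\<integral>x. z x \<bullet> g x \<partial>lebesgue_on D) \<in> V}"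
      and g: "integrable (lebesgue_on D) g" and V: "open V" by blast
    have "z -` U \<inter> topspace (top_of_set {0..}) = {0..} \<inter> (\<lambda>t. \<integral>x. z t x \<bullet> g x \<partial>lebesgue_on D) -` V"
      using zL by (auto simp: U)
    then show "openin (top_of_set {0..}) (z -` U \<inter> topspace (top_of_set {0..}))"
      using continuous_openin_preimage_gen[OF cont[OF g] V] by simp
  next
    \<comment> \<open>The generator with \<open>g = 0\<close> and \<open>V = UNIV\<close> is all of
      \<open>Linf D\<close>, so the generators cover the range of \<open>z\<close>.\<close>
    have "Linf D = {z \<in> Linf D. (\<integral>x. z x \<bullet> 0 \<partial>lebesgue_on D) \<in> UNIV}" by simp
    then have "Linf D \<in> {{z \<in> Linf D. (\<integral>x. z x \<bullet> g x \<partial>lebesgue_on D) \<in> V} | g V.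
        integrable (lebesgue_on D) g \<and> open V}"
      by (intro CollectI exI[of _ "\<lambda>_. 0"] exI[of _ UNIV] conjI) auto
    then show "z ` topspace (top_of_set {0..}) \<subseteq> \<Union> {{z \<in> Linf D. (\<integral>x. z x \<bullet> g x \<partial>lebesgue_on D) \<in> V} | g V.
        integrable (lebesgue_on D) g \<and> open V}"
      using zL by auto
  qed
  then show ?thesis using z by (auto simp: continuous_map_in_subtopology)
qed

lemma integral_lebesgue_on_superset:
  fixes f :: "'a::euclidean_space \<Rightarrow> real"
  assumes "S \<in> sets lebesgue" "T \<in> sets lebesgue" "S \<subseteq> T" "\<And>x. x \<in> T - S \<Longrightarrow> f x = 0"
  shows "(\<integral>x. f x \<partial>lebesgue_on T) = (\<integral>x. f x \<partial>lebesgue_on S)"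
proof -
  have "(\<integral>x. f x \<partial>lebesgue_on T) = (\<integral>x. indicator T x *\<^sub>R f x \<partial>lebesgue)"
    using assms(2) by (intro integral_restrict_space) auto
  also have "\<dots> = (\<integral>x. indicator S x *\<^sub>R f x \<partial>lebesgue)"
    using assms(3,4) by (intro Bochner_Integration.integral_cong refl) (auto simp: indicator_def)
  also have "\<dots> = (\<integral>x. f x \<partial>lebesgue_on S)"
    using assms(1) by (intro integral_restrict_space[symmetric]) auto
  finally show ?thesis .
qed

text \<open>For positive times the gradient vanishes off the support because such points are
  interior. Time zero is a boundary point of the half space, and there the gradient is a limit from
  positive times.\<close>

lemma C1c_compact_support_box:
  fixes \<phi> :: "real \<times> plane \<Rightarrow> real"
  assumes \<phi>: "C1c ({0..} \<times> UNIV) \<phi> D\<phi>"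
  obtains r where "0 < r" "\<And>t x. 0 \<le> t \<Longrightarrow> x \<notin> open_box r \<Longrightarrow> \<phi> (t, x) = 0 \<and> D\<phi> (t, x) = 0"
proof -
  define K where "K = closure {p \<in> {0..} \<times> UNIV. \<phi> p \<noteq> 0}"
  have "compact K" using \<phi> unfolding C1c_def K_def by blast
  then obtain b where b: "0 < b" "\<And>p. p \<in> K \<Longrightarrow> norm p \<le> b"
    using compact_imp_bounded[of K] unfolding bounded_pos by blast
  have K: "(t, x) \<notin> K" if "x \<notin> open_box (b + 1)" for t x
  proof
    assume "(t, x) \<in> K"
    then have "norm x \<le> b" using b(2) norm_snd_le[of x t] by fastforce
    then have "\<bar>fst x\<bar> \<le> b" "\<bar>snd x\<bar> \<le> b"
      using norm_fst_le[of "fst x" "snd x"] norm_snd_le[of "snd x" "fst x"] by auto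
    then show False using that by (cases x) (auto simp: open_box_def)
  qed
  show thesis
  proof (rule that[of "b + 1"])
    fix t :: real and x :: plane assume t: "0 \<le> t" and x: "x \<notin> open_box (b + 1)"
    have "\<phi> (t, x) = 0"
      using K[OF x, of t] t closure_subset[of "{p \<in> {0..} \<times> UNIV. \<phi> p \<noteq> 0}"] by (auto simp: K_def)
    moreover have pos: "D\<phi> (s, x) = 0" if "0 < s" for s
    proof (rule C1c_zero_outside_support[OF \<phi>])
      show "(s, x) \<in> interior ({0..} \<times> UNIV)" using that by (simp add: interior_Times)
      show "(s, x) \<notin> closure {p \<in> {0..} \<times> UNIV. \<phi> p \<noteq> 0}" using K[OF x, of s] by (simp add: K_def)
    qed
    moreover have "D\<phi> (0, x) = 0"
    proof -
      have "continuous_on ({0..} \<times> UNIV) D\<phi>" using \<phi> by (simp add: C1c_def)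
      then have "continuous_on {0..} (\<lambda>s. D\<phi> (s, x))"
        by (rule continuous_on_compose2) (auto intro!: continuous_intros)
      then have "((\<lambda>s. D\<phi> (s, x)) \<longlongrightarrow> D\<phi> (0, x)) (at 0 within {0..})"
        unfolding continuous_on_def by simp
      then have "((\<lambda>s. D\<phi> (s, x)) \<longlongrightarrow> D\<phi> (0, x)) (at_right 0)"
        by (rule tendsto_within_subset) auto
      moreover have "((\<lambda>s. D\<phi> (s, x)) \<longlongrightarrow> 0) (at_right 0)"
        by (rule tendsto_eventually) (auto simp: eventually_at_filter pos)
      ultimately show ?thesis by (rule tendsto_unique[rotated]) simp
    qed
    ultimately show "\<phi> (t, x) = 0 \<and> D\<phi> (t, x) = 0" using t by (cases "t = 0") auto
  qed (use b in auto)
qed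

section \<open>Criteria for subsolutions and for admissibility\<close>

lemma tendsto_time_scale:
  fixes f :: "real \<Rightarrow> 'a::topological_space"
  assumes "0 < \<alpha>" "0 \<le> t" "(f \<longlongrightarrow> l) (at (\<alpha> * t) within {0..})"
  shows "((\<lambda>s. f (\<alpha> * s)) \<longlongrightarrow> l) (at t within {0..})"
proof (rule filterlim_compose[OF assms(3)])
  have "eventually (\<lambda>s. s \<in> {0..} \<and> s \<noteq> t) (at t within {0..})" by (simp add: eventually_at_filter)
  then have "eventually (\<lambda>s. \<alpha> * s \<in> {0..} \<and> \<alpha> * s \<noteq> \<alpha> * t) (at t within {0..})"
    by eventually_elim (use assms in auto)
  then show "LIM s at t within {0..}. \<alpha> * s :> at (\<alpha> * t) within {0..}"
    unfolding filterlim_at by (auto intro!: tendsto_intros)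
qed

text \<open>The disjunction in \<open>D\<close> records the two reasons why boundary terms vanish:
  in the plane the test function has bounded support, in the square the potential keeps the value
  \<open>1\<close> at the walls.\<close>

lemma subsolution_profile:
  fixes \<theta> \<Psi> :: "real \<Rightarrow> real \<Rightarrow> real"
  assumes A: "\<bar>A\<bar> < 1" and \<alpha>: "0 < \<alpha>" "\<alpha> < 1"
    and D: "D = UNIV \<and> J = UNIV \<or> D = open_square \<and> J = {-1<..<1} \<and> (\<forall>t\<ge>0. \<Psi> t 1 = 1 \<and> \<Psi> t (-1) = 1)"
    and \<Theta>: "\<And>t x. \<Theta> A t x = \<theta> t (snd x)" and init: "\<And>y. \<theta> 0 y = sgn y"
    and meas: "\<And>t. \<theta> t \<in> borel_measurable borel" and bd: "\<And>t y. \<bar>\<theta> t y\<bar> \<le> 1"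
    and N: "\<And>t. finite (N t)"
    and lim: "\<And>t y. 0 \<le> t \<Longrightarrow> y \<in> J - N t \<Longrightarrow> ((\<lambda>s. \<theta> s y) \<longlongrightarrow> \<theta> t y) (at t within {0..})"
    and \<Psi>_space: "\<And>t y. 0 < t \<Longrightarrow> y \<in> J - N t \<Longrightarrow> (\<Psi> t has_real_derivative \<theta> t y) (at y)"
    and \<Psi>_cont: "\<And>t S. 0 < t \<Longrightarrow> continuous_on S (\<Psi> t)"
    and \<Psi>_time: "\<And>t y. 0 < t \<Longrightarrow> y \<in> J - N t \<Longrightarrow>
      ((\<lambda>s. \<Psi> s y) has_real_derivative - flux A (\<theta> t y)) (at t)"
    and \<Psi>_lip: "\<And>t t' y. 0 \<le> t \<Longrightarrow> 0 \<le> t' \<Longrightarrow> \<bar>\<Psi> t' y - \<Psi> t y\<bar> \<le> 1 / (1 - \<bar>A\<bar>) * \<bar>t' - t\<bar>"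
  shows "subsolution A D planar (z_breve \<Theta> A \<alpha>)"
proof -
  have Dop: "open D" using D by (auto simp: open_square_def intro!: open_Times)
  then have Dl: "D \<in> sets lebesgue" by auto
  have DJ: "AE x in lebesgue_on D. snd x \<in> J - N t" for t
    using AE_snd_notin_finite[OF Dl N[of t]] AE_space[of "lebesgue_on D"]
    by eventually_elim (use D in \<open>auto simp: open_square_def space_restrict_space\<close>)
  have z: "z_breve \<Theta> A \<alpha> t x = fan_state A \<alpha> (\<theta> (\<alpha> * t) (snd x))" for t x
    by (simp add: z_breve_fan_state \<Theta>)
  have z': "z_breve \<Theta> A \<alpha> t = (\<lambda>x. fan_state A \<alpha> (\<theta> (\<alpha> * t) (snd x)))" for t
    by (rule ext) (rule z)
  have fan_lim: "((\<lambda>s. fan_state A \<alpha> (\<theta> s y)) \<longlongrightarrow> fan_state A \<alpha> (\<theta> t y)) (at t within {0..})"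
    if "0 \<le> t" "y \<in> J - N t" for t y
  proof (rule continuous_on_tendsto_compose[OF continuous_on_fan_state[OF A] lim[OF that]])
    show "\<theta> t y \<in> {-1..1}" using bd[of t y] by (auto simp: abs_le_iff)
    show "eventually (\<lambda>s. \<theta> s y \<in> {-1..1}) (at t within {0..})"
      using bd[of _ y] by (intro always_eventually allI) (auto simp: abs_le_iff)
  qed
  have weak_star: "continuous_map (top_of_set {0..}) (subtopology (weak_star D) (Linf_S A D)) (z_breve \<Theta> A \<alpha>)"
  proof (rule weak_star_continuous[OF Dl])
    show "z_breve \<Theta> A \<alpha> t \<in> Linf_S A D" for t
      unfolding z' by (rule fan_profile_in_Linf_S[OF A \<alpha> Dop meas bd])
    show "norm (z_breve \<Theta> A \<alpha> t x) \<le> 1 + 1 / (1 - \<bar>A\<bar>)" for t x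
      unfolding z by (rule norm_fan_state[OF A \<alpha> bd])
    show "AE x in lebesgue_on D. ((\<lambda>s. z_breve \<Theta> A \<alpha> s x) \<longlongrightarrow> z_breve \<Theta> A \<alpha> t x) (at t within {0..})"
      if t: "0 \<le> t" for t
      using DJ[of "\<alpha> * t"]
    proof eventually_elim
      case (elim x)
      show ?case unfolding z
        using fan_lim[OF _ elim] t \<alpha> by (intro tendsto_time_scale) auto
    qed
  qed
  let ?m = "\<lambda>s y. \<alpha> * flux A (\<theta> (\<alpha> * s) y)"
  have integrand: "theta_of (z_breve \<Theta> A \<alpha> \<tau> x) * fst d + m_of (z_breve \<Theta> A \<alpha> \<tau> x) \<bullet> snd d
      = \<theta> (\<alpha> * \<tau>) (snd x) * fst d + ?m \<tau> (snd x) * snd (snd d)" for \<tau> x and d :: "real \<times> plane"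
    by (simp add: z fan_state_def e_vert_def inner_prod_def)
  have box: "(\<integral>\<tau>. (\<integral>x. \<theta> (\<alpha> * \<tau>) (snd x) * fst (D\<phi> (\<tau>, x)) + ?m \<tau> (snd x) * snd (snd (D\<phi> (\<tau>, x)))
        \<partial>lebesgue_on (open_box r)) \<partial>lebesgue_on {0..t})
      = (\<integral>x. \<theta> (\<alpha> * t) (snd x) * \<phi> (t, x) \<partial>lebesgue_on (open_box r))
        - (\<integral>x. planar x * \<phi> (0, x) \<partial>lebesgue_on (open_box r))"
    if t: "0 \<le> t" and r: "0 < r" "{-r<..<r} \<subseteq> J"
      and \<phi>: "C1c ({0..} \<times> closure D) \<phi> D\<phi>" "{-r..r} \<times> {-r..r} \<subseteq> closure D"
      and ends: "\<And>s s' x1 b. 0 < s \<Longrightarrow> 0 < s' \<Longrightarrow> b \<in> {r, -r} \<Longrightarrow> \<Psi> (\<alpha> * s') b = \<Psi> (\<alpha> * s) b \<or> \<phi> (s, (x1, b)) = 0"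
    for t r \<phi> D\<phi>
  proof -
    have sub: "{0..} \<times> ({-r..r} \<times> {-r..r}) \<subseteq> {0..} \<times> closure D" using \<phi>(2) by auto
    have mb: "\<bar>?m s y\<bar> \<le> 1 / (1 - \<bar>A\<bar>)" for s y
    proof -
      have "\<bar>\<alpha>\<bar> * \<bar>flux A (\<theta> (\<alpha> * s) y)\<bar> \<le> 1 * (1 / (1 - \<bar>A\<bar>))"
        using \<alpha> by (intro mult_mono flux_bound A bd) auto
      then show ?thesis by (simp add: abs_mult)
    qed
    have "(\<integral>\<tau>. (\<integral>x. \<theta> (\<alpha> * \<tau>) (snd x) * fst (D\<phi> (\<tau>, x)) + ?m \<tau> (snd x) * snd (snd (D\<phi> (\<tau>, x)))
        \<partial>lebesgue_on (open_box r)) \<partial>lebesgue_on {0..t})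
      = (\<integral>x. \<theta> (\<alpha> * t) (snd x) * \<phi> (t, x) \<partial>lebesgue_on (open_box r))
        - (\<integral>x. \<theta> (\<alpha> * 0) (snd x) * \<phi> (0, x) \<partial>lebesgue_on (open_box r))"
    proof (rule weak_formulation_box[OF r(1) t, where \<Psi> = "\<lambda>s. \<Psi> (\<alpha> * s)" and N = "\<lambda>s. N (\<alpha> * s)"])
      show "?m s \<in> borel_measurable borel" for s using meas[of "\<alpha> * s"] by measurable
      show "\<bar>?m s y\<bar> \<le> 1 / (1 - \<bar>A\<bar>)" for s y by (rule mb)
      show "((\<lambda>s. \<theta> (\<alpha> * s) y) \<longlongrightarrow> \<theta> (\<alpha> * s) y) (at s within {0..})"
        if "0 \<le> s" "y \<in> {-r<..<r} - N (\<alpha> * s)" for s y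
        using that \<alpha> r by (intro tendsto_time_scale lim) auto
      show "(\<Psi> (\<alpha> * s) has_real_derivative \<theta> (\<alpha> * s) y) (at y)"
        if "0 < s" "y \<in> {-r<..<r} - N (\<alpha> * s)" for s y
        using that \<alpha> r by (intro \<Psi>_space) auto
      show "((\<lambda>s. \<Psi> (\<alpha> * s) y) has_real_derivative - ?m s y) (at s)"
        if "0 < s" "y \<in> {-r<..<r} - N (\<alpha> * s)" for s y
      proof -
        have "((\<lambda>s. \<Psi> s y) has_real_derivative - flux A (\<theta> (\<alpha> * s) y)) (at (\<alpha> * s))"
          using that \<alpha> r by (intro \<Psi>_time) auto
        moreover have "((\<lambda>s. \<alpha> * s) has_real_derivative \<alpha>) (at s)" by (auto intro!: derivative_eq_intros)
        ultimately have "((\<lambda>s. \<Psi> (\<alpha> * s) y) has_real_derivative - flux A (\<theta> (\<alpha> * s) y) * \<alpha>) (at s)"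
          by (rule DERIV_chain2[where f = "\<lambda>s. \<Psi> s y" and g = "\<lambda>s. \<alpha> * s"])
        then show ?thesis by (simp add: mult.commute)
      qed
      show "\<bar>\<Psi> (\<alpha> * s') y - \<Psi> (\<alpha> * s) y\<bar> \<le> 1 / (1 - \<bar>A\<bar>) * \<bar>s' - s\<bar>" if "0 < s" "0 < s'" for s s' y
      proof -
        have "\<bar>\<Psi> (\<alpha> * s') y - \<Psi> (\<alpha> * s) y\<bar> \<le> 1 / (1 - \<bar>A\<bar>) * \<bar>\<alpha> * s' - \<alpha> * s\<bar>"
          using that \<alpha> by (intro \<Psi>_lip) auto
        also have "\<bar>\<alpha> * s' - \<alpha> * s\<bar> = \<alpha> * \<bar>s' - s\<bar>"
          using \<alpha> by (simp add: abs_mult flip: right_diff_distrib)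
        \<comment> \<open>Slowing the clock can only improve the Lipschitz constant, so one constant
          serves for potential and momentum.\<close>
        also have "1 / (1 - \<bar>A\<bar>) * (\<alpha> * \<bar>s' - s\<bar>) \<le> 1 / (1 - \<bar>A\<bar>) * (1 * \<bar>s' - s\<bar>)"
          using A \<alpha> by (intro mult_left_mono mult_right_mono) auto
        finally show ?thesis by simp
      qed
      show "(\<phi> has_derivative (\<lambda>h. D\<phi> p \<bullet> h)) (at p within {0..} \<times> ({-r..r} \<times> {-r..r}))"
        if "p \<in> {0..} \<times> ({-r..r} \<times> {-r..r})" for p
        using \<phi>(1) that sub has_derivative_subset[OF _ sub] unfolding C1c_def by blast
      show "continuous_on ({0..} \<times> ({-r..r} \<times> {-r..r})) D\<phi>"
        using \<phi>(1) continuous_on_subset[OF _ sub] unfolding C1c_def by blast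
      show "(\<Psi> (\<alpha> * s') b - \<Psi> (\<alpha> * s) b) * \<phi> (s, x1, b) = 0"
        if "0 < s" "0 < s'" "b \<in> {r, -r}" for s s' x1 b
        using ends[OF that, of x1] by auto
    qed (use meas bd N \<alpha> \<Psi>_cont in auto)
    then show ?thesis by (simp add: init planar_def)
  qed
  have weak: "(\<integral>\<tau>. (\<integral>x. theta_of (z_breve \<Theta> A \<alpha> \<tau> x) * fst (D\<phi> (\<tau>, x)) + m_of (z_breve \<Theta> A \<alpha> \<tau> x) \<bullet> snd (D\<phi> (\<tau>, x))
        \<partial>lebesgue_on D) \<partial>lebesgue_on {0..t})
      = (\<integral>x. theta_of (z_breve \<Theta> A \<alpha> t x) * \<phi> (t, x) \<partial>lebesgue_on D) - (\<integral>x. planar x * \<phi> (0, x) \<partial>lebesgue_on D)"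
    if t: "0 \<le> t" and \<phi>: "C1c ({0..} \<times> closure D) \<phi> D\<phi>" for t \<phi> D\<phi>
  proof -
    have th: "theta_of (z_breve \<Theta> A \<alpha> t x) = \<theta> (\<alpha> * t) (snd x)" for x by (simp add: z fan_state_def)
    from D show ?thesis
    proof (elim disjE conjE)
      assume U: "D = UNIV" "J = UNIV"
      \<comment> \<open>The plane is cut down to a box outside which the test function and its
        gradient vanish at all times.\<close>
      obtain r where r: "0 < r" "\<And>t x. 0 \<le> t \<Longrightarrow> x \<notin> open_box r \<Longrightarrow> \<phi> (t, x) = 0 \<and> D\<phi> (t, x) = 0"
        using C1c_compact_support_box[of \<phi> D\<phi>] \<phi> U by auto
      have red: "(\<integral>x. f x \<partial>lebesgue_on D) = (\<integral>x. f x \<partial>lebesgue_on (open_box r))"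
        if "\<And>x. x \<notin> open_box r \<Longrightarrow> f x = 0" for f :: "plane \<Rightarrow> real"
        by (rule integral_lebesgue_on_superset) (use that U in auto)
      have "(\<integral>\<tau>. (\<integral>x. \<theta> (\<alpha> * \<tau>) (snd x) * fst (D\<phi> (\<tau>, x)) + ?m \<tau> (snd x) * snd (snd (D\<phi> (\<tau>, x)))
          \<partial>lebesgue_on D) \<partial>lebesgue_on {0..t})
        = (\<integral>\<tau>. (\<integral>x. \<theta> (\<alpha> * \<tau>) (snd x) * fst (D\<phi> (\<tau>, x)) + ?m \<tau> (snd x) * snd (snd (D\<phi> (\<tau>, x)))
          \<partial>lebesgue_on (open_box r)) \<partial>lebesgue_on {0..t})"
        by (intro Bochner_Integration.integral_cong refl red) (use r(2) in \<open>auto simp: space_restrict_space\<close>)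
      also have "\<dots> = (\<integral>x. \<theta> (\<alpha> * t) (snd x) * \<phi> (t, x) \<partial>lebesgue_on (open_box r))
          - (\<integral>x. planar x * \<phi> (0, x) \<partial>lebesgue_on (open_box r))"
        by (rule box[OF t r(1) _ \<phi>]) (use U r(2) in \<open>auto simp: open_box_def\<close>)
      also have "\<dots> = (\<integral>x. \<theta> (\<alpha> * t) (snd x) * \<phi> (t, x) \<partial>lebesgue_on D)
          - (\<integral>x. planar x * \<phi> (0, x) \<partial>lebesgue_on D)"
        using r(2) t by (subst (1 2) red) auto
      finally show ?thesis unfolding integrand th .
    next
      assume S: "D = open_square" "J = {-1<..<1}" "\<forall>t\<ge>0. \<Psi> t 1 = 1 \<and> \<Psi> t (-1) = 1"
      have Db: "D = open_box 1" using S by (simp add: open_square_def open_box_def)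
      have cl: "closure D = {-1..1} \<times> {-1..1}" using S by (simp add: open_square_def closure_Times)
      show ?thesis
        unfolding integrand th Db by (rule box[OF t _ _ \<phi>]) (use S \<alpha> cl in auto)
    qed
  qed
  have "planar \<in> borel_measurable (lebesgue_on D)"
    unfolding planar_def by (intro measurable_lebesgue_on_snd) simp
  then show ?thesis
    unfolding subsolution_def using weak_star weak
    by (auto simp: planar_def sgn_if)
qed

lemma openin_time_slice:
  fixes \<Omega> :: "(real \<times> plane) set"
  assumes \<Omega>: "openin (top_of_set ({0..} \<times> D)) \<Omega>" and D: "open D" and t: "0 \<le> t"
  shows "open (\<Omega> `` {t})"
proof -
  obtain T where T: "open T" "\<Omega> = ({0..} \<times> D) \<inter> T" using \<Omega> by (auto simp: openin_open)
  have "\<Omega> `` {t} = D \<inter> Pair t -` T" using T t by auto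
  moreover have "open (Pair t -` T)" by (intro open_vimage T(1) continuous_intros)
  ultimately show ?thesis using D by auto
qed

text \<open>Inside the zone the profile coincides with the fan, which is jointly continuous and
  takes values strictly between \<open>-1\<close> and \<open>1\<close>. Outside, the flux vanishes
  at the pure values, so the momentum is zero and equals \<theta> times the zero velocity.\<close>

lemma admissible_profile:
  assumes A: "\<bar>A\<bar> < 1" and \<alpha>: "0 < \<alpha>" "\<alpha> < 1" and D: "open D"
    and \<Omega>: "openin (top_of_set ({0..} \<times> D)) \<Omega>" "\<Omega> \<noteq> {}"
    and \<Theta>: "\<And>t x. \<Theta> A t x = \<theta> t (snd x)"
    and fan: "\<And>t x. (t, x) \<in> \<Omega> \<Longrightarrow> 0 < t \<and> - c_speed A (-1) * (\<alpha> * t) < snd x \<and>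
      snd x < c_speed A 1 * (\<alpha> * t) \<and> \<theta> (\<alpha> * t) (snd x) = vartheta A (\<alpha> * t) (snd x)"
    and N: "\<And>t. finite (N t)"
    and out: "\<And>t x. 0 \<le> t \<Longrightarrow> x \<in> D \<Longrightarrow> (t, x) \<notin> \<Omega> \<Longrightarrow> snd x \<notin> N t \<Longrightarrow> \<bar>\<theta> (\<alpha> * t) (snd x)\<bar> = 1"
  shows "admissible A D (z_breve \<Theta> A \<alpha>) \<Omega>"
proof -
  have z: "z_breve \<Theta> A \<alpha> t x = fan_state A \<alpha> (\<theta> (\<alpha> * t) (snd x))" for t x
    by (simp add: z_breve_fan_state \<Theta>)
  have mix: "\<theta> (\<alpha> * t) (snd x) = plane_profile A (\<alpha> * t) (snd x)" "\<bar>\<theta> (\<alpha> * t) (snd x)\<bar> < 1"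
    if "(t, x) \<in> \<Omega>" for t x
    using fan[OF that] \<alpha> vartheta_strict[OF A, of "\<alpha> * t" "snd x"] plane_profile_fan_interior[OF A, of "\<alpha> * t" "snd x"]
    by auto
  have "continuous_on \<Omega> (\<lambda>p. fan_state A \<alpha> (plane_profile A (\<alpha> * fst p) (snd (snd p))))"
  proof (rule continuous_on_compose2[OF continuous_on_fan_state[OF A]])
    have "continuous_on \<Omega> (\<lambda>p. (\<lambda>q. plane_profile A (fst q) (snd q)) (\<alpha> * fst p, snd (snd p)))"
      by (rule continuous_on_compose2[OF continuous_on_plane_profile[OF A]])
         (use fan \<alpha> in \<open>auto intro!: continuous_intros\<close>)
    then show "continuous_on \<Omega> (\<lambda>p. plane_profile A (\<alpha> * fst p) (snd (snd p)))" by simp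
    show "(\<lambda>p. plane_profile A (\<alpha> * fst p) (snd (snd p))) ` \<Omega> \<subseteq> {-1..1}"
      using plane_profile_bound[OF A] by (auto simp: abs_le_iff minus_le_iff)
  qed
  then have cont: "continuous_on \<Omega> (\<lambda>(t, x). z_breve \<Theta> A \<alpha> t x)"
  proof (rule continuous_on_eq)
    show "fan_state A \<alpha> (plane_profile A (\<alpha> * fst p) (snd (snd p))) = (case p of (t, x) \<Rightarrow> z_breve \<Theta> A \<alpha> t x)"
      if "p \<in> \<Omega>" for p
      using mix(1)[of "fst p" "snd p"] that by (simp add: z case_prod_beta)
  qed
  have U: "\<forall>(t, x)\<in>\<Omega>. z_breve \<Theta> A \<alpha> t x \<in> U_set A"
  proof
    show "case p of (t, x) \<Rightarrow> z_breve \<Theta> A \<alpha> t x \<in> U_set A" if "p \<in> \<Omega>" for p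
      using fan_state_in_U[OF A \<alpha>] mix(2)[of "fst p" "snd p"] that by (simp add: z case_prod_beta)
  qed
  have outside: "AE x in lebesgue_on (D - \<Omega> `` {t}).
      m_of (z_breve \<Theta> A \<alpha> t x) = theta_of (z_breve \<Theta> A \<alpha> t x) *\<^sub>R u_of (z_breve \<Theta> A \<alpha> t x) \<and>
      \<bar>theta_of (z_breve \<Theta> A \<alpha> t x)\<bar> = 1" if t: "0 \<le> t" for t
  proof -
    have "D - \<Omega> `` {t} \<in> sets borel"
      using openin_time_slice[OF \<Omega>(1) D t] D by (intro sets.Diff borel_open)
    then have Sl: "D - \<Omega> `` {t} \<in> sets lebesgue" by auto
    have one: "m_of (fan_state A \<alpha> a) = theta_of (fan_state A \<alpha> a) *\<^sub>R u_of (fan_state A \<alpha> a) \<and>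
      \<bar>theta_of (fan_state A \<alpha> a)\<bar> = 1" if "\<bar>a\<bar> = 1" for a
      using that by (auto simp: fan_state_def flux_def abs_if split: if_splits)
    show ?thesis
      using AE_snd_notin_finite[OF Sl N[of t]] AE_space[of "lebesgue_on (D - \<Omega> `` {t})"]
    proof eventually_elim
      case (elim x)
      then have "x \<in> D" "(t, x) \<notin> \<Omega>" by (auto simp: space_restrict_space)
      then show ?case unfolding z by (intro one out[OF t]) (use elim in auto)
    qed
  qed
  show ?thesis unfolding admissible_def using \<Omega> cont U outside by blast
qed

section \<open>Application to the plane and to the square\<close>

lemma subsolution_plane:
  assumes A: "\<bar>A\<bar> < 1" and \<alpha>: "0 < \<alpha>" "\<alpha> < 1"
  shows "subsolution A UNIV planar (z_breve Theta_plane A \<alpha>)"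
proof (rule subsolution_profile[OF A \<alpha>, where \<theta> = "plane_profile A" and \<Psi> = "plane_potential A" and J = UNIV and N = "\<lambda>_. {0}"])
  \<comment> \<open>The excluded height \<open>0\<close> is where the initial datum jumps.\<close>
  show "((\<lambda>s. plane_profile A s y) \<longlongrightarrow> plane_profile A t y) (at t within {0..})" if "0 \<le> t" "y \<in> UNIV - {0}" for t y
    using that by (intro plane_profile_tendsto_time[OF A]) auto
qed (use plane_profile_bound[OF A] plane_potential_deriv_space[OF A] plane_potential_deriv_time[OF A]
    continuous_on_plane_potential[OF A] plane_potential_lipschitz_time[OF A]
    in \<open>auto simp: Theta_plane_eq_profile plane_profile_def[of A 0]\<close>)

lemma subsolution_square:
  assumes A: "\<bar>A\<bar> < 1" and \<alpha>: "0 < \<alpha>" "\<alpha> < 1"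
  shows "subsolution A open_square planar (z_breve Theta_square A \<alpha>)"
proof (rule subsolution_profile[OF A \<alpha>, where \<theta> = "square_profile A" and \<Psi> = "square_potential A" and J = "{-1<..<1}" and N = "interfaces A"])
  show "((\<lambda>s. square_profile A s y) \<longlongrightarrow> square_profile A t y) (at t within {0..})" if "0 \<le> t" "y \<in> {-1<..<1} - interfaces A t" for t y
    using that by (intro square_profile_tendsto_time[OF A]) auto
  show "(square_potential A t has_real_derivative square_profile A t y) (at y)" if "0 < t" "y \<in> {-1<..<1} - interfaces A t" for t y
    using that by (intro square_potential_deriv_space[OF A]) auto
  show "((\<lambda>s. square_potential A s y) has_real_derivative - flux A (square_profile A t y)) (at t)"
    if "0 < t" "y \<in> {-1<..<1} - interfaces A t" for t y
    using that by (intro square_potential_deriv_time[OF A]) auto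
qed (use square_profile_bound[OF A] continuous_on_square_potential[OF A] square_potential_lipschitz_time[OF A] square_potential_end[OF A]
    in \<open>auto simp: Theta_square_eq_profile square_profile_def[of A 0] interfaces_def\<close>)

lemma openin_inter_open:
  assumes "open T" "\<Omega> = S \<inter> T"
  shows "openin (top_of_set S) \<Omega>"
  using assms by (auto simp: openin_open)

lemma plane_profile_outside:
  assumes A: "\<bar>A\<bar> < 1" and t: "0 < t" and y: "y \<le> - c_speed A (-1) * t \<or> c_speed A 1 * t \<le> y"
  shows "\<bar>plane_profile A t y\<bar> = 1"
  using vartheta_ends[OF A t] y t
  by (cases "y = - c_speed A (-1) * t"; cases "y = c_speed A 1 * t") (auto simp: plane_profile_def)

lemma admissible_plane:
  assumes A: "\<bar>A\<bar> < 1" and \<alpha>: "0 < \<alpha>" "\<alpha> < 1"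
  shows "admissible A UNIV (z_breve Theta_plane A \<alpha>) (mix_plane A \<alpha>)"
proof (rule admissible_profile[OF A \<alpha>, where \<Theta> = Theta_plane and \<theta> = "plane_profile A" and N = "\<lambda>_. {0}"])
  have c: "0 < c_speed A 1" "0 < c_speed A (-1)" using c_speed_pos[OF A] by auto
  show "openin (top_of_set ({0..} \<times> UNIV)) (mix_plane A \<alpha>)"
  proof (rule openin_inter_open)
    show "open {p :: real \<times> plane. - \<alpha> * c_speed A (-1) * fst p < snd (snd p) \<and> snd (snd p) < \<alpha> * c_speed A 1 * fst p}"
      by (intro open_Collect_conj open_Collect_less continuous_intros)
  qed (auto simp: mix_plane_def)
  have "(1, (0, 0)) \<in> mix_plane A \<alpha>" using \<alpha> c by (simp add: mix_plane_def)
  then show "mix_plane A \<alpha> \<noteq> {}" by blast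
  show "0 < t \<and> - c_speed A (-1) * (\<alpha> * t) < snd x \<and> snd x < c_speed A 1 * (\<alpha> * t) \<and>
      plane_profile A (\<alpha> * t) (snd x) = vartheta A (\<alpha> * t) (snd x)" if tx: "(t, x) \<in> mix_plane A \<alpha>" for t x
  proof -
    have *: "0 \<le> t" "- c_speed A (-1) * (\<alpha> * t) < snd x" "snd x < c_speed A 1 * (\<alpha> * t)"
      using tx by (auto simp: mix_plane_def mult_ac)
    \<comment> \<open>At \<open>t = 0\<close> the two bounds coincide and no height lies strictly
      between them.\<close>
    then have t: "0 < t" by (cases "t = 0") auto
    then show ?thesis using * \<alpha> plane_profile_fan_interior[OF A, of "\<alpha> * t" "snd x"] by simp
  qed
  show "\<bar>plane_profile A (\<alpha> * t) (snd x)\<bar> = 1" if t: "0 \<le> t" and x: "(t, x) \<notin> mix_plane A \<alpha>" "snd x \<notin> {0}" for t x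
  proof (cases "t = 0")
    case True
    then show ?thesis using x by (auto simp: plane_profile_def sgn_if)
  next
    case False
    then have "0 < \<alpha> * t" using t \<alpha> by simp
    then show ?thesis using x t by (intro plane_profile_outside[OF A]) (auto simp: mix_plane_def mult_ac)
  qed
qed (auto simp: Theta_plane_eq_profile)

section \<open>Front curves and the shape of the confined mixing zone\<close>

lemma continuous_on_ell_one:
  assumes A: "\<bar>A\<bar> < 1"
  shows "continuous_on UNIV (ell A 1)"
proof -
  have B: "1 + A \<noteq> 0" using A by auto
  have "continuous_on UNIV (\<lambda>t. if t \<le> (1 - A) / 2 then c_speed A 1 * t else 1 - front_solution A t)"
  proof (rule continuous_on_cases_le)
    show "continuous_on {t \<in> UNIV. (1 - A) / 2 \<le> t} (\<lambda>t. 1 - front_solution A t)"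
      unfolding front_solution_def using B by (intro continuous_intros) auto
    show "c_speed A 1 * t = 1 - front_solution A t" if "t = (1 - A) / 2" for t
      unfolding that using A front_solution_zero[OF A] by (simp add: c_speed_def)
  qed (auto intro!: continuous_intros)
  moreover have "(\<lambda>t. if t \<le> (1 - A) / 2 then c_speed A 1 * t else 1 - front_solution A t) = ell A 1"
  proof
    show "(if t \<le> (1 - A) / 2 then c_speed A 1 * t else 1 - front_solution A t) = ell A 1 t" for t
      using ell_one_late[OF A, of t] by (cases "t \<le> (1 - A) / 2") (simp_all add: ell_def inverse_c_speed)
  qed
  ultimately show ?thesis by (simp only:)
qed

lemma continuous_on_ell:
  assumes A: "\<bar>A\<bar> < 1" and s: "s \<in> {1, -1}"
  shows "continuous_on S (ell A s)"
proof -
  have "continuous_on UNIV (\<lambda>t. - ell (- A) 1 t)" using A by (intro continuous_intros continuous_on_ell_one) simp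
  then have "continuous_on UNIV (ell A (-1))" using ell_reflect[OF A] by (simp add: fun_eq_iff cong: continuous_on_cong)
  then show ?thesis using s continuous_on_ell_one[OF A] continuous_on_subset[OF _ subset_UNIV] by blast
qed

lemma admissible_square:
  assumes A: "\<bar>A\<bar> < 1" and \<alpha>: "0 < \<alpha>" "\<alpha> < 1"
  shows "admissible A open_square (z_breve Theta_square A \<alpha>) (mix_square A \<alpha>)"
proof (rule admissible_profile[OF A \<alpha>, where \<Theta> = Theta_square and \<theta> = "square_profile A" and N = "\<lambda>t. interfaces A (\<alpha> * t)"])
  show "open open_square" by (auto simp: open_square_def intro!: open_Times)
  show "openin (top_of_set ({0..} \<times> open_square)) (mix_square A \<alpha>)"
  proof (rule openin_inter_open)
    have c: "continuous_on UNIV (\<lambda>p :: real \<times> plane. ell A s (\<alpha> * fst p))" if "s \<in> {1, -1}" for s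
      by (intro continuous_on_compose2[OF continuous_on_ell[OF A that, of UNIV]] continuous_intros) auto
    show "open {p :: real \<times> plane. 0 < \<alpha> * fst p \<and> \<alpha> * fst p < collapse_time A \<and>
        ell A (-1) (\<alpha> * fst p) < snd (snd p) \<and> snd (snd p) < ell A 1 (\<alpha> * fst p)}"
      using c by (intro open_Collect_conj open_Collect_less continuous_intros) auto
    show "mix_square A \<alpha> = ({0..} \<times> open_square) \<inter> {p. 0 < \<alpha> * fst p \<and> \<alpha> * fst p < collapse_time A \<and>
        ell A (-1) (\<alpha> * fst p) < snd (snd p) \<and> snd (snd p) < ell A 1 (\<alpha> * fst p)}"
      using \<alpha> by (auto simp: mix_square_def zero_less_mult_iff)
  qed
  \<comment> \<open>The rescaled time is \<open>1 / 2\<close>, which precedes the collapse since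
    that happens at time \<open>1\<close> or later.\<close>
  have "(1 / (2 * \<alpha>), (0, 0)) \<in> mix_square A \<alpha>"
    using \<alpha> collapse_time_ge[OF A] ell_one_pos[OF A, of "1 / 2"] ell_neg(1)[OF A, of "1 / 2"]
    by (simp add: mix_square_def open_square_def)
  then show "mix_square A \<alpha> \<noteq> {}" by blast
  show "0 < t \<and> - c_speed A (-1) * (\<alpha> * t) < snd x \<and> snd x < c_speed A 1 * (\<alpha> * t) \<and>
      square_profile A (\<alpha> * t) (snd x) = vartheta A (\<alpha> * t) (snd x)" if tx: "(t, x) \<in> mix_square A \<alpha>" for t x
  proof -
    have *: "0 < \<alpha> * t" "\<alpha> * t < collapse_time A" "ell A (-1) (\<alpha> * t) < snd x" "snd x < ell A 1 (\<alpha> * t)"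
      using tx by (auto simp: mix_square_def)
    moreover have "0 < t" using *(1) \<alpha> by (simp add: zero_less_mult_iff)
    ultimately show ?thesis
      using square_profile_interior(1)[OF A *(1,2), of "snd x"] ell_one_le[OF A, of "\<alpha> * t"] ell_neg(2)[OF A *(1,2)]
      by auto
  qed
  show "\<bar>square_profile A (\<alpha> * t) (snd x)\<bar> = 1"
    if t: "0 \<le> t" and x: "x \<in> open_square" "(t, x) \<notin> mix_square A \<alpha>" "snd x \<notin> interfaces A (\<alpha> * t)" for t x
  proof -
    have "0 \<le> \<alpha> * t" using t \<alpha> by simp
    then show ?thesis using x by (auto simp: mix_square_def interfaces_def square_profile_def sgn_if)
  qed
qed (auto simp: interfaces_def Theta_square_eq_profile)

text \<open>Once a linear edge has passed its wall, the true front is strictly inside the square,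
  and points between front and wall satisfy the linear formula without belonging to the zone. So the
  formula fails immediately after the first contact and never recovers.\<close>

lemma mix_square_initial:
  assumes A: "\<bar>A\<bar> < 1" and \<alpha>: "0 < \<alpha>" and t: "0 \<le> t"
  shows "mix_square A \<alpha> `` {t}
      = {x \<in> open_square. - \<alpha> * c_speed A (-1) * t < snd x \<and> snd x < \<alpha> * c_speed A 1 * t}
    \<longleftrightarrow> \<alpha> * t \<le> min (1 / c_speed A 1) (1 / c_speed A (-1))"
proof
  have c: "0 < c_speed A 1" "0 < c_speed A (-1)" using c_speed_pos[OF A] by auto
  have T: "1 \<le> collapse_time A" by (rule collapse_time_ge[OF A])
  {
    assume le: "\<alpha> * t \<le> min (1 / c_speed A 1) (1 / c_speed A (-1))"
    then have e: "ell A 1 (\<alpha> * t) = \<alpha> * c_speed A 1 * t" "ell A (-1) (\<alpha> * t) = - \<alpha> * c_speed A (-1) * t"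
      by (auto simp: ell_def mult_ac)
    have "1 / c_speed A 1 < 1" unfolding inverse_c_speed using A by auto
    then have lt: "\<alpha> * t < collapse_time A" using le T by linarith
    show "mix_square A \<alpha> `` {t}
      = {x \<in> open_square. - \<alpha> * c_speed A (-1) * t < snd x \<and> snd x < \<alpha> * c_speed A 1 * t}"
    proof (cases "t = 0")
      case True
      then show ?thesis by (auto simp: mix_square_def)
    next
      case False
      then have "0 < \<alpha> * t" using t \<alpha> by simp
      then show ?thesis using lt by (auto simp: mix_square_def e)
    qed
  }
  assume eq: "mix_square A \<alpha> `` {t}
      = {x \<in> open_square. - \<alpha> * c_speed A (-1) * t < snd x \<and> snd x < \<alpha> * c_speed A 1 * t}"
  have mem: "x \<in> mix_square A \<alpha> `` {t}" if "x \<in> open_square" "- \<alpha> * c_speed A (-1) * t < snd x" "snd x < \<alpha> * c_speed A 1 * t" for x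
    using that eq by simp
  show "\<alpha> * t \<le> min (1 / c_speed A 1) (1 / c_speed A (-1))"
  proof (rule ccontr)
    assume "\<not> \<alpha> * t \<le> min (1 / c_speed A 1) (1 / c_speed A (-1))"
    then consider "1 / c_speed A 1 < \<alpha> * t" | "1 / c_speed A (-1) < \<alpha> * t" by fastforce
    then show False
    proof cases
      case 1
      have late: "(1 - A) / 2 < \<alpha> * t" using 1 by (simp add: inverse_c_speed)
      have pos: "0 < \<alpha> * t" using late A by auto
      have big: "1 < \<alpha> * c_speed A 1 * t" using 1 c by (simp add: field_simps)
      have l1: "ell A 1 (\<alpha> * t) < 1" by (rule ell_one_less(1)[OF A late])
      \<comment> \<open>The midpoint between front and wall; \<open>max 0\<close> keeps it above the
        lower linear edge even after the collapse, when the formula for the front may give negative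
        heights.\<close>
      define y where "y = (max 0 (ell A 1 (\<alpha> * t)) + 1) / 2"
      have y: "0 < y" "y < 1" "ell A 1 (\<alpha> * t) < y" using l1 by (auto simp: y_def)
      have "- \<alpha> * c_speed A (-1) * t \<le> 0" using c \<alpha> t by simp
      then have "(0, y) \<in> mix_square A \<alpha> `` {t}" using y big by (intro mem) (auto simp: open_square_def)
      then show False using y by (auto simp: mix_square_def)
    next
      case 2
      have late: "(1 - - A) / 2 < \<alpha> * t" using 2 by (simp add: inverse_c_speed)
      have big: "1 < \<alpha> * c_speed A (-1) * t" using 2 c by (simp add: field_simps)
      have l1: "-1 < ell A (-1) (\<alpha> * t)"
        using ell_one_less(1)[OF _ late] A ell_reflect[OF A] by simp
      define y where "y = (min 0 (ell A (-1) (\<alpha> * t)) - 1) / 2"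
      have y: "y < 0" "-1 < y" "y < ell A (-1) (\<alpha> * t)" using l1 by (auto simp: y_def)
      have "0 \<le> \<alpha> * c_speed A 1 * t" using c \<alpha> t by simp
      then have "(0, y) \<in> mix_square A \<alpha> `` {t}" using y big by (intro mem) (auto simp: open_square_def)
      then show False using y by (auto simp: mix_square_def)
    qed
  qed
qed

lemma ell_touch_collapse:
  assumes A: "\<bar>A\<bar> < 1" and s: "s \<in> {1, -1}"
  shows "1 / c_speed A s < collapse_time A" "ell A s (1 / c_speed A s) = s" "ell A s (collapse_time A) = 0"
proof -
  show "1 / c_speed A s < collapse_time A"
    unfolding inverse_c_speed using collapse_time_ge[OF A] A s by auto
  show "ell A s (1 / c_speed A s) = s" using c_speed_pos[OF A s] by (simp add: ell_def)
  show "ell A s (collapse_time A) = 0"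
    using s ell_one_collapse[OF A] ell_one_collapse[of "- A"] A
    by (auto simp: ell_reflect collapse_time_reflect)
qed

lemma ell_one_strict_antimono:
  assumes A: "\<bar>A\<bar> < 1" and t: "1 / c_speed A 1 \<le> t" "t < t'"
  shows "ell A 1 t' < ell A 1 t"
  using front_solution_strict_mono[OF A _ t(2)] t ell_one_late[OF A, of t] ell_one_late[OF A, of t']
  by (simp add: inverse_c_speed)

lemma ell_strict_monotone:
  assumes A: "\<bar>A\<bar> < 1" and \<alpha>: "0 < \<alpha>"
  shows "strict_antimono_on {1 / c_speed A 1 / \<alpha>..T} (\<lambda>t. ell A 1 (\<alpha> * t))"
    and "strict_mono_on {1 / c_speed A (-1) / \<alpha>..T} (\<lambda>t. ell A (-1) (\<alpha> * t))"
proof -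
  have scale: "c \<le> \<alpha> * t" if "c / \<alpha> \<le> t" for c t
    using that \<alpha> by (simp add: pos_divide_le_eq mult.commute)
  show "strict_antimono_on {1 / c_speed A 1 / \<alpha>..T} (\<lambda>t. ell A 1 (\<alpha> * t))"
    unfolding monotone_on_def using \<alpha> scale by (auto intro!: ell_one_strict_antimono[OF A])
  have B: "\<bar>- A\<bar> < 1" and c: "c_speed (- A) 1 = c_speed A (-1)" using A by (auto simp: c_speed_def)
  show "strict_mono_on {1 / c_speed A (-1) / \<alpha>..T} (\<lambda>t. ell A (-1) (\<alpha> * t))"
    unfolding strict_mono_on_def ell_reflect[OF A]
    using \<alpha> scale by (auto intro!: ell_one_strict_antimono[OF B] simp: c)
qed

lemma mix_square_nonempty:
  assumes A: "\<bar>A\<bar> < 1"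
  shows "mix_square A \<alpha> `` {t} \<noteq> {} \<longleftrightarrow> 0 < \<alpha> * t \<and> \<alpha> * t < collapse_time A"
proof
  assume "0 < \<alpha> * t \<and> \<alpha> * t < collapse_time A"
  then have "(0, 0) \<in> mix_square A \<alpha> `` {t}"
    using ell_one_pos[OF A, of "\<alpha> * t"] ell_neg(1)[OF A, of "\<alpha> * t"]
    by (simp add: mix_square_def open_square_def)
  then show "mix_square A \<alpha> `` {t} \<noteq> {}" by blast
qed (auto simp: mix_square_def)

theorem theorem2p2:
  fixes A \<alpha> :: real
  assumes "\<bar>A\<bar> < 1" and "0 < \<alpha>" and "\<alpha> < 1"
  shows
    "(subsolution A UNIV planar (z_breve Theta_plane A \<alpha>) \<and>
      admissible A UNIV (z_breve Theta_plane A \<alpha>) (mix_plane A \<alpha>))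
     \<and>
     ((\<forall>s\<in>{1, -1}. \<exists>!f. is_front A s f) \<and> (\<exists>!t. is_collapse_time A t) \<and>
      subsolution A open_square planar (z_breve Theta_square A \<alpha>) \<and>
      admissible A open_square (z_breve Theta_square A \<alpha>) (mix_square A \<alpha>) \<and>
      (\<forall>t\<ge>0. mix_square A \<alpha> `` {t}
                = {x \<in> open_square. - \<alpha> * c_speed A (-1) * t < snd x \<and> snd x < \<alpha> * c_speed A 1 * t}
              \<longleftrightarrow> \<alpha> * t \<le> min (1 / c_speed A 1) (1 / c_speed A (-1))) \<and>
      (\<forall>s\<in>{1, -1}. 1 / c_speed A s < collapse_time A \<and>
         ell A s (1 / c_speed A s) = s \<and> ell A s (collapse_time A) = 0) \<and>
      strict_antimono_on {1 / c_speed A 1 / \<alpha>..collapse_time A / \<alpha>} (\<lambda>t. ell A 1 (\<alpha> * t)) \<and>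
      strict_mono_on {1 / c_speed A (-1) / \<alpha>..collapse_time A / \<alpha>} (\<lambda>t. ell A (-1) (\<alpha> * t)) \<and>
      (\<forall>t\<ge>0. mix_square A \<alpha> `` {t} \<noteq> {} \<longleftrightarrow> 0 < \<alpha> * t \<and> \<alpha> * t < collapse_time A) \<and>
      (\<forall>t. collapse_time A \<le> \<alpha> * t \<longrightarrow>
         (\<forall>x\<in>open_square.
            (snd x > 0 \<longrightarrow> theta_of (z_breve Theta_square A \<alpha> t x) = -1) \<and>
            (snd x < 0 \<longrightarrow> theta_of (z_breve Theta_square A \<alpha> t x) = 1))))"
proof -
  note A = assms(1) and \<alpha> = assms(2,3)
  \<comment> \<open>The collapse time is at least \<open>1\<close>, so the initial branch of the
    profile is excluded here.\<close>
  have "theta_of (z_breve Theta_square A \<alpha> t x) = - sgn (snd x)" if "collapse_time A \<le> \<alpha> * t" for t x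
    using that collapse_time_ge[OF A]
    by (simp add: z_breve_fan_state fan_state_def Theta_square_eq_profile square_profile_def)
  then have final: "\<forall>t. collapse_time A \<le> \<alpha> * t \<longrightarrow> (\<forall>x\<in>open_square.
      (snd x > 0 \<longrightarrow> theta_of (z_breve Theta_square A \<alpha> t x) = -1) \<and>
      (snd x < 0 \<longrightarrow> theta_of (z_breve Theta_square A \<alpha> t x) = 1))"
    by (simp add: sgn_if)
  have "\<exists>!t. is_collapse_time A t" using collapse_time_eq(1)[OF A] by simp
  moreover have "\<forall>s\<in>{1, -1}. \<exists>!f. is_front A s f" using ex1_front(1)[OF A] by blast
  moreover have "\<forall>t\<ge>0. mix_square A \<alpha> `` {t}
        = {x \<in> open_square. - \<alpha> * c_speed A (-1) * t < snd x \<and> snd x < \<alpha> * c_speed A 1 * t}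
      \<longleftrightarrow> \<alpha> * t \<le> min (1 / c_speed A 1) (1 / c_speed A (-1))"
    using mix_square_initial[OF A \<alpha>(1)] by blast
  moreover have "\<forall>s\<in>{1, -1}. 1 / c_speed A s < collapse_time A \<and>
      ell A s (1 / c_speed A s) = s \<and> ell A s (collapse_time A) = 0"
    using ell_touch_collapse[OF A] by blast
  moreover have "\<forall>t\<ge>0. mix_square A \<alpha> `` {t} \<noteq> {} \<longleftrightarrow> 0 < \<alpha> * t \<and> \<alpha> * t < collapse_time A"
    using mix_square_nonempty[OF A] by blast
  ultimately show ?thesis
    by (intro conjI subsolution_plane[OF A \<alpha>] admissible_plane[OF A \<alpha>] subsolution_square[OF A \<alpha>]
        admissible_square[OF A \<alpha>] ell_strict_monotone[OF A \<alpha>(1)] final)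
qed

end
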